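(* The system $\mathsf{Z}_2^\omega+\mathsf{QF\text{-}AC}^{0,1}$ does not prove $\mathsf{BCT}$, where $\mathsf{BCT}$ states: if $(Y_n)_{n\in\mathbb{N}}$ is a sequence of dense open sets of reals, then $\bigcap_{n\in\mathbb{N}}Y_n\neq\emptyset$.
   Context: Metatheory ZFC. Framework: Kohlenbach's higher-order arithmetic with base theory $\mathsf{RCA}_0^\omega$ (variables of all finite types over $\mathbb{N}$; basic arithmetic, combinators, primitive recursor $\mathbf{R}_0$, extensionality, quantifier-free induction, $\mathsf{QF\text{-}AC}^{1,0}$). $\mathsf{QF\text{-}AC}^{0,1}$ is the schema $(\forall n^0)(\exists f^1)A(n,f)\to(\exists F^{0\to1})(\forall n)A(n,F(n))$ for quantifier-free $A$. For $k\ge1$, $\mathsf{S}_k^2$ is the type-2 functional with values in $\{0,1\}$ deciding $\Sigma^1_k$-formulas with function parameters (for $k=0$, $\exists^2$); $\Pi^1_k\text{-}\mathsf{CA}_0^\omega$ is $\mathsf{RCA}_0^\omega$ plus existence of $\mathsf{S}_k^2$, and $\mathsf{Z}_2^\omega=\bigcup_k\Pi^1_k\text{-}\mathsf{CA}_0^\omega$. Reals are fast-converging Cauchy sequences of rationals. A set of reals is given by $Y:\mathbb{R}\to\mathbb{R}$, $x\in Y$ meaning $Y(x)>0$; $Y$ is open if for every $x\in Y$ there is a rational $r>0$ with $B(x,r)\subseteq Y$; dense means it meets every non-empty open interval. *)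

theory Defs
  imports Main
begin

section \<open>The language of finite types\<close>

datatype ty = N | Arr ty ty  (infixr \<open>\<rightarrow>\<close> 70)

abbreviation ty1 :: ty where "ty1 \<equiv> N \<rightarrow> N"
abbreviation ty2 :: ty where "ty2 \<equiv> ty1 \<rightarrow> N"

text \<open>Variables carry their type, so \<open>(i, \<sigma>)\<close> and \<open>(i, \<tau>)\<close> are different variables
  when \<open>\<sigma>\<close> and \<open>\<tau>\<close> differ.\<close>
type_synonym var = "nat \<times> ty"

datatype cst =
    CZero | COne | CPlus | CTimes
  | CPi ty ty
  | CSigma ty ty ty
  | CRec

fun cty :: "cst \<Rightarrow> ty" where
  "cty CZero = N"
| "cty COne = N"
| "cty CPlus = N \<rightarrow> N \<rightarrow> N"
| "cty CTimes = N \<rightarrow> N \<rightarrow> N"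
| "cty (CPi \<rho> \<tau>) = \<rho> \<rightarrow> \<tau> \<rightarrow> \<rho>"
| "cty (CSigma \<delta> \<rho> \<tau>) = (\<delta> \<rightarrow> \<rho> \<rightarrow> \<tau>) \<rightarrow> (\<delta> \<rightarrow> \<rho>) \<rightarrow> \<delta> \<rightarrow> \<tau>"
| "cty CRec = (N \<rightarrow> N \<rightarrow> N) \<rightarrow> N \<rightarrow> N \<rightarrow> N"

datatype trm = Var var | Cst cst | App trm trm  (infixl \<open>\<cdot>\<close> 90)

fun result_ty :: "ty \<Rightarrow> ty" where
  "result_ty N = N"
| "result_ty (\<sigma> \<rightarrow> \<tau>) = \<tau>"

text \<open>\<open>ty_of t\<close> is meaningful for well-typed terms only.\<close>
fun ty_of :: "trm \<Rightarrow> ty" where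
  "ty_of (Var v) = snd v"
| "ty_of (Cst c) = cty c"
| "ty_of (s \<cdot> t) = result_ty (ty_of s)"

fun wft :: "trm \<Rightarrow> bool" where
  "wft (Var v) \<longleftrightarrow> True"
| "wft (Cst c) \<longleftrightarrow> True"
| "wft (s \<cdot> t) \<longleftrightarrow> wft s \<and> wft t \<and> (\<exists>\<tau>. ty_of s = ty_of t \<rightarrow> \<tau>)"

datatype fm =
    EqN trm trm  (infix \<open>\<doteq>\<close> 60)
  | LessN trm trm  (infix \<open>\<prec>\<close> 60)
  | Falsum
  | Imp fm fm  (infixr \<open>\<^bold>\<longrightarrow>\<close> 40)
  | Forall var fm

fun wff :: "fm \<Rightarrow> bool" where
  "wff (s \<doteq> t) \<longleftrightarrow> wft s \<and> wft t \<and> ty_of s = N \<and> ty_of t = N"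
| "wff (s \<prec> t) \<longleftrightarrow> wft s \<and> wft t \<and> ty_of s = N \<and> ty_of t = N"
| "wff Falsum \<longleftrightarrow> True"
| "wff (A \<^bold>\<longrightarrow> B) \<longleftrightarrow> wff A \<and> wff B"
| "wff (Forall v A) \<longleftrightarrow> wff A"

fun qfree :: "fm \<Rightarrow> bool" where
  "qfree (s \<doteq> t) \<longleftrightarrow> True"
| "qfree (s \<prec> t) \<longleftrightarrow> True"
| "qfree Falsum \<longleftrightarrow> True"
| "qfree (A \<^bold>\<longrightarrow> B) \<longleftrightarrow> qfree A \<and> qfree B"
| "qfree (Forall v A) \<longleftrightarrow> False"

definition Neg :: "fm \<Rightarrow> fm"  (\<open>\<^bold>\<not> _\<close> [55] 55) where
  "(\<^bold>\<not> A) = (A \<^bold>\<longrightarrow> Falsum)"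

definition Conj :: "fm \<Rightarrow> fm \<Rightarrow> fm"  (infixr \<open>\<^bold>\<and>\<close> 50) where
  "(A \<^bold>\<and> B) = \<^bold>\<not> (A \<^bold>\<longrightarrow> \<^bold>\<not> B)"

definition Disj :: "fm \<Rightarrow> fm \<Rightarrow> fm"  (infixr \<open>\<^bold>\<or>\<close> 45) where
  "(A \<^bold>\<or> B) = (\<^bold>\<not> A \<^bold>\<longrightarrow> B)"

definition Iff :: "fm \<Rightarrow> fm \<Rightarrow> fm"  (infix \<open>\<^bold>\<longleftrightarrow>\<close> 38) where
  "(A \<^bold>\<longleftrightarrow> B) = ((A \<^bold>\<longrightarrow> B) \<^bold>\<and> (B \<^bold>\<longrightarrow> A))"

definition Exists :: "var \<Rightarrow> fm \<Rightarrow> fm" where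
  "Exists v A = \<^bold>\<not> Forall v (\<^bold>\<not> A)"

fun fvt :: "trm \<Rightarrow> var set" where
  "fvt (Var v) = {v}"
| "fvt (Cst c) = {}"
| "fvt (s \<cdot> t) = fvt s \<union> fvt t"

fun fv :: "fm \<Rightarrow> var set" where
  "fv (s \<doteq> t) = fvt s \<union> fvt t"
| "fv (s \<prec> t) = fvt s \<union> fvt t"
| "fv Falsum = {}"
| "fv (A \<^bold>\<longrightarrow> B) = fv A \<union> fv B"
| "fv (Forall v A) = fv A - {v}"

fun substt :: "var \<Rightarrow> trm \<Rightarrow> trm \<Rightarrow> trm" where
  "substt v t (Var w) = (if w = v then t else Var w)"
| "substt v t (Cst c) = Cst c"
| "substt v t (r \<cdot> s) = substt v t r \<cdot> substt v t s"

fun subst :: "var \<Rightarrow> trm \<Rightarrow> fm \<Rightarrow> fm" where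
  "subst v t (r \<doteq> s) = (substt v t r \<doteq> substt v t s)"
| "subst v t (r \<prec> s) = (substt v t r \<prec> substt v t s)"
| "subst v t Falsum = Falsum"
| "subst v t (A \<^bold>\<longrightarrow> B) = (subst v t A \<^bold>\<longrightarrow> subst v t B)"
| "subst v t (Forall w A) = Forall w (if w = v then A else subst v t A)"

text \<open>\<open>subst\<close> does not rename bound variables; \<open>free_for v t A\<close> says that no free variable of
  \<open>t\<close> is captured when \<open>t\<close> is substituted for \<open>v\<close> in \<open>A\<close>.\<close>
fun free_for :: "var \<Rightarrow> trm \<Rightarrow> fm \<Rightarrow> bool" where
  "free_for v t (r \<doteq> s) \<longleftrightarrow> True"
| "free_for v t (r \<prec> s) \<longleftrightarrow> True"
| "free_for v t Falsum \<longleftrightarrow> True"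
| "free_for v t (A \<^bold>\<longrightarrow> B) \<longleftrightarrow> free_for v t A \<and> free_for v t B"
| "free_for v t (Forall w A) \<longleftrightarrow> v \<notin> fv (Forall w A) \<or> (w \<notin> fvt t \<and> free_for v t A)"

text \<open>\<open>(i, \<sigma>)\<close> does not occur in \<open>t\<close> if \<open>i \<ge> fresh t\<close>.\<close>
fun fresh :: "trm \<Rightarrow> nat" where
  "fresh (Var v) = Suc (fst v)"
| "fresh (Cst c) = 0"
| "fresh (s \<cdot> t) = max (fresh s) (fresh t)"


section \<open>Provability: classical many-sorted first-order logic\<close>

text \<open>A Hilbert calculus. Equality is primitive at type \<open>N\<close> only. Generalisation is unrestricted,
  so free variables in elements of \<open>T\<close> are read universally.\<close>
inductive proves :: "fm set \<Rightarrow> fm \<Rightarrow> bool"  (infix \<open>\<turnstile>\<close> 30) for T :: "fm set" where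
  ax: "A \<in> T \<Longrightarrow> wff A \<Longrightarrow> T \<turnstile> A"
| imp_K: "wff A \<Longrightarrow> wff B \<Longrightarrow> T \<turnstile> A \<^bold>\<longrightarrow> B \<^bold>\<longrightarrow> A"
| imp_S: "wff A \<Longrightarrow> wff B \<Longrightarrow> wff C \<Longrightarrow>
    T \<turnstile> (A \<^bold>\<longrightarrow> B \<^bold>\<longrightarrow> C) \<^bold>\<longrightarrow> (A \<^bold>\<longrightarrow> B) \<^bold>\<longrightarrow> A \<^bold>\<longrightarrow> C"
| dneg: "wff A \<Longrightarrow> T \<turnstile> \<^bold>\<not> \<^bold>\<not> A \<^bold>\<longrightarrow> A"
| all_inst: "wff A \<Longrightarrow> wft t \<Longrightarrow> ty_of t = snd v \<Longrightarrow> free_for v t A \<Longrightarrow>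
    T \<turnstile> Forall v A \<^bold>\<longrightarrow> subst v t A"
| all_dist: "wff A \<Longrightarrow> wff B \<Longrightarrow> v \<notin> fv A \<Longrightarrow>
    T \<turnstile> Forall v (A \<^bold>\<longrightarrow> B) \<^bold>\<longrightarrow> A \<^bold>\<longrightarrow> Forall v B"
| eq_refl: "wft t \<Longrightarrow> ty_of t = N \<Longrightarrow> T \<turnstile> t \<doteq> t"
| eq_subst: "wff A \<Longrightarrow> wft s \<Longrightarrow> wft t \<Longrightarrow> ty_of s = N \<Longrightarrow> ty_of t = N \<Longrightarrow> snd v = N \<Longrightarrow>
    free_for v s A \<Longrightarrow> free_for v t A \<Longrightarrow> T \<turnstile> s \<doteq> t \<^bold>\<longrightarrow> subst v s A \<^bold>\<longrightarrow> subst v t A"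
| mp: "T \<turnstile> A \<^bold>\<longrightarrow> B \<Longrightarrow> T \<turnstile> A \<Longrightarrow> T \<turnstile> B"
| gen: "T \<turnstile> A \<Longrightarrow> T \<turnstile> Forall v A"


section \<open>The base theory\<close>

abbreviation Zero :: trm  (\<open>\<^bold>0\<close>) where "\<^bold>0 \<equiv> Cst CZero"
abbreviation One :: trm  (\<open>\<^bold>1\<close>) where "\<^bold>1 \<equiv> Cst COne"

definition plus_t :: "trm \<Rightarrow> trm \<Rightarrow> trm"  (infixl \<open>\<oplus>\<close> 75) where
  "s \<oplus> t = Cst CPlus \<cdot> s \<cdot> t"

definition times_t :: "trm \<Rightarrow> trm \<Rightarrow> trm"  (infixl \<open>\<otimes>\<close> 80) where
  "s \<otimes> t = Cst CTimes \<cdot> s \<cdot> t"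

definition Rec :: "trm \<Rightarrow> trm \<Rightarrow> trm \<Rightarrow> trm" where
  "Rec f s t = Cst CRec \<cdot> f \<cdot> s \<cdot> t"

text \<open>Equality at higher types is extensional: equality of all values down at type \<open>N\<close>.\<close>
fun eqty :: "ty \<Rightarrow> trm \<Rightarrow> trm \<Rightarrow> fm" where
  "eqty N s t = (s \<doteq> t)"
| "eqty (\<sigma> \<rightarrow> \<tau>) s t =
    (let z = (max (fresh s) (fresh t), \<sigma>) in Forall z (eqty \<tau> (s \<cdot> Var z) (t \<cdot> Var z)))"

definition arith_axioms :: "fm set" where
  "arith_axioms =
    (let m = Var (0, N); n = Var (1, N) in
     { \<^bold>\<not> (n \<oplus> \<^bold>1 \<doteq> \<^bold>0),
       m \<oplus> \<^bold>1 \<doteq> n \<oplus> \<^bold>1 \<^bold>\<longrightarrow> m \<doteq> n,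
       m \<oplus> \<^bold>0 \<doteq> m,
       m \<oplus> (n \<oplus> \<^bold>1) \<doteq> (m \<oplus> n) \<oplus> \<^bold>1,
       m \<otimes> \<^bold>0 \<doteq> \<^bold>0,
       m \<otimes> (n \<oplus> \<^bold>1) \<doteq> (m \<otimes> n) \<oplus> m,
       \<^bold>\<not> (m \<prec> \<^bold>0),
       m \<prec> n \<oplus> \<^bold>1 \<^bold>\<longleftrightarrow> (m \<prec> n \<^bold>\<or> m \<doteq> n) })"

definition combinator_axioms :: "fm set" where
  "combinator_axioms =
    {eqty \<rho> (Cst (CPi \<rho> \<tau>) \<cdot> x \<cdot> y) x | \<rho> \<tau> x y. x = Var (0, \<rho>) \<and> y = Var (1, \<tau>)} \<union>
    {eqty \<tau> (Cst (CSigma \<delta> \<rho> \<tau>) \<cdot> x \<cdot> y \<cdot> z) (x \<cdot> z \<cdot> (y \<cdot> z)) | \<delta> \<rho> \<tau> x y z.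
       x = Var (0, \<delta> \<rightarrow> \<rho> \<rightarrow> \<tau>) \<and> y = Var (1, \<delta> \<rightarrow> \<rho>) \<and> z = Var (2, \<delta>)}"

definition recursor_axioms :: "fm set" where
  "recursor_axioms =
    (let f = Var (0, N \<rightarrow> N \<rightarrow> N); m = Var (0, N); n = Var (1, N) in
     { Rec f m \<^bold>0 \<doteq> m,
       Rec f m (n \<oplus> \<^bold>1) \<doteq> f \<cdot> n \<cdot> Rec f m n })"

definition extensionality_axioms :: "fm set" where
  "extensionality_axioms =
    {eqty \<rho> x y \<^bold>\<longrightarrow> eqty \<tau> (\<phi> \<cdot> x) (\<phi> \<cdot> y) | \<rho> \<tau> x y \<phi>.
       x = Var (0, \<rho>) \<and> y = Var (1, \<rho>) \<and> \<phi> = Var (2, \<rho> \<rightarrow> \<tau>)}"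

definition qf_induction :: "fm set" where
  "qf_induction =
    {subst n \<^bold>0 A \<^bold>\<and> Forall n (A \<^bold>\<longrightarrow> subst n (Var n \<oplus> \<^bold>1) A) \<^bold>\<longrightarrow> Forall n A | n A.
       snd n = N \<and> qfree A \<and> wff A}"

text \<open>The formula \<open>A\<close> may contain further free variables (parameters) of any type.\<close>
definition QF_AC :: "ty \<Rightarrow> ty \<Rightarrow> fm set" where
  "QF_AC \<sigma> \<tau> =
    {Forall x (Exists y A) \<^bold>\<longrightarrow> Exists F (Forall x (subst y (Var F \<cdot> Var x) A)) | x y F A.
       snd x = \<sigma> \<and> snd y = \<tau> \<and> snd F = \<sigma> \<rightarrow> \<tau> \<and> x \<noteq> y \<and> F \<noteq> x \<and> F \<noteq> y \<and>
       F \<notin> fv A \<and> qfree A \<and> wff A}"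

definition RCA0\<omega> :: "fm set" where
  "RCA0\<omega> = arith_axioms \<union> combinator_axioms \<union> recursor_axioms \<union> extensionality_axioms
     \<union> qf_induction \<union> QF_AC ty1 N"


section \<open>Coding by terms\<close>

text \<open>\<open>lam v t\<close> is the usual bracket abstraction of \<open>v\<close> from \<open>t\<close>.\<close>
fun lam :: "var \<Rightarrow> trm \<Rightarrow> trm" where
  "lam v (Var w) =
    (if w = v
     then Cst (CSigma (snd v) (N \<rightarrow> snd v) (snd v)) \<cdot> Cst (CPi (snd v) (N \<rightarrow> snd v))
            \<cdot> Cst (CPi (snd v) N)
     else Cst (CPi (snd w) (snd v)) \<cdot> Var w)"
| "lam v (Cst c) = Cst (CPi (cty c) (snd v)) \<cdot> Cst c"
| "lam v (s \<cdot> t) = Cst (CSigma (snd v) (ty_of t) (ty_of (s \<cdot> t))) \<cdot> lam v s \<cdot> lam v t"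

definition pred_t :: "trm \<Rightarrow> trm" where
  "pred_t t = Rec (Cst (CPi N N)) \<^bold>0 t"

definition monus :: "trm \<Rightarrow> trm \<Rightarrow> trm"  (infixl \<open>\<ominus>\<close> 75) where
  "s \<ominus> t = (let k = (0, N); m = (1, N) in Rec (lam k (lam m (pred_t (Var m)))) s t)"

definition pow2 :: "trm \<Rightarrow> trm" where
  "pow2 t = (let k = (0, N); m = (1, N) in Rec (lam k (lam m (Var m \<oplus> Var m))) \<^bold>1 t)"

text \<open>Integer square root; the summand is \<open>1\<close> if \<open>(m + 1)\<^sup>2 \<le> k + 1\<close>, and \<open>0\<close> otherwise.\<close>
definition sqrt_t :: "trm \<Rightarrow> trm" where
  "sqrt_t t =
    (let k = (0, N); m = (1, N) in
     Rec (lam k (lam m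
       (Var m \<oplus> (\<^bold>1 \<ominus> ((Var m \<oplus> \<^bold>1) \<otimes> (Var m \<oplus> \<^bold>1) \<ominus> (Var k \<oplus> \<^bold>1)))))) \<^bold>0 t)"

text \<open>Pairs are coded by \<open>(a + b)\<^sup>2 + a\<close>, an injection; the projections are total.\<close>
definition pair :: "trm \<Rightarrow> trm \<Rightarrow> trm" where
  "pair s t = (s \<oplus> t) \<otimes> (s \<oplus> t) \<oplus> s"

definition fst_t :: "trm \<Rightarrow> trm" where
  "fst_t q = q \<ominus> sqrt_t q \<otimes> sqrt_t q"

definition snd_t :: "trm \<Rightarrow> trm" where
  "snd_t q = sqrt_t q \<ominus> fst_t q"

text \<open>The code of the initial segment \<open>\<langle>g 0, \<dots>, g (n - 1)\<rangle>\<close>: the empty sequence is coded by \<open>0\<close>,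
  and \<open>u\<close> extended by \<open>a\<close> by \<open>pair u a + 1\<close>.\<close>
definition initseg :: "trm \<Rightarrow> trm \<Rightarrow> trm" where
  "initseg g n =
    (let k = (fresh g, N); m = (Suc (fresh g), N) in
     Rec (lam k (lam m (pair (Var m) (g \<cdot> Var k) \<oplus> \<^bold>1))) \<^bold>0 n)"

fun tuple :: "trm list \<Rightarrow> trm" where
  "tuple [] = \<^bold>0"
| "tuple [t] = t"
| "tuple (t # s # ts) = pair t (tuple (s # ts))"


section \<open>The functionals deciding \<open>\<Sigma>\<^sup>1\<^sub>k\<close>-formulas, and \<open>Z\<^sub>2\<^sup>\<omega>\<close>\<close>

text \<open>Alternating function quantifiers over the listed variables, followed by a number quantifier
  over \<open>n\<close> of the next kind; the first quantifier is existential iff \<open>b\<close>.\<close>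
fun alternate :: "bool \<Rightarrow> var list \<Rightarrow> var \<Rightarrow> fm \<Rightarrow> fm" where
  "alternate b [] n A = (if b then Exists n A else Forall n A)"
| "alternate b (g # gs) n A =
    (if b then Exists g (alternate False gs n A) else Forall g (alternate True gs n A))"

text \<open>The Kleene normal form of \<open>\<Sigma>\<^sup>1\<^sub>k\<close>-formulas with function parameter \<open>f\<close>:
  \<open>(\<exists>g\<^sub>1)(\<forall>g\<^sub>2)\<dots>(Qn) f(\<langle>g\<^sub>1|n, \<dots>, g\<^sub>k|n\<rangle>) = 0\<close>,
  and \<open>(\<exists>n) f(n) = 0\<close> for \<open>k = 0\<close>. The parameter \<open>f\<close> is the variable \<open>(0, ty1)\<close>.\<close>
definition Sigma1_normal :: "nat \<Rightarrow> fm" where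
  "Sigma1_normal k =
    (let f = Var (0, ty1); n = (0, N); gs = map (\<lambda>i. (i, ty1)) [1..<Suc k];
         u = (if k = 0 then Var n else tuple (map (\<lambda>g. initseg (Var g) (Var n)) gs))
     in alternate True gs n (f \<cdot> u \<doteq> \<^bold>0))"

text \<open>Existence of \<open>S\<^sub>k\<^sup>2\<close>, with value \<open>0\<close> for truth as usual; for \<open>k = 0\<close> this is \<open>\<exists>\<^sup>2\<close>.\<close>
definition exists_S :: "nat \<Rightarrow> fm" where
  "exists_S k =
    (let S = (0, ty2); f = (0, ty1) in
     Exists S (Forall f
       ((Var S \<cdot> Var f \<doteq> \<^bold>0 \<^bold>\<or> Var S \<cdot> Var f \<doteq> \<^bold>1) \<^bold>\<and>
        (Sigma1_normal k \<^bold>\<longleftrightarrow> Var S \<cdot> Var f \<doteq> \<^bold>0))))"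

definition Pi1_CA0\<omega> :: "nat \<Rightarrow> fm set" where
  "Pi1_CA0\<omega> k = RCA0\<omega> \<union> {exists_S k}"

definition Z2\<omega> :: "fm set" where
  "Z2\<omega> = (\<Union>k. Pi1_CA0\<omega> k)"


section \<open>Rationals and reals\<close>

text \<open>A number \<open>q = pair (pair a b) c\<close> codes the rational \<open>(a - b) / (c + 1)\<close>. Since the projections
  are total, every number codes a rational. The code \<open>0\<close> denotes the rational \<open>0\<close>.\<close>
definition num_pos :: "trm \<Rightarrow> trm" where "num_pos q = fst_t (fst_t q)"
definition num_neg :: "trm \<Rightarrow> trm" where "num_neg q = snd_t (fst_t q)"
definition den :: "trm \<Rightarrow> trm" where "den q = snd_t q \<oplus> \<^bold>1"

definition mkrat :: "trm \<Rightarrow> trm \<Rightarrow> trm \<Rightarrow> trm" where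
  \<comment> \<open>\<open>(a - b) / d\<close>, for \<open>d > 0\<close>\<close>
  "mkrat a b d = pair (pair a b) (pred_t d)"

definition ratless :: "trm \<Rightarrow> trm \<Rightarrow> fm"  (infix \<open>\<prec>\<^sub>Q\<close> 60) where
  "(q \<prec>\<^sub>Q r) = (num_pos q \<otimes> den r \<oplus> num_neg r \<otimes> den q \<prec> num_pos r \<otimes> den q \<oplus> num_neg q \<otimes> den r)"

definition ratle :: "trm \<Rightarrow> trm \<Rightarrow> fm"  (infix \<open>\<preceq>\<^sub>Q\<close> 60) where
  "(q \<preceq>\<^sub>Q r) = \<^bold>\<not> (r \<prec>\<^sub>Q q)"

definition ratadd :: "trm \<Rightarrow> trm \<Rightarrow> trm"  (infixl \<open>\<oplus>\<^sub>Q\<close> 75) where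
  "q \<oplus>\<^sub>Q r = mkrat (num_pos q \<otimes> den r \<oplus> num_pos r \<otimes> den q)
                (num_neg q \<otimes> den r \<oplus> num_neg r \<otimes> den q) (den q \<otimes> den r)"

definition ratneg :: "trm \<Rightarrow> trm" where
  "ratneg q = mkrat (num_neg q) (num_pos q) (den q)"

definition ratabs :: "trm \<Rightarrow> trm" where
  "ratabs q = mkrat ((num_pos q \<ominus> num_neg q) \<oplus> (num_neg q \<ominus> num_pos q)) \<^bold>0 (den q)"

definition ratdist :: "trm \<Rightarrow> trm \<Rightarrow> trm" where
  "ratdist q r = ratabs (q \<oplus>\<^sub>Q ratneg r)"

definition half_pow :: "trm \<Rightarrow> trm" where
  \<comment> \<open>\<open>2\<^sup>-\<^sup>n\<close>\<close>
  "half_pow n = mkrat \<^bold>1 \<^bold>0 (pow2 n)"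

definition twice_half_pow :: "trm \<Rightarrow> trm" where
  \<comment> \<open>\<open>2\<^sup>-\<^sup>n\<^sup>+\<^sup>1\<close>\<close>
  "twice_half_pow n = mkrat (\<^bold>1 \<oplus> \<^bold>1) \<^bold>0 (pow2 n)"

text \<open>Reals are type-1 objects \<open>x\<close> with \<open>|x\<^sub>n - x\<^sub>n\<^sub>+\<^sub>i| < 2\<^sup>-\<^sup>n\<close> for all \<open>n, i\<close>; they are equal when
  \<open>|x\<^sub>n - y\<^sub>n| \<le> 2\<^sup>-\<^sup>n\<^sup>+\<^sup>1\<close> for all \<open>n\<close>, and \<open>x < y\<close> when \<open>x\<^sub>n + 2\<^sup>-\<^sup>n\<^sup>+\<^sup>1 < y\<^sub>n\<close> for some \<open>n\<close>.\<close>
definition is_real :: "trm \<Rightarrow> fm" where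
  "is_real x =
    (let n = (fresh x, N); i = (Suc (fresh x), N) in
     Forall n (Forall i
       (ratdist (x \<cdot> Var n) (x \<cdot> (Var n \<oplus> Var i)) \<prec>\<^sub>Q half_pow (Var n))))"

definition realeq :: "trm \<Rightarrow> trm \<Rightarrow> fm"  (infix \<open>\<doteq>\<^sub>R\<close> 60) where
  "(x \<doteq>\<^sub>R y) =
    (let n = (max (fresh x) (fresh y), N) in
     Forall n (ratdist (x \<cdot> Var n) (y \<cdot> Var n) \<preceq>\<^sub>Q twice_half_pow (Var n)))"

definition realless :: "trm \<Rightarrow> trm \<Rightarrow> fm"  (infix \<open>\<prec>\<^sub>R\<close> 60) where
  "(x \<prec>\<^sub>R y) =
    (let n = (max (fresh x) (fresh y), N) in
     Exists n (x \<cdot> Var n \<oplus>\<^sub>Q twice_half_pow (Var n) \<prec>\<^sub>Q y \<cdot> Var n))"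

definition real_of_ratcode :: "trm \<Rightarrow> trm" where
  "real_of_ratcode q = Cst (CPi N N) \<cdot> q"

text \<open>\<open>|x - y|\<close>; the shift of the index makes the result converge fast again.\<close>
definition realdist :: "trm \<Rightarrow> trm \<Rightarrow> trm" where
  "realdist x y =
    (let n = (max (fresh x) (fresh y), N) in
     lam n (ratdist (x \<cdot> (Var n \<oplus> \<^bold>1)) (y \<cdot> (Var n \<oplus> \<^bold>1))))"

definition ForallR :: "var \<Rightarrow> fm \<Rightarrow> fm" where
  "ForallR x A = Forall x (is_real (Var x) \<^bold>\<longrightarrow> A)"

definition ExistsR :: "var \<Rightarrow> fm \<Rightarrow> fm" where
  "ExistsR x A = Exists x (is_real (Var x) \<^bold>\<and> A)"


section \<open>The Baire category theorem as a formula\<close>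

text \<open>\<open>Y\<close> of type \<open>1 \<rightarrow> 1\<close> represents a function on the reals.\<close>
definition real_function :: "trm \<Rightarrow> fm" where
  "real_function Y =
    (let x = (fresh Y, ty1); y = (Suc (fresh Y), ty1) in
     ForallR x (is_real (Y \<cdot> Var x)) \<^bold>\<and>
     ForallR x (ForallR y (Var x \<doteq>\<^sub>R Var y \<^bold>\<longrightarrow> Y \<cdot> Var x \<doteq>\<^sub>R Y \<cdot> Var y)))"

definition mem_R :: "trm \<Rightarrow> trm \<Rightarrow> fm"  (infix \<open>\<epsilon>\<close> 60) where
  "(x \<epsilon> Y) = (real_of_ratcode \<^bold>0 \<prec>\<^sub>R Y \<cdot> x)"

definition open_R :: "trm \<Rightarrow> fm" where
  "open_R Y =
    (let x = (fresh Y, ty1); y = (Suc (fresh Y), ty1); r = (fresh Y, N) in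
     ForallR x (Var x \<epsilon> Y \<^bold>\<longrightarrow>
       Exists r (\<^bold>0 \<prec>\<^sub>Q Var r \<^bold>\<and>
         ForallR y (realdist (Var x) (Var y) \<prec>\<^sub>R real_of_ratcode (Var r) \<^bold>\<longrightarrow> Var y \<epsilon> Y))))"

definition dense_R :: "trm \<Rightarrow> fm" where
  "dense_R Y =
    (let a = (fresh Y, ty1); b = (Suc (fresh Y), ty1); x = (Suc (Suc (fresh Y)), ty1) in
     ForallR a (ForallR b (Var a \<prec>\<^sub>R Var b \<^bold>\<longrightarrow>
       ExistsR x (Var a \<prec>\<^sub>R Var x \<^bold>\<and> Var x \<prec>\<^sub>R Var b \<^bold>\<and> Var x \<epsilon> Y))))"

definition BCT :: fm where
  "BCT =
    (let Y = (0, N \<rightarrow> ty1 \<rightarrow> ty1); n = (0, N); x = (0, ty1) in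
     Forall Y
       (Forall n (real_function (Var Y \<cdot> Var n) \<^bold>\<and> open_R (Var Y \<cdot> Var n) \<^bold>\<and> dense_R (Var Y \<cdot> Var n))
        \<^bold>\<longrightarrow> ExistsR x (Forall n (Var x \<epsilon> Var Y \<cdot> Var n))))"

end

theory Submission
  imports Defs Complex_Main "HOL-Library.Infinite_Set" "HOL-Library.Nat_Bijection"
begin

text \<open>The idea is to force a generic injection \<open>G\<close> of the reals into \<open>\<nat>\<close>. A condition is an
  injective partial map from reals to \<open>\<nat>\<close> together with an infinite set of spare values, the only
  ones that an extension may use. Objects of finite type are closed combinatory terms with oracles
  that may consult \<open>G\<close>. The value of such a term depends on the map of a condition, never on its
  spare values; hence countably many requirements can be met at once by splitting the spare values
  into infinite pieces. So no new elements of \<open>\<nat>\<^sup>\<nat>\<close> are added, the functionals \<open>S\<^sub>k\<^sup>2\<close>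
  are the true ones, and quantifier-free choice holds. On the other hand the sets \<open>{x. n \<le> G x}\<close>
  are forced to have finite complements, hence to be open and dense, while their intersection is
  empty.\<close>

section \<open>Conditions\<close>

text \<open>Partial injections alone would not do: along a chain they may use up all of
  \<open>nat\<close>. Reserving an infinite set of values repairs single extensions, but the
  reserves of a decreasing sequence of conditions may have empty intersection, so the order is not
  closed under countable descent. Fusion replaces closure, and it serves only requirements that look
  at the map. This dictates what the model may contain. That a number is not a value of
  \<open>G\<close> is settled by the reserve alone, so the range of \<open>G\<close> would be a new
  set of numbers; oracles that see nothing but the map cannot compute it. The same feature protects
  the model from its own choice principle. If every number were a value of \<open>G\<close>, choice
  from numbers to functions would invert \<open>G\<close>, enumerate the reals and contradict
  Cantor.\<close>

lemma map_le_SomeD: "p \<subseteq>\<^sub>m q \<Longrightarrow> p x = Some y \<Longrightarrow> q x = Some y"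
  unfolding map_le_def by (metis domI)

text \<open>Injectivity into \<open>nat\<close> makes the domain of the map countable, but it may be
  infinite: fusion adds infinitely many values at once. The infinite reserve guarantees that every
  further real can still receive a value.\<close>

typedef cond = "{(p :: real \<rightharpoonup> nat, E :: nat set). inj_on p (dom p) \<and> infinite E \<and> ran p \<inter> E = {}}"
  by (intro exI[of _ "(Map.empty, UNIV)"]) auto

definition pos :: "cond \<Rightarrow> real \<rightharpoonup> nat" where "pos P = fst (Rep_cond P)"
definition spare :: "cond \<Rightarrow> nat set" where "spare P = snd (Rep_cond P)"

lemma inj_on_pos: "inj_on (pos P) (dom (pos P))"
  and infinite_spare: "infinite (spare P)"
  and ran_pos_spare: "ran (pos P) \<inter> spare P = {}"
  using Rep_cond[of P] by (auto simp: pos_def spare_def split: prod.splits)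

lemma ex_cond:
  assumes "inj_on p (dom p)" "infinite E" "ran p \<inter> E = {}"
  obtains P where "pos P = p" "spare P = E"
proof
  show "pos (Abs_cond (p, E)) = p" "spare (Abs_cond (p, E)) = E"
    using assms by (simp_all add: pos_def spare_def Abs_cond_inverse)
qed

instantiation cond :: preorder
begin

text \<open>The reserve may shrink by more than the values that are used. A number that leaves it
  without entering the range is excluded as a value forever; this is how the set of reals with small
  value gets frozen.\<close>

definition less_eq_cond :: "cond \<Rightarrow> cond \<Rightarrow> bool" where
  "Q \<le> P \<longleftrightarrow> pos P \<subseteq>\<^sub>m pos Q \<and> spare Q \<subseteq> spare P \<and> ran (pos Q) \<subseteq> ran (pos P) \<union> spare P"

definition less_cond :: "cond \<Rightarrow> cond \<Rightarrow> bool" where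
  "Q < P \<longleftrightarrow> Q \<le> P \<and> \<not> P \<le> (Q :: cond)"

instance
proof
  fix P Q R :: cond
  show "P < Q \<longleftrightarrow> P \<le> Q \<and> \<not> Q \<le> P" by (rule less_cond_def)
  show "P \<le> P" by (simp add: less_eq_cond_def)
  assume "P \<le> Q" "Q \<le> R"
  then show "P \<le> R" unfolding less_eq_cond_def using map_le_trans by blast
qed

end

lemma pos_mono: "Q \<le> P \<Longrightarrow> pos P \<subseteq>\<^sub>m pos Q"
  by (simp add: less_eq_cond_def)

section \<open>Splitting the spare values, and fusion\<close>

lemma infinite_split:
  fixes E :: "nat set"
  assumes "infinite E"
  shows "\<exists>C :: nat \<Rightarrow> nat set. (\<forall>i. infinite (C i)) \<and> (\<forall>i. C i \<subseteq> E) \<and>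
    (\<forall>i j. i \<noteq> j \<longrightarrow> C i \<inter> C j = {})"
proof -
  define C where "C i = range (\<lambda>j. enumerate E (prod_encode (i, j)))" for i
  have inj: "enumerate E m = enumerate E n \<Longrightarrow> m = n" for m n
    using assms by (metis enumerate_mono linorder_neqE_nat less_irrefl)
  have "infinite (C i)" for i
  proof -
    have "inj (\<lambda>j. enumerate E (prod_encode (i, j)))"
    proof (rule injI)
      fix x y
      assume "enumerate E (prod_encode (i, x)) = enumerate E (prod_encode (i, y))"
      then have "prod_encode (i, x) = prod_encode (i, y)" by (rule inj)
      then show "x = y" by (simp add: prod_encode_eq)
    qed
    then show ?thesis unfolding C_def using finite_imageD infinite_UNIV_nat by blast
  qed
  moreover have "C i \<subseteq> E" for i
    using enumerate_in_set[OF assms] by (auto simp: C_def)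
  moreover have "C i \<inter> C j = {}" if "i \<noteq> j" for i j
  proof -
    have "prod_encode (i, x) \<noteq> prod_encode (j, y)" for x y
      using that by (simp add: prod_encode_eq)
    then show ?thesis unfolding C_def using inj by blast
  qed
  ultimately show ?thesis by blast
qed

text \<open>Meant for increasing chains. If no \<open>q n\<close> is defined at \<open>x\<close>,
  the \<open>LEAST\<close> is unspecified, but every choice gives \<open>None\<close>.\<close>

definition map_Union :: "(nat \<Rightarrow> 'a \<rightharpoonup> 'b) \<Rightarrow> 'a \<rightharpoonup> 'b" where
  "map_Union q x = q (LEAST n. q n x \<noteq> None) x"

lemma map_Union_upper:
  assumes mono: "\<And>i j. i \<le> j \<Longrightarrow> q i \<subseteq>\<^sub>m q j"
  shows "q n \<subseteq>\<^sub>m map_Union q"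
  unfolding map_le_def
proof
  fix x assume x: "x \<in> dom (q n)"
  let ?k = "LEAST n. q n x \<noteq> None"
  have "q ?k x \<noteq> None" using LeastI[of "\<lambda>n. q n x \<noteq> None" n] x by (simp add: domIff)
  moreover have "?k \<le> n" using Least_le[of "\<lambda>n. q n x \<noteq> None" n] x by (simp add: domIff)
  ultimately show "q n x = map_Union q x"
    using mono[of ?k n] unfolding map_Union_def map_le_def by (metis domIff)
qed

lemma map_Union_SomeD: "map_Union q x = Some y \<Longrightarrow> \<exists>n. q n x = Some y"
  by (auto simp: map_Union_def)

text \<open>Since \<open>X i\<close> depends on the map only, the \<open>i\<close>-th step may consume all of the
  \<open>i\<close>-th piece of the spare values and still leave the other pieces untouched.\<close>
lemma fusion:
  fixes X :: "nat \<Rightarrow> (real \<rightharpoonup> nat) \<Rightarrow> bool"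
  assumes up: "\<And>i p q. X i p \<Longrightarrow> p \<subseteq>\<^sub>m q \<Longrightarrow> X i q"
    and dense: "\<And>i Q. Q \<le> P \<Longrightarrow> \<exists>R\<le>Q. X i (pos R)"
    and "Q \<le> P"
  shows "\<exists>R\<le>Q. \<forall>i. X i (pos R)"
proof -
  obtain C :: "nat \<Rightarrow> nat set" where C: "\<forall>i. infinite (C i)" "\<forall>i. C i \<subseteq> spare Q"
      "\<forall>i j. i \<noteq> j \<longrightarrow> C i \<inter> C j = {}"
    using infinite_split[OF infinite_spare[of Q]] by blast
  \<comment> \<open>Piece 0 is withheld from all stages, hence the indices from 1: it becomes the
    spare set of the limit.\<close>
  define ok where "ok n q \<longleftrightarrow> inj_on q (dom q) \<and> pos Q \<subseteq>\<^sub>m q \<and>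
      ran q \<subseteq> ran (pos Q) \<union> (\<Union>j\<in>{1..n}. C j)" for n and q :: "real \<rightharpoonup> nat"
  have step: "\<exists>q'. ok (Suc n) q' \<and> q \<subseteq>\<^sub>m q' \<and> X n q'" if q: "ok n q" for n q
  proof -
    have "ran q \<inter> C (Suc n) = {}"
    proof -
      have "C (Suc n) \<inter> C j = {}" if "j \<in> {1..n}" for j
        using that C(3) by simp
      then show ?thesis
        using q spec[OF C(2), of "Suc n"] ran_pos_spare[of Q] unfolding ok_def by blast
    qed
    \<comment> \<open>The stage condition is rebuilt with piece \<open>Suc n\<close> as its whole
      reserve. The spare set that \<open>R\<close> is left with is forgotten afterwards, since
      \<open>X n\<close> looks at the map only.\<close>
    then obtain S where S: "pos S = q" "spare S = C (Suc n)"
      using ex_cond[of q "C (Suc n)"] q C(1) by (auto simp: ok_def)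
    have "S \<le> Q"
      using S q C(2) unfolding less_eq_cond_def ok_def by blast
    then obtain R where R: "R \<le> S" "X n (pos R)"
      using dense[of S n] assms(3) order_trans by blast
    have "ran (pos R) \<subseteq> ran (pos Q) \<union> (\<Union>j\<in>{1..n}. C j) \<union> C (Suc n)"
      using R(1) S q unfolding less_eq_cond_def ok_def by blast
    also have "\<dots> = ran (pos Q) \<union> (\<Union>j\<in>{1..Suc n}. C j)"
      by (auto simp: atLeastAtMostSuc_conv)
    finally have "ok (Suc n) (pos R)"
      using R(1) S q inj_on_pos[of R] map_le_trans unfolding less_eq_cond_def ok_def by metis
    then show ?thesis using R S unfolding less_eq_cond_def by metis
  qed
  have "ok 0 (pos Q)" by (simp add: ok_def inj_on_pos)
  then obtain q where q: "\<And>n. ok n (q n)" "\<And>n. q n \<subseteq>\<^sub>m q (Suc n) \<and> X n (q (Suc n))"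
    using dependent_nat_choice[of ok "\<lambda>n q q'. q \<subseteq>\<^sub>m q' \<and> X n q'"] step by metis
  have mono: "i \<le> j \<Longrightarrow> q i \<subseteq>\<^sub>m q j" for i j
    by (induction rule: dec_induct) (auto intro: map_le_trans[OF _ conjunct1[OF q(2)]])
  let ?q = "map_Union q"
  have up_q: "q n \<subseteq>\<^sub>m ?q" for n by (rule map_Union_upper) (rule mono)
  have inj_q: "inj_on ?q (dom ?q)"
  proof (rule inj_onI)
    fix x y assume "x \<in> dom ?q" "y \<in> dom ?q" and eq: "?q x = ?q y"
    then obtain z where z: "?q x = Some z" "?q y = Some z" by auto
    then obtain i j where "q i x = Some z" "q j y = Some z" by (meson map_Union_SomeD)
    then have "q (max i j) x = Some z" "q (max i j) y = Some z"
      using map_le_SomeD[OF mono[of i "max i j"]] map_le_SomeD[OF mono[of j "max i j"]] by simp_all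
    then show "x = y"
      using q(1)[of "max i j"] unfolding ok_def inj_on_def by (metis domI)
  qed
  have ran_q: "ran ?q \<subseteq> ran (pos Q) \<union> (\<Union>j\<in>{1..}. C j)"
  proof
    fix y assume "y \<in> ran ?q"
    then obtain x n where "q n x = Some y" unfolding ran_def using map_Union_SomeD by fast
    then show "y \<in> ran (pos Q) \<union> (\<Union>j\<in>{1..}. C j)"
      using q(1)[of n] unfolding ok_def ran_def by fastforce
  qed
  have "ran ?q \<inter> C 0 = {}"
  proof -
    have "C 0 \<inter> C j = {}" if "j \<in> {1..}" for j
      using that C(3) by simp
    then show ?thesis using ran_q spec[OF C(2), of 0] ran_pos_spare[of Q] by blast
  qed
  \<comment> \<open>The limit lies below \<open>Q\<close> but below none of the stage conditions,
    whose reserves are other pieces. It inherits each \<open>X i\<close> through inclusion of maps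
    alone.\<close>
  then obtain R where R: "pos R = ?q" "spare R = C 0"
    by (rule ex_cond[OF inj_q spec[OF C(1), of 0]])
  have "pos Q \<subseteq>\<^sub>m ?q"
    by (rule map_le_trans[OF _ up_q[of 0]]) (use q(1)[of 0] ok_def in blast)
  then have "R \<le> Q"
    using ran_q C(2) unfolding less_eq_cond_def R by fast
  moreover have "X i (pos R)" for i
    unfolding R by (rule up[OF _ up_q]) (use q(2)[of i] in blast)
  ultimately show ?thesis by blast
qed


section \<open>A term structure with oracles\<close>

text \<open>One format for all higher-type data: number, genuine function, number, then the map of a
  condition. Type-2 functionals fill both numbers with 0; the sequence of sets uses them as its
  index and as the position in a Cauchy sequence. \<open>None\<close> means that the map does not
  settle the answer yet.\<close>

type_synonym orc = "nat \<Rightarrow> (nat \<Rightarrow> nat) \<Rightarrow> nat \<Rightarrow> (real \<rightharpoonup> nat) \<Rightarrow> nat option"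

text \<open>Terms are untyped; types enter through the logical relation. \<open>Fn\<close> is binary
  so that it covers the arithmetical operations as well as every sequence of genuine functions,
  which is what choice from numbers to functions has to produce.\<close>

datatype ctm =
    Num nat
  | Fn "nat \<Rightarrow> nat \<Rightarrow> nat"
  | Or orc
  | Pi
  | Sg
  | Rc
  | Ap ctm ctm  (infixl \<open>\<bullet>\<close> 90)

text \<open>Head contraction only: nothing is reduced inside an argument, which makes the relation
  deterministic.\<close>

inductive step :: "ctm \<Rightarrow> ctm \<Rightarrow> bool" where
  Pi: "step (Pi \<bullet> x \<bullet> y) x"
| Sg: "step (Sg \<bullet> x \<bullet> y \<bullet> z) (x \<bullet> z \<bullet> (y \<bullet> z))"
| Ap: "step s s' \<Longrightarrow> step (s \<bullet> t) (s' \<bullet> t)"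

definition mono_orc :: "orc \<Rightarrow> bool" where
  "mono_orc F \<longleftrightarrow> (\<forall>n g m p q r. F n g m p = Some r \<longrightarrow> p \<subseteq>\<^sub>m q \<longrightarrow> F n g m q = Some r)"

text \<open>The oracle rule has infinitely many premises because a whole function is handed over.
  Monotonicity of \<open>F\<close> is a premise of the rule rather than a condition on terms, so
  that every term evaluates monotonically in the map.\<close>

inductive eval :: "(real \<rightharpoonup> nat) \<Rightarrow> ctm \<Rightarrow> nat \<Rightarrow> bool" for p where
  Num: "eval p (Num n) n"
| Fn: "eval p a m \<Longrightarrow> eval p b n \<Longrightarrow> eval p (Fn h \<bullet> a \<bullet> b) (h m n)"
| Rc0: "eval p n 0 \<Longrightarrow> eval p a m \<Longrightarrow> eval p (Rc \<bullet> f \<bullet> a \<bullet> n) m"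
| RcS: "eval p n (Suc k) \<Longrightarrow> eval p (f \<bullet> Num k \<bullet> (Rc \<bullet> f \<bullet> a \<bullet> Num k)) m \<Longrightarrow>
    eval p (Rc \<bullet> f \<bullet> a \<bullet> n) m"
| Or: "mono_orc F \<Longrightarrow> eval p a n \<Longrightarrow> (\<And>i. eval p (t \<bullet> Num i) (g i)) \<Longrightarrow> eval p b m \<Longrightarrow>
    F n g m p = Some r \<Longrightarrow> eval p (Or F \<bullet> a \<bullet> t \<bullet> b) r"
| step: "step s s' \<Longrightarrow> eval p s' m \<Longrightarrow> eval p s m"

inductive_cases step_NumE[elim!]: "step (Num n) u"
inductive_cases step_FnE[elim!]: "step (Fn f) u"
inductive_cases step_FnE1[elim!]: "step (Fn f \<bullet> a) u"
inductive_cases step_FnE2[elim!]: "step (Fn f \<bullet> a \<bullet> b) u"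
inductive_cases step_OrE[elim!]: "step (Or f) u"
inductive_cases step_OrE1[elim!]: "step (Or f \<bullet> a) u"
inductive_cases step_OrE2[elim!]: "step (Or f \<bullet> a \<bullet> b) u"
inductive_cases step_OrE3[elim!]: "step (Or f \<bullet> a \<bullet> b \<bullet> c) u"
inductive_cases step_RcE[elim!]: "step Rc u"
inductive_cases step_RcE1[elim!]: "step (Rc \<bullet> a) u"
inductive_cases step_RcE2[elim!]: "step (Rc \<bullet> a \<bullet> b) u"
inductive_cases step_RcE3[elim!]: "step (Rc \<bullet> a \<bullet> b \<bullet> c) u"
inductive_cases step_PiE[elim!]: "step Pi u"
inductive_cases step_PiE1[elim!]: "step (Pi \<bullet> a) u"
inductive_cases step_PiE2: "step (Pi \<bullet> a \<bullet> b) u"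
inductive_cases step_SgE[elim!]: "step Sg u"
inductive_cases step_SgE1[elim!]: "step (Sg \<bullet> a) u"
inductive_cases step_SgE2[elim!]: "step (Sg \<bullet> a \<bullet> b) u"
inductive_cases step_SgE3: "step (Sg \<bullet> a \<bullet> b \<bullet> c) u"
inductive_cases step_ApE: "step (s \<bullet> t) u"

lemma step_det: "step s u \<Longrightarrow> step s v \<Longrightarrow> u = v"
proof (induction arbitrary: v rule: step.induct)
  case (Pi x y)
  then show ?case by (rule step_PiE2) blast+
next
  case (Sg x y z)
  then show ?case by (rule step_SgE3) blast+
next
  case (Ap s s' t)
  from Ap.prems show ?case
    by (rule step_ApE) (use Ap in blast)+
qed

lemma not_step[simp]:
  "\<not> step (Num n) u" "\<not> step (Fn h \<bullet> a \<bullet> b) u" "\<not> step (Rc \<bullet> f \<bullet> a \<bullet> b) u"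
  "\<not> step (Or F \<bullet> a \<bullet> t \<bullet> b) u"
  by blast+

lemma eval_Num_iff[simp]: "eval p (Num n) m \<longleftrightarrow> m = n"
  by (auto elim: eval.cases intro: eval.Num eval.Fn eval.Rc0 eval.RcS eval.Or)

inductive_cases eval_FnE: "eval p (Fn f \<bullet> a \<bullet> b) r"
inductive_cases eval_RcE: "eval p (Rc \<bullet> f \<bullet> a \<bullet> n) r"
inductive_cases eval_OrE: "eval p (Or F \<bullet> a \<bullet> t \<bullet> b) r"

lemma eval_Fn_iff:
  "eval p (Fn f \<bullet> a \<bullet> b) r \<longleftrightarrow> (\<exists>m n. eval p a m \<and> eval p b n \<and> r = f m n)"
  by (auto elim!: eval_FnE intro: eval.Fn)

lemma eval_Rc_iff:
  "eval p (Rc \<bullet> f \<bullet> a \<bullet> n) r \<longleftrightarrow> (eval p n 0 \<and> eval p a r) \<or>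
    (\<exists>k. eval p n (Suc k) \<and> eval p (f \<bullet> Num k \<bullet> (Rc \<bullet> f \<bullet> a \<bullet> Num k)) r)"
  by (auto elim!: eval_RcE intro: eval.Rc0 eval.RcS)

lemma eval_Or_iff:
  "eval p (Or F \<bullet> a \<bullet> t \<bullet> b) r \<longleftrightarrow> mono_orc F \<and> (\<exists>n g m. eval p a n \<and>
    (\<forall>i. eval p (t \<bullet> Num i) (g i)) \<and> eval p b m \<and> F n g m p = Some r)"
  by (auto elim!: eval_OrE intro: eval.Or)

lemma eval_step_iff:
  assumes "step s s'"
  shows "eval p s m \<longleftrightarrow> eval p s' m"
proof
  assume "eval p s m"
  then show "eval p s' m"
    using assms by cases (auto dest: step_det)
qed (use assms eval.step in blast)

lemma eval_mono: "eval p a m \<Longrightarrow> p \<subseteq>\<^sub>m q \<Longrightarrow> eval q a m"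
proof (induction rule: eval.induct)
  case (Or F a n t g b m r)
  then have "F n g m q = Some r" unfolding mono_orc_def by blast
  then show ?case using Or by (intro eval.Or[of F q a n t g b m]) auto
next
  case (step s s' m)
  then show ?case using eval.step by blast
qed (blast intro: eval.Num eval.Fn eval.Rc0 eval.RcS)+

lemma eval_det: "eval p a m \<Longrightarrow> eval p a n \<Longrightarrow> m = n"
proof (induction arbitrary: n rule: eval.induct)
  case (Fn a m b n h)
  then show ?case unfolding eval_Fn_iff by blast
next
  case (Rc0 n a m f)
  then show ?case unfolding eval_Rc_iff by blast
next
  case (RcS n k f a m)
  then show ?case unfolding eval_Rc_iff by blast
next
  case (Or F a n t g b m r n')
  from Or.prems obtain n1 g1 m1 where 1: "eval p a n1" "\<And>i. eval p (t \<bullet> Num i) (g1 i)"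
      "eval p b m1" "F n1 g1 m1 p = Some n'"
    by (auto simp: eval_Or_iff)
  moreover have "g = g1" using Or.IH(2) 1(2) by blast
  ultimately show ?case using Or by auto
next
  case (step s s' m)
  then show ?case using eval_step_iff by blast
qed simp


section \<open>A Kripke logical relation\<close>

text \<open>A partial equivalence: \<open>rel P \<sigma> a a\<close> says that \<open>a\<close> is
  an object of type \<open>\<sigma>\<close> at \<open>P\<close>, and relatedness is extensional
  equality. Density in the clause for \<open>N\<close> admits numbers whose value is still to be
  determined by extensions.\<close>

fun rel :: "cond \<Rightarrow> ty \<Rightarrow> ctm \<Rightarrow> ctm \<Rightarrow> bool" where
  "rel P N a b \<longleftrightarrow> (\<forall>Q\<le>P. \<exists>R\<le>Q. \<exists>m. eval (pos R) a m \<and> eval (pos R) b m)"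
| "rel P (\<sigma> \<rightarrow> \<tau>) a b \<longleftrightarrow> (\<forall>Q\<le>P. \<forall>c d. rel Q \<sigma> c d \<longrightarrow> rel Q \<tau> (a \<bullet> c) (b \<bullet> d))"

lemma rel_mono: "rel P \<sigma> a b \<Longrightarrow> Q \<le> P \<Longrightarrow> rel Q \<sigma> a b"
  by (cases \<sigma>; simp; meson order_trans)

lemma rel_sym: "rel P \<sigma> a b \<Longrightarrow> rel P \<sigma> b a"
proof (induction \<sigma> arbitrary: P a b)
  case N
  then show ?case by (simp; blast)
qed auto

lemma rel_trans: "rel P \<sigma> a b \<Longrightarrow> rel P \<sigma> b c \<Longrightarrow> rel P \<sigma> a c"
proof (induction \<sigma> arbitrary: P a b c)
  case N
  show ?case unfolding rel.simps
  proof (intro allI impI)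
    fix Q assume "Q \<le> P"
    then obtain R m where R: "R \<le> Q" "eval (pos R) a m" "eval (pos R) b m"
      using N(1) by auto
    with \<open>Q \<le> P\<close> N(2) obtain S n where S: "S \<le> R" "eval (pos S) b n" "eval (pos S) c n"
      by (meson order_trans rel.simps(1))
    then have "eval (pos S) a m" "n = m"
      using R eval_mono pos_mono eval_det by metis+
    then show "\<exists>R\<le>Q. \<exists>m. eval (pos R) a m \<and> eval (pos R) c m"
      using S R(1) order_trans by blast
  qed
next
  case (Arr \<sigma> \<tau>)
  show ?case unfolding rel.simps
  proof (intro allI impI)
    fix Q d e assume Q: "Q \<le> P" and de: "rel Q \<sigma> d e"
    then have "rel Q \<sigma> d d" using Arr.IH(1) rel_sym by blast
    then show "rel Q \<tau> (a \<bullet> d) (c \<bullet> e)"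
      using Arr.prems Q de Arr.IH(2)[of Q "a \<bullet> d" "b \<bullet> d" "c \<bullet> e"] by auto
  qed
qed

lemma rel_refl1: "rel P \<sigma> a b \<Longrightarrow> rel P \<sigma> a a"
  using rel_sym rel_trans by blast

lemma rel_Ap: "rel P (\<sigma> \<rightarrow> \<tau>) a b \<Longrightarrow> rel P \<sigma> c d \<Longrightarrow> rel P \<tau> (a \<bullet> c) (b \<bullet> d)"
  by simp

text \<open>Local character. It is built into the clause for \<open>N\<close> and passes to arrow
  types because related arguments stay related at stronger conditions.\<close>

lemma rel_dense: "(\<And>Q. Q \<le> P \<Longrightarrow> \<exists>R\<le>Q. rel R \<sigma> a b) \<Longrightarrow> rel P \<sigma> a b"
proof (induction \<sigma> arbitrary: P a b)
  case N
  show ?case unfolding rel.simps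
  proof (intro allI impI)
    fix Q assume "Q \<le> P"
    then obtain R where R: "R \<le> Q" "rel R N a b" using N by blast
    then show "\<exists>R\<le>Q. \<exists>m. eval (pos R) a m \<and> eval (pos R) b m"
      by (meson order_refl order_trans rel.simps(1))
  qed
next
  case (Arr \<sigma> \<tau>)
  show ?case unfolding rel.simps
  proof (intro allI impI)
    fix Q c d assume Q: "Q \<le> P" and cd: "rel Q \<sigma> c d"
    show "rel Q \<tau> (a \<bullet> c) (b \<bullet> d)"
    proof (rule Arr.IH(2))
      fix Q' assume Q': "Q' \<le> Q"
      then obtain R where R: "R \<le> Q'" "rel R (\<sigma> \<rightarrow> \<tau>) a b"
        using Arr.prems Q order_trans by blast
      moreover have "rel R \<sigma> c d" using cd rel_mono R(1) Q' order_trans by blast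
      ultimately show "\<exists>R\<le>Q'. rel R \<tau> (a \<bullet> c) (b \<bullet> d)" by auto
    qed
  qed
qed

text \<open>Application keeps the redex at the head, so arrow types reduce to type \<open>N\<close>,
  where a step does not change the value.\<close>

lemma rel_step: "step a a' \<Longrightarrow> rel P \<sigma> a' b \<Longrightarrow> rel P \<sigma> a b"
proof (induction \<sigma> arbitrary: P a a' b)
  case N
  then show ?case by (simp add: eval_step_iff)
next
  case (Arr \<sigma> \<tau>)
  then show ?case unfolding rel.simps(2) using step.Ap by blast
qed

lemma rel_step2: "step a a' \<Longrightarrow> step b b' \<Longrightarrow> rel P \<sigma> a' b' \<Longrightarrow> rel P \<sigma> a b"
  by (meson rel_step rel_sym)

lemma rel_Num: "rel P N (Num n) (Num n)"
  by auto

lemma rel_N_obtain: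
  assumes "rel P N a b"
  obtains R m where "R \<le> P" "eval (pos R) a m" "eval (pos R) b m"
  using assms by auto

lemma eval_imp_rel: "eval (pos P) a m \<Longrightarrow> rel P N a (Num m)"
  using eval_mono pos_mono by (simp; blast)

section \<open>Constants and oracles as objects of their types\<close>

lemma rel_Pi: "rel P (\<rho> \<rightarrow> \<tau> \<rightarrow> \<rho>) Pi Pi"
  by (auto intro!: rel_step2[OF step.Pi step.Pi] intro: rel_mono)

lemma rel_Sg: "rel P ((\<delta> \<rightarrow> \<rho> \<rightarrow> \<tau>) \<rightarrow> (\<delta> \<rightarrow> \<rho>) \<rightarrow> \<delta> \<rightarrow> \<tau>) Sg Sg"
  unfolding rel.simps(2)[where a = Sg and b = Sg] rel.simps(2)[where a = "Sg \<bullet> x" for x]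
    rel.simps(2)[where a = "Sg \<bullet> x \<bullet> y" for x y]
proof (intro allI impI rel_step2[OF step.Sg step.Sg])
  fix Q x x' Q1 y y' Q2 z z'
  assume "Q \<le> P" "rel Q (\<delta> \<rightarrow> \<rho> \<rightarrow> \<tau>) x x'" "Q1 \<le> Q" "rel Q1 (\<delta> \<rightarrow> \<rho>) y y'"
    "Q2 \<le> Q1" "rel Q2 \<delta> z z'"
  then show "rel Q2 \<tau> (x \<bullet> z \<bullet> (y \<bullet> z)) (x' \<bullet> z' \<bullet> (y' \<bullet> z'))"
    by (meson rel_Ap rel_mono order_trans)
qed

lemma rel_N_denseI:
  assumes "\<And>Q. Q \<le> P \<Longrightarrow> \<exists>R\<le>Q. \<exists>m. eval (pos R) a m \<and> eval (pos R) b m"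
  shows "rel P N a b"
  using assms by simp

lemma rel_Fn: "rel P (N \<rightarrow> N \<rightarrow> N) (Fn f) (Fn f)"
  unfolding rel.simps(2)
proof (intro allI impI rel_N_denseI)
  fix P1 a a' P2 b b' Q
  assume 1: "P1 \<le> P" "rel P1 N a a'" "P2 \<le> P1" "rel P2 N b b'" "Q \<le> P2"
  then obtain R m where R: "R \<le> Q" "eval (pos R) a m" "eval (pos R) a' m"
    by (meson order_trans rel.simps(1))
  then obtain S n where S: "S \<le> R" "eval (pos S) b n" "eval (pos S) b' n"
    using 1 by (meson order_trans rel.simps(1))
  have "eval (pos S) a m" "eval (pos S) a' m" using R S eval_mono pos_mono by blast+
  then show "\<exists>R\<le>Q. \<exists>m. eval (pos R) (Fn f \<bullet> a \<bullet> b) m \<and> eval (pos R) (Fn f \<bullet> a' \<bullet> b') m"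
    using S R(1) order_trans by (metis eval.Fn)
qed

lemma rel_Rc: "rel P ((N \<rightarrow> N \<rightarrow> N) \<rightarrow> N \<rightarrow> N \<rightarrow> N) Rc Rc"
proof -
  \<comment> \<open>The recursion argument becomes a numeral only after an extension, and that
    numeral depends on the extension. Hence the induction is over numerals and is stated for every
    condition.\<close>
  have num: "rel P N (Rc \<bullet> f \<bullet> a \<bullet> Num k) (Rc \<bullet> f' \<bullet> a' \<bullet> Num k)"
    if "rel P (N \<rightarrow> N \<rightarrow> N) f f'" "rel P N a a'" for P f f' a a' k
  proof (induction k)
    case 0
    then show ?case using that(2) by (simp add: eval_Rc_iff)
  next
    case (Suc k)
    have "rel P N (f \<bullet> Num k \<bullet> (Rc \<bullet> f \<bullet> a \<bullet> Num k)) (f' \<bullet> Num k \<bullet> (Rc \<bullet> f' \<bullet> a' \<bullet> Num k))"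
      using rel_Ap rel_Num that(1) Suc by blast
    then show ?case by (simp add: eval_Rc_iff)
  qed
  show ?thesis
    unfolding rel.simps(2)[where a = Rc and b = Rc] rel.simps(2)[where a = "Rc \<bullet> x" for x]
      rel.simps(2)[where a = "Rc \<bullet> x \<bullet> y" for x y]
  proof (intro allI impI rel_N_denseI)
    fix P1 f f' P2 a a' P3 n n' Q
    assume 1: "P1 \<le> P" "rel P1 (N \<rightarrow> N \<rightarrow> N) f f'" "P2 \<le> P1" "rel P2 N a a'"
      "P3 \<le> P2" "rel P3 N n n'" "Q \<le> P3"
    then obtain R k where R: "R \<le> Q" "eval (pos R) n k" "eval (pos R) n' k"
      by (meson order_trans rel.simps(1))
    have "rel R N (Rc \<bullet> f \<bullet> a \<bullet> Num k) (Rc \<bullet> f' \<bullet> a' \<bullet> Num k)"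
      by (rule num) (use 1 R(1) in \<open>meson rel_mono order_trans\<close>)+
    then obtain S m where S: "S \<le> R" "eval (pos S) (Rc \<bullet> f \<bullet> a \<bullet> Num k) m"
        "eval (pos S) (Rc \<bullet> f' \<bullet> a' \<bullet> Num k) m"
      by (rule rel_N_obtain)
    moreover have "eval (pos S) n k" "eval (pos S) n' k"
      using R S(1) eval_mono pos_mono by blast+
    ultimately have "eval (pos S) (Rc \<bullet> f \<bullet> a \<bullet> n) m" "eval (pos S) (Rc \<bullet> f' \<bullet> a' \<bullet> n') m"
      by (auto simp: eval_Rc_iff)
    then show "\<exists>R\<le>Q. \<exists>m. eval (pos R) (Rc \<bullet> f \<bullet> a \<bullet> n) m \<and> eval (pos R) (Rc \<bullet> f' \<bullet> a' \<bullet> n') m"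
      using S(1) R(1) order_trans by blast
  qed
qed

text \<open>This is why no new functions on the numbers arise. Each \<open>i\<close> poses the
  requirement that the map settle a common value at \<open>i\<close>; it persists under larger maps
  and is dense, so fusion meets all of them at once.\<close>

lemma rel_ty1_dense:
  assumes "rel P ty1 t t'" "Q \<le> P"
  shows "\<exists>R\<le>Q. \<exists>g. \<forall>i. eval (pos R) (t \<bullet> Num i) (g i) \<and> eval (pos R) (t' \<bullet> Num i) (g i)"
proof -
  have "\<exists>R\<le>Q. \<forall>i. \<exists>m. eval (pos R) (t \<bullet> Num i) m \<and> eval (pos R) (t' \<bullet> Num i) m"
  proof (rule fusion)
    show "\<exists>m. eval q (t \<bullet> Num i) m \<and> eval q (t' \<bullet> Num i) m"
      if "\<exists>m. eval p (t \<bullet> Num i) m \<and> eval p (t' \<bullet> Num i) m" "p \<subseteq>\<^sub>m q" for i p q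
      using that eval_mono by blast
    show "\<exists>R\<le>Q. \<exists>m. eval (pos R) (t \<bullet> Num i) m \<and> eval (pos R) (t' \<bullet> Num i) m"
      if "Q \<le> P" for i Q
      using rel_Ap[OF assms(1) rel_Num] that by simp
  qed fact
  then show ?thesis by metis
qed

definition total_orc :: "cond \<Rightarrow> orc \<Rightarrow> bool" where
  "total_orc P F \<longleftrightarrow> (\<forall>n g m. \<forall>Q\<le>P. \<exists>R\<le>Q. F n g m (pos R) \<noteq> None)"

text \<open>Totality of \<open>F\<close> speaks of genuine functions \<open>g\<close> only. This
  suffices: by \<open>rel_ty1_dense\<close> two related function arguments densely become one and
  the same \<open>g\<close>, so both sides ask the oracle the same question.\<close>

lemma rel_Or:
  assumes "mono_orc F" "total_orc P F"
  shows "rel P (N \<rightarrow> ty1 \<rightarrow> N \<rightarrow> N) (Or F) (Or F)"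
  unfolding rel.simps(2)[where a = "Or F"] rel.simps(2)[where a = "Or F \<bullet> x" for x]
    rel.simps(2)[where a = "Or F \<bullet> x \<bullet> y" for x y]
proof (intro allI impI rel_N_denseI)
  fix P1 a a' P2 t t' P3 b b' Q
  assume 1: "P1 \<le> P" "rel P1 N a a'" "P2 \<le> P1" "rel P2 ty1 t t'"
    "P3 \<le> P2" "rel P3 N b b'" "Q \<le> P3"
  obtain R n where R: "R \<le> Q" "eval (pos R) a n" "eval (pos R) a' n"
    using 1 by (meson order_trans rel.simps(1))
  obtain S m where S: "S \<le> R" "eval (pos S) b m" "eval (pos S) b' m"
    using 1 R(1) by (meson order_trans rel.simps(1))
  obtain T g where T: "T \<le> S" "\<And>i. eval (pos T) (t \<bullet> Num i) (g i)"
      "\<And>i. eval (pos T) (t' \<bullet> Num i) (g i)"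
    using rel_ty1_dense[OF 1(4), of S] 1 R(1) S(1) order_trans by meson
  have "T \<le> P" using 1 R(1) S(1) T(1) order_trans by meson
  then obtain U r where U: "U \<le> T" "F n g m (pos U) = Some r"
    using assms(2) unfolding total_orc_def by blast
  have "pos R \<subseteq>\<^sub>m pos U" "pos S \<subseteq>\<^sub>m pos U" "pos T \<subseteq>\<^sub>m pos U"
    using R S T U pos_mono order_trans by meson+
  then have "eval (pos U) (Or F \<bullet> a \<bullet> t \<bullet> b) r" "eval (pos U) (Or F \<bullet> a' \<bullet> t' \<bullet> b') r"
    using R S T U assms(1) eval_mono
    by (intro eval.Or[of F _ _ n _ g _ m]; blast)+
  then show "\<exists>R\<le>Q. \<exists>m. eval (pos R) (Or F \<bullet> a \<bullet> t \<bullet> b) m \<and> eval (pos R) (Or F \<bullet> a' \<bullet> t' \<bullet> b') m"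
    using U T S R order_trans by meson
qed

text \<open>\<open>Fn\<close> is binary, so a unary function carries a dummy first argument, filled
  with 0.\<close>

definition std :: "(nat \<Rightarrow> nat) \<Rightarrow> ctm" where
  "std g = Fn (\<lambda>_. g) \<bullet> Num 0"

lemma eval_std[simp]: "eval p (std g \<bullet> a) r \<longleftrightarrow> (\<exists>m. eval p a m \<and> r = g m)"
  by (auto simp: std_def eval_Fn_iff)

lemma rel_std: "rel P ty1 (std g) (std g)"
  unfolding std_def using rel_Fn rel_Ap rel_Num by blast

text \<open>A number argument densely equals a numeral, and self-relatedness of \<open>a\<close> and
  \<open>b\<close> allows the argument to be replaced by it on either side.\<close>

lemma rel_ty1I:
  assumes "\<And>i. rel P N (a \<bullet> Num i) (b \<bullet> Num i)" "rel P ty1 a a" "rel P ty1 b b"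
  shows "rel P ty1 a b"
  unfolding rel.simps(2)
proof (intro allI impI rel_N_denseI)
  fix P1 c d Q assume 1: "P1 \<le> P" "rel P1 N c d" "Q \<le> P1"
  then obtain R m where R: "R \<le> Q" "eval (pos R) c m" "eval (pos R) d m"
    by (meson rel.simps(1))
  have "R \<le> P" using R 1 order_trans by meson
  have "rel R N (a \<bullet> c) (a \<bullet> Num m)" "rel R N (b \<bullet> Num m) (b \<bullet> d)"
    using assms(2,3) \<open>R \<le> P\<close> R eval_imp_rel rel_mono rel_Ap rel_sym by meson+
  then have "rel R N (a \<bullet> c) (b \<bullet> d)"
    using rel_trans rel_mono[OF assms(1) \<open>R \<le> P\<close>] by blast
  then show "\<exists>R\<le>Q. \<exists>m. eval (pos R) (a \<bullet> c) m \<and> eval (pos R) (b \<bullet> d) m"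
    by (rule rel_N_obtain) (use R(1) order_trans in blast)
qed

text \<open>The form in which the absence of new functions is used below: quantifiers over type 1
  can be tested on genuine functions.\<close>

lemma rel_ty1_std:
  assumes "rel P ty1 a a" "Q \<le> P"
  shows "\<exists>R\<le>Q. \<exists>g. rel R ty1 a (std g)"
proof -
  obtain R g where R: "R \<le> Q" "\<And>i. eval (pos R) (a \<bullet> Num i) (g i)"
    using rel_ty1_dense[OF assms] by blast
  have "rel R ty1 a (std g)"
  proof (rule rel_ty1I)
    show "rel R N (a \<bullet> Num i) (std g \<bullet> Num i)" for i
    proof (rule rel_trans[OF eval_imp_rel[OF R(2)]])
      show "rel R N (Num (g i)) (std g \<bullet> Num i)" by auto
    qed
  qed (use assms R rel_mono rel_std order_trans in meson)+
  then show ?thesis using R by blast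
qed


section \<open>Forcing\<close>

fun ccst :: "cst \<Rightarrow> ctm" where
  "ccst CZero = Num 0"
| "ccst COne = Num 1"
| "ccst CPlus = Fn (+)"
| "ccst CTimes = Fn (*)"
| "ccst (CPi \<rho> \<tau>) = Pi"
| "ccst (CSigma \<delta> \<rho> \<tau>) = Sg"
| "ccst CRec = Rc"

fun cl :: "(var \<Rightarrow> ctm) \<Rightarrow> trm \<Rightarrow> ctm" where
  "cl \<rho> (Var v) = \<rho> v"
| "cl \<rho> (Cst c) = ccst c"
| "cl \<rho> (s \<cdot> t) = cl \<rho> s \<bullet> cl \<rho> t"

definition less_rel :: "cond \<Rightarrow> ctm \<Rightarrow> ctm \<Rightarrow> bool" where
  "less_rel P a b \<longleftrightarrow> (\<forall>Q\<le>P. \<exists>R\<le>Q. \<exists>m n. eval (pos R) a m \<and> eval (pos R) b n \<and> m < n)"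

text \<open>In the fragment \<open>\<longrightarrow>\<close>, \<open>\<forall>\<close>, \<open>\<bottom>\<close> weak forcing has the clauses of Kripke semantics, once atomic
  formulas are only required to hold densely. The domains of quantification grow along the order.\<close>
fun forces :: "cond \<Rightarrow> (var \<Rightarrow> ctm) \<Rightarrow> fm \<Rightarrow> bool" where
  "forces P \<rho> (s \<doteq> t) \<longleftrightarrow> rel P N (cl \<rho> s) (cl \<rho> t)"
| "forces P \<rho> (s \<prec> t) \<longleftrightarrow> less_rel P (cl \<rho> s) (cl \<rho> t)"
| "forces P \<rho> Falsum \<longleftrightarrow> False"
| "forces P \<rho> (A \<^bold>\<longrightarrow> B) \<longleftrightarrow> (\<forall>Q\<le>P. forces Q \<rho> A \<longrightarrow> forces Q \<rho> B)"
| "forces P \<rho> (Forall v A) \<longleftrightarrow> (\<forall>Q\<le>P. \<forall>a. rel Q (snd v) a a \<longrightarrow> forces Q (\<rho>(v := a)) A)"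

definition rel_on :: "var set \<Rightarrow> cond \<Rightarrow> (var \<Rightarrow> ctm) \<Rightarrow> (var \<Rightarrow> ctm) \<Rightarrow> bool" where
  "rel_on V P \<rho> \<rho>' \<longleftrightarrow> (\<forall>v\<in>V. rel P (snd v) (\<rho> v) (\<rho>' v))"

definition env :: "cond \<Rightarrow> (var \<Rightarrow> ctm) \<Rightarrow> bool" where
  "env P \<rho> \<longleftrightarrow> rel_on UNIV P \<rho> \<rho>"

definition valid :: "fm \<Rightarrow> bool" where
  "valid A \<longleftrightarrow> (\<forall>P \<rho>. env P \<rho> \<longrightarrow> forces P \<rho> A)"

lemma env_rel: "env P \<rho> \<Longrightarrow> rel P (snd v) (\<rho> v) (\<rho> v)"
  unfolding env_def rel_on_def by blast

lemma rel_on_mono: "rel_on V P \<rho> \<rho>' \<Longrightarrow> Q \<le> P \<Longrightarrow> rel_on V Q \<rho> \<rho>'"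
  unfolding rel_on_def using rel_mono by blast

lemma env_mono: "env P \<rho> \<Longrightarrow> Q \<le> P \<Longrightarrow> env Q \<rho>"
  unfolding env_def by (rule rel_on_mono)

lemma env_upd: "env P \<rho> \<Longrightarrow> rel P (snd v) a a \<Longrightarrow> env P (\<rho>(v := a))"
  unfolding env_def rel_on_def by (metis fun_upd_apply)

lemma rel_on_upd: "rel_on (V - {v}) P \<rho> \<rho>' \<Longrightarrow> rel P (snd v) a b \<Longrightarrow>
    rel_on V P (\<rho>(v := a)) (\<rho>'(v := b))"
  by (auto simp: rel_on_def)

lemma env_rel_on: "env P \<rho> \<Longrightarrow> rel_on V P \<rho> \<rho>"
  by (auto simp: env_def rel_on_def)

lemma rel_ccst: "rel P (cty c) (ccst c) (ccst c)"
  by (cases c) (simp_all only: cty.simps ccst.simps rel_Num rel_Fn rel_Pi rel_Sg rel_Rc)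

text \<open>The fundamental lemma of the logical relation: constants are self-related, and
  application preserves relatedness.\<close>

lemma rel_cl: "wft t \<Longrightarrow> rel_on (fvt t) P \<rho> \<rho>' \<Longrightarrow> rel P (ty_of t) (cl \<rho> t) (cl \<rho>' t)"
proof (induction t)
  case (App s t)
  then obtain \<tau> where \<tau>: "ty_of s = ty_of t \<rightarrow> \<tau>" by auto
  have "rel P (ty_of t \<rightarrow> \<tau>) (cl \<rho> s) (cl \<rho>' s)" "rel P (ty_of t) (cl \<rho> t) (cl \<rho>' t)"
    using App \<tau> by (auto simp: rel_on_def)
  then show ?case using rel_Ap \<tau> by simp
qed (auto simp: rel_on_def rel_ccst simp del: rel.simps)

lemma rel_cl_env: "wft t \<Longrightarrow> ty_of t = \<sigma> \<Longrightarrow> env P \<rho> \<Longrightarrow> rel P \<sigma> (cl \<rho> t) (cl \<rho> t)"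
  using rel_cl env_rel_on by blast

lemma less_rel_mono: "less_rel P a b \<Longrightarrow> Q \<le> P \<Longrightarrow> less_rel Q a b"
  unfolding less_rel_def using order_trans by blast

lemma less_rel_dense: "(\<And>Q. Q \<le> P \<Longrightarrow> \<exists>R\<le>Q. less_rel R a b) \<Longrightarrow> less_rel P a b"
  unfolding less_rel_def by (meson order_refl order_trans)

lemma less_rel_cong:
  assumes "less_rel P a b" "rel P N a a'" "rel P N b b'"
  shows "less_rel P a' b'"
  unfolding less_rel_def
proof (intro allI impI)
  fix Q assume Q: "Q \<le> P"
  obtain R m n where R: "R \<le> Q" "eval (pos R) a m" "eval (pos R) b n" "m < n"
    using assms(1) Q unfolding less_rel_def by blast
  obtain S k where S: "S \<le> R" "eval (pos S) a k" "eval (pos S) a' k"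
    using assms(2) Q R(1) by (meson order_trans rel.simps(1))
  obtain T l where T: "T \<le> S" "eval (pos T) b l" "eval (pos T) b' l"
    using assms(3) Q R(1) S(1) by (meson order_trans rel.simps(1))
  have "T \<le> R" using S T order_trans by blast
  then have "l = n" using R T eval_mono pos_mono eval_det by metis
  moreover have "k = m" using R S eval_mono pos_mono eval_det by metis
  moreover have "eval (pos T) a' k" using S T eval_mono pos_mono by blast
  ultimately show "\<exists>R\<le>Q. \<exists>m n. eval (pos R) a' m \<and> eval (pos R) b' n \<and> m < n"
    using T \<open>T \<le> R\<close> R(1,4) order_trans by blast
qed

lemma forces_mono: "forces P \<rho> A \<Longrightarrow> Q \<le> P \<Longrightarrow> forces Q \<rho> A"
proof (induction A arbitrary: P Q \<rho>)
  case (EqN s t)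
  then show ?case unfolding forces.simps by (rule rel_mono)
next
  case (LessN s t)
  then show ?case unfolding forces.simps by (rule less_rel_mono)
next
  case (Imp A B)
  then show ?case unfolding forces.simps using order_trans by blast
next
  case (Forall v A)
  then show ?case unfolding forces.simps using order_trans by blast
qed simp

text \<open>Local character of forcing, and the source of classical logic: if no extension forces
  the negation of a formula, the formula is forced densely, hence forced.\<close>

lemma forces_dense: "(\<And>Q. Q \<le> P \<Longrightarrow> \<exists>R\<le>Q. forces R \<rho> A) \<Longrightarrow> forces P \<rho> A"
proof (induction A arbitrary: P \<rho>)
  case (EqN s t)
  then show ?case unfolding forces.simps by (rule rel_dense)
next
  case (LessN s t)
  then show ?case unfolding forces.simps by (rule less_rel_dense)
next
  case Falsum
  then show ?case by auto
next
  case (Imp A B)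
  show ?case unfolding forces.simps
  proof (intro allI impI)
    fix Q assume Q: "Q \<le> P" "forces Q \<rho> A"
    show "forces Q \<rho> B"
    proof (rule Imp.IH(2))
      fix Q' assume Q': "Q' \<le> Q"
      then obtain R where R: "R \<le> Q'" "forces R \<rho> (A \<^bold>\<longrightarrow> B)"
        using Imp.prems Q(1) order_trans by blast
      moreover have "forces R \<rho> A" using Q(2) Q' R(1) forces_mono order_trans by blast
      ultimately show "\<exists>R\<le>Q'. forces R \<rho> B" by auto
    qed
  qed
next
  case (Forall v A)
  show ?case unfolding forces.simps
  proof (intro allI impI)
    fix Q a assume Q: "Q \<le> P" "rel Q (snd v) a a"
    show "forces Q (\<rho>(v := a)) A"
    proof (rule Forall.IH)
      fix Q' assume Q': "Q' \<le> Q"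
      then obtain R where R: "R \<le> Q'" "forces R \<rho> (Forall v A)"
        using Forall.prems Q(1) order_trans by blast
      moreover have "rel R (snd v) a a" using Q(2) Q' R(1) rel_mono order_trans by blast
      ultimately show "\<exists>R\<le>Q'. forces R (\<rho>(v := a)) A" by auto
    qed
  qed
qed

lemma forces_cong: "wff A \<Longrightarrow> rel_on (fv A) P \<rho> \<rho>' \<Longrightarrow> forces P \<rho> A \<longleftrightarrow> forces P \<rho>' A"
proof (induction A arbitrary: P \<rho> \<rho>')
  case (EqN s t)
  then have "rel P N (cl \<rho> s) (cl \<rho>' s)" "rel P N (cl \<rho> t) (cl \<rho>' t)"
    using rel_cl[of s P \<rho> \<rho>'] rel_cl[of t P \<rho> \<rho>'] by (auto simp: rel_on_def)
  then show ?case unfolding forces.simps by (meson rel_sym rel_trans)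
next
  case (LessN s t)
  then have "rel P N (cl \<rho> s) (cl \<rho>' s)" "rel P N (cl \<rho> t) (cl \<rho>' t)"
    using rel_cl[of s P \<rho> \<rho>'] rel_cl[of t P \<rho> \<rho>'] by (auto simp: rel_on_def)
  then show ?case unfolding forces.simps by (meson rel_sym less_rel_cong)
next
  case (Imp A B)
  have "forces Q \<rho> A \<longleftrightarrow> forces Q \<rho>' A" "forces Q \<rho> B \<longleftrightarrow> forces Q \<rho>' B" if "Q \<le> P" for Q
    using Imp rel_on_mono[OF _ that] by (auto simp: rel_on_def)
  then show ?case by simp
next
  case (Forall v A)
  have "forces Q (\<rho>(v := a)) A \<longleftrightarrow> forces Q (\<rho>'(v := a)) A" if "Q \<le> P" "rel Q (snd v) a a" for Q a
    using Forall that by (intro Forall.IH rel_on_upd) (auto intro: rel_on_mono)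
  then show ?case by auto
qed simp

lemma cl_coincidence: "(\<And>v. v \<in> fvt t \<Longrightarrow> \<rho> v = \<rho>' v) \<Longrightarrow> cl \<rho> t = cl \<rho>' t"
  by (induction t) auto

text \<open>Literal equality of values, as opposed to relatedness in \<open>forces_cong\<close>; it
  serves to reassign variables that do not occur free.\<close>

lemma forces_coincidence: "(\<And>v. v \<in> fv A \<Longrightarrow> \<rho> v = \<rho>' v) \<Longrightarrow> forces P \<rho> A \<longleftrightarrow> forces P \<rho>' A"
proof (induction A arbitrary: P \<rho> \<rho>')
  case (EqN s t)
  then show ?case using cl_coincidence[of s \<rho> \<rho>'] cl_coincidence[of t \<rho> \<rho>'] by simp
next
  case (LessN s t)
  then show ?case using cl_coincidence[of s \<rho> \<rho>'] cl_coincidence[of t \<rho> \<rho>'] by simp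
next
  case (Imp A B)
  have "forces Q \<rho> A \<longleftrightarrow> forces Q \<rho>' A" "forces Q \<rho> B \<longleftrightarrow> forces Q \<rho>' B" for Q
    by (intro Imp.IH; use Imp.prems in auto)+
  then show ?case by simp
next
  case (Forall v A)
  have "forces Q (\<rho>(v := a)) A \<longleftrightarrow> forces Q (\<rho>'(v := a)) A" for Q a
    by (rule Forall.IH) (use Forall.prems in auto)
  then show ?case by simp
qed simp

lemma cl_substt: "cl \<rho> (substt v t s) = cl (\<rho>(v := cl \<rho> t)) s"
  by (induction s) auto

lemma subst_fresh: "v \<notin> fv A \<Longrightarrow> subst v t A = A"
proof (induction A)
  have substt_fresh: "v \<notin> fvt s \<Longrightarrow> substt v t s = s" for s by (induction s) auto
  { case EqN then show ?case using substt_fresh by auto }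
  { case LessN then show ?case using substt_fresh by auto }
qed auto

lemma forces_subst: "free_for v t A \<Longrightarrow> forces P \<rho> (subst v t A) \<longleftrightarrow> forces P (\<rho>(v := cl \<rho> t)) A"
proof (induction A arbitrary: P \<rho>)
  case (Forall w A)
  show ?case
  proof (cases "v \<notin> fv (Forall w A)")
    \<comment> \<open>Here \<open>free_for\<close> says nothing about capture, but the substitution
      leaves the formula unchanged.\<close>
    case True
    then show ?thesis
      unfolding subst_fresh[OF True] by (intro forces_coincidence) auto
  next
    case False
    then have w: "w \<noteq> v" "w \<notin> fvt t" "free_for v t A" using Forall.prems by auto
    then have "cl (\<rho>(w := a)) t = cl \<rho> t" for a by (intro cl_coincidence) auto
    then show ?thesis
      using Forall.IH[OF w(3)] w(1) by (simp add: fun_upd_twist[OF w(1)] del: fun_upd_apply)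
  qed
qed (auto simp: cl_substt)

section \<open>Defined connectives and soundness\<close>

lemma forces_Neg: "forces P \<rho> (\<^bold>\<not> A) \<longleftrightarrow> (\<forall>Q\<le>P. \<not> forces Q \<rho> A)"
  by (simp add: Neg_def)

lemma forces_Conj: "forces P \<rho> (A \<^bold>\<and> B) \<longleftrightarrow> forces P \<rho> A \<and> forces P \<rho> B"
proof
  assume *: "forces P \<rho> (A \<^bold>\<and> B)"
  have "\<exists>R\<le>Q. forces R \<rho> A \<and> forces R \<rho> B" if "Q \<le> P" for Q
    using * that by (auto simp: Conj_def forces_Neg) (meson forces_mono order_trans)
  then show "forces P \<rho> A \<and> forces P \<rho> B"
    by (meson forces_dense)
next
  assume *: "forces P \<rho> A \<and> forces P \<rho> B"
  then show "forces P \<rho> (A \<^bold>\<and> B)"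
    unfolding Conj_def forces_Neg forces.simps using forces_mono order_refl by blast
qed

lemma forces_Iff: "forces P \<rho> (A \<^bold>\<longleftrightarrow> B) \<longleftrightarrow> (\<forall>Q\<le>P. forces Q \<rho> A \<longleftrightarrow> forces Q \<rho> B)"
  unfolding Iff_def forces_Conj by auto

lemma forces_Disj:
  "forces P \<rho> (A \<^bold>\<or> B) \<longleftrightarrow> (\<forall>Q\<le>P. \<exists>R\<le>Q. forces R \<rho> A \<or> forces R \<rho> B)"
proof
  assume *: "forces P \<rho> (A \<^bold>\<or> B)"
  show "\<forall>Q\<le>P. \<exists>R\<le>Q. forces R \<rho> A \<or> forces R \<rho> B"
    using * unfolding Disj_def forces.simps forces_Neg by (meson order_refl)
next
  assume *: "\<forall>Q\<le>P. \<exists>R\<le>Q. forces R \<rho> A \<or> forces R \<rho> B"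
  show "forces P \<rho> (A \<^bold>\<or> B)"
    unfolding Disj_def forces.simps forces_Neg
  proof (intro allI impI forces_dense)
    fix Q Q' assume "Q \<le> P" "\<forall>R\<le>Q. \<not> forces R \<rho> A" "Q' \<le> Q"
    then show "\<exists>R\<le>Q'. forces R \<rho> B" using * order_trans by meson
  qed
qed

lemma forces_Exists:
  "forces P \<rho> (Exists v A) \<longleftrightarrow>
    (\<forall>Q\<le>P. \<exists>R\<le>Q. \<exists>a. rel R (snd v) a a \<and> forces R (\<rho>(v := a)) A)"
proof
  assume *: "forces P \<rho> (Exists v A)"
  show "\<forall>Q\<le>P. \<exists>R\<le>Q. \<exists>a. rel R (snd v) a a \<and> forces R (\<rho>(v := a)) A"
    using * unfolding Exists_def forces.simps forces_Neg by (meson order_trans rel_mono)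
next
  assume *: "\<forall>Q\<le>P. \<exists>R\<le>Q. \<exists>a. rel R (snd v) a a \<and> forces R (\<rho>(v := a)) A"
  show "forces P \<rho> (Exists v A)"
    unfolding Exists_def forces_Neg forces.simps
    using * by (meson order_refl)
qed

lemma forces_ExistsI:
  "rel P (snd v) a a \<Longrightarrow> forces P (\<rho>(v := a)) A \<Longrightarrow> forces P \<rho> (Exists v A)"
  unfolding forces_Exists using rel_mono forces_mono by blast

lemma forces_ForallI:
  "(\<And>Q a. Q \<le> P \<Longrightarrow> rel Q (snd v) a a \<Longrightarrow> forces Q (\<rho>(v := a)) A) \<Longrightarrow> forces P \<rho> (Forall v A)"
  by simp

lemma forces_ForallD:
  "forces P \<rho> (Forall v A) \<Longrightarrow> rel P (snd v) a a \<Longrightarrow> forces P (\<rho>(v := a)) A"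
  by simp

lemma forces_ImpI:
  "(\<And>Q. Q \<le> P \<Longrightarrow> forces Q \<rho> A \<Longrightarrow> forces Q \<rho> B) \<Longrightarrow> forces P \<rho> (A \<^bold>\<longrightarrow> B)"
  by simp

theorem soundness: "T \<turnstile> A \<Longrightarrow> (\<And>B. B \<in> T \<Longrightarrow> wff B \<Longrightarrow> valid B) \<Longrightarrow> valid A"
proof (induction rule: proves.induct)
  case (ax A)
  then show ?case by blast
next
  case (imp_K A B)
  show ?case unfolding valid_def forces.simps using forces_mono by blast
next
  case (imp_S A B C)
  show ?case unfolding valid_def forces.simps by (meson order_trans order_refl)
next
  case (dneg A)
  show ?case unfolding valid_def
  proof (intro allI impI forces_ImpI)
    fix P \<rho> Q assume "forces Q \<rho> (\<^bold>\<not> \<^bold>\<not> A)"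
    then show "forces Q \<rho> A"
      unfolding forces_Neg by (intro forces_dense) blast
  qed
next
  case (all_inst A t v)
  show ?case unfolding valid_def
  proof (intro allI impI forces_ImpI)
    fix P \<rho> Q assume \<rho>: "env P \<rho>" and Q: "Q \<le> P" "forces Q \<rho> (Forall v A)"
    have "rel Q (snd v) (cl \<rho> t) (cl \<rho> t)"
      using all_inst \<rho> Q env_mono rel_cl_env by metis
    then show "forces Q \<rho> (subst v t A)"
      using forces_ForallD[OF Q(2)] forces_subst all_inst by blast
  qed
next
  case (all_dist A B v)
  show ?case unfolding valid_def
  proof (intro allI impI forces_ImpI forces_ForallI)
    fix P \<rho> Q R S a
    assume 1: "forces Q \<rho> (Forall v (A \<^bold>\<longrightarrow> B))" "R \<le> Q" "forces R \<rho> A" "S \<le> R" "rel S (snd v) a a"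
    have "forces S (\<rho>(v := a)) (A \<^bold>\<longrightarrow> B)"
      using 1 forces_mono forces_ForallD order_trans by blast
    moreover have "forces S (\<rho>(v := a)) A \<longleftrightarrow> forces S \<rho> A"
      using all_dist by (intro forces_coincidence) auto
    ultimately show "forces S (\<rho>(v := a)) B"
      using 1 forces_mono by auto
  qed
next
  case (eq_refl t)
  then show ?case unfolding valid_def forces.simps using rel_cl_env by blast
next
  case (eq_subst A s t v)
  show ?case unfolding valid_def
  proof (intro allI impI forces_ImpI)
    fix P \<rho> Q R assume 1: "env P \<rho>" "Q \<le> P" "forces Q \<rho> (s \<doteq> t)" "R \<le> Q" "forces R \<rho> (subst v s A)"
    have "rel R N (cl \<rho> s) (cl \<rho> t)" using 1 rel_mono by (metis forces.simps(1))
    moreover have "env R \<rho>" using 1 env_mono order_trans by blast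
    ultimately have "rel_on (fv A) R (\<rho>(v := cl \<rho> s)) (\<rho>(v := cl \<rho> t))"
      using eq_subst by (intro rel_on_upd) (auto intro: env_rel_on)
    then show "forces R \<rho> (subst v t A)"
      using 1 eq_subst forces_subst forces_cong by blast
  qed
next
  case (mp A B)
  then show ?case unfolding valid_def forces.simps by blast
next
  case (gen A v)
  show ?case unfolding valid_def
  proof (intro allI impI forces_ForallI)
    fix P \<rho> Q a assume "env P \<rho>" "Q \<le> P" "rel Q (snd v) a a"
    then have "env Q (\<rho>(v := a))" using env_upd env_mono by blast
    then show "forces Q (\<rho>(v := a)) A" using gen unfolding valid_def by blast
  qed
qed

section \<open>Extensional equality of terms\<close>

lemma fvt_fresh: "v \<in> fvt t \<Longrightarrow> fst v < fresh t"
  by (induction t) auto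

lemma cl_fresh: "fresh t \<le> i \<Longrightarrow> cl (\<rho>((i, \<sigma>) := a)) t = cl \<rho> t"
  by (rule cl_coincidence) (use fvt_fresh in fastforce)

text \<open>The formula compares both terms at the same argument, \<open>rel\<close> at two related
  ones. The term \<open>t\<close>, being related to itself, bridges the difference. In this way the
  extensionality axioms come for free.\<close>

lemma forces_eqty:
  "wft s \<Longrightarrow> wft t \<Longrightarrow> ty_of s = \<sigma> \<Longrightarrow> ty_of t = \<sigma> \<Longrightarrow> env P \<rho> \<Longrightarrow>
    forces P \<rho> (eqty \<sigma> s t) \<longleftrightarrow> rel P \<sigma> (cl \<rho> s) (cl \<rho> t)"
proof (induction \<sigma> arbitrary: s t P \<rho>)
  case (Arr \<sigma> \<tau>)
  define z where "z = (max (fresh s) (fresh t), \<sigma>)"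
  have eq: "forces Q (\<rho>(z := a)) (eqty \<tau> (s \<cdot> Var z) (t \<cdot> Var z)) \<longleftrightarrow>
      rel Q \<tau> (cl \<rho> s \<bullet> a) (cl \<rho> t \<bullet> a)" if "Q \<le> P" "rel Q \<sigma> a a" for Q a
  proof -
    have "env Q (\<rho>(z := a))" using Arr.prems(5) that env_mono env_upd by (simp add: z_def)
    then show ?thesis
      using Arr.IH(2)[of "s \<cdot> Var z" "t \<cdot> Var z" Q "\<rho>(z := a)"] Arr.prems
        cl_fresh[of s "fst z" \<rho> \<sigma> a] cl_fresh[of t "fst z" \<rho> \<sigma> a]
      by (simp add: z_def del: fun_upd_apply) (simp add: fun_upd_apply)
  qed
  have t: "rel P (\<sigma> \<rightarrow> \<tau>) (cl \<rho> t) (cl \<rho> t)" using Arr.prems rel_cl_env by metis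
  have "forces P \<rho> (eqty (\<sigma> \<rightarrow> \<tau>) s t) \<longleftrightarrow>
      (\<forall>Q\<le>P. \<forall>a. rel Q \<sigma> a a \<longrightarrow> rel Q \<tau> (cl \<rho> s \<bullet> a) (cl \<rho> t \<bullet> a))"
    using eq by (simp add: z_def Let_def)
  also have "\<dots> \<longleftrightarrow> rel P (\<sigma> \<rightarrow> \<tau>) (cl \<rho> s) (cl \<rho> t)"
  proof
    assume *: "\<forall>Q\<le>P. \<forall>a. rel Q \<sigma> a a \<longrightarrow> rel Q \<tau> (cl \<rho> s \<bullet> a) (cl \<rho> t \<bullet> a)"
    show "rel P (\<sigma> \<rightarrow> \<tau>) (cl \<rho> s) (cl \<rho> t)" unfolding rel.simps
    proof (intro allI impI)
      fix Q c d assume Q: "Q \<le> P" "rel Q \<sigma> c d"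
      have "rel Q \<tau> (cl \<rho> s \<bullet> c) (cl \<rho> t \<bullet> c)" using * Q rel_refl1 by blast
      moreover have "rel Q \<tau> (cl \<rho> t \<bullet> c) (cl \<rho> t \<bullet> d)" using t Q by auto
      ultimately show "rel Q \<tau> (cl \<rho> s \<bullet> c) (cl \<rho> t \<bullet> d)" by (rule rel_trans)
    qed
  qed auto
  finally show ?case .
qed simp


section \<open>The axioms of the base theory\<close>

lemma rel_Fn_Num:
  "rel P N a (Num m) \<Longrightarrow> rel P N b (Num n) \<Longrightarrow> rel P N (Fn f \<bullet> a \<bullet> b) (Num (f m n))"
proof -
  assume "rel P N a (Num m)" "rel P N b (Num n)"
  then have "rel P N (Fn f \<bullet> a \<bullet> b) (Fn f \<bullet> Num m \<bullet> Num n)"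
    using rel_Fn rel_Ap by blast
  moreover have "rel P N (Fn f \<bullet> Num m \<bullet> Num n) (Num (f m n))"
    by (rule eval_imp_rel) (simp add: eval_Fn_iff)
  ultimately show ?thesis by (rule rel_trans)
qed

lemma rel_Num_Num: "rel P N (Num m) (Num n) \<longleftrightarrow> m = n"
  by auto

lemma less_rel_Num: "less_rel P (Num m) (Num n) \<longleftrightarrow> m < n"
  by (auto simp: less_rel_def)

lemma forces_EqN:
  "rel P N (cl \<rho> s) (Num m) \<Longrightarrow> rel P N (cl \<rho> t) (Num n) \<Longrightarrow> forces P \<rho> (s \<doteq> t) \<longleftrightarrow> m = n"
  unfolding forces.simps by (metis rel_Num_Num rel_sym rel_trans)

lemma forces_LessN:
  "rel P N (cl \<rho> s) (Num m) \<Longrightarrow> rel P N (cl \<rho> t) (Num n) \<Longrightarrow> forces P \<rho> (s \<prec> t) \<longleftrightarrow> m < n"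
  unfolding forces.simps by (metis less_rel_Num less_rel_cong rel_sym)

lemma rel_plus:
  "rel P N (cl \<rho> s) (Num m) \<Longrightarrow> rel P N (cl \<rho> t) (Num n) \<Longrightarrow> rel P N (cl \<rho> (s \<oplus> t)) (Num (m + n))"
  by (simp add: plus_t_def rel_Fn_Num del: rel.simps)

lemma rel_times:
  "rel P N (cl \<rho> s) (Num m) \<Longrightarrow> rel P N (cl \<rho> t) (Num n) \<Longrightarrow> rel P N (cl \<rho> (s \<otimes> t)) (Num (m * n))"
  by (simp add: times_t_def rel_Fn_Num del: rel.simps)

lemma rel_Zero: "rel P N (cl \<rho> \<^bold>0) (Num 0)"
  and rel_One: "rel P N (cl \<rho> \<^bold>1) (Num 1)"
  by auto

lemma rel_N_Num:
  assumes "rel P N a a"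
  shows "\<exists>R\<le>P. \<exists>m. rel R N a (Num m)"
proof -
  from assms obtain R m where "R \<le> P" "eval (pos R) a m" by (rule rel_N_obtain)
  then show ?thesis using eval_imp_rel by blast
qed

lemma forces_dense_Num:
  assumes "rel P N a a" "\<And>R m. R \<le> P \<Longrightarrow> rel R N a (Num m) \<Longrightarrow> forces R \<rho> A"
  shows "forces P \<rho> A"
proof (rule forces_dense)
  fix Q assume Q: "Q \<le> P"
  then obtain R m where "R \<le> Q" "rel R N a (Num m)"
    using rel_N_Num rel_mono assms(1) by meson
  then show "\<exists>R\<le>Q. forces R \<rho> A" using assms(2) Q order_trans by blast
qed

lemma forces_dense_std:
  assumes "rel P ty1 a a" "\<And>R g. R \<le> P \<Longrightarrow> rel R ty1 a (std g) \<Longrightarrow> forces R \<rho> A"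
  shows "forces P \<rho> A"
proof (rule forces_dense)
  fix Q assume Q: "Q \<le> P"
  then obtain R g where "R \<le> Q" "rel R ty1 a (std g)"
    using rel_ty1_std assms(1) by blast
  then show "\<exists>R\<le>Q. forces R \<rho> A" using assms(2) Q order_trans by blast
qed

text \<open>The arithmetical and recursor axioms have no number variables besides these two; by
  local character their values may be taken to be numerals.\<close>

lemma valid_NumI:
  assumes "\<And>P \<rho> m n. env P \<rho> \<Longrightarrow> rel P N (\<rho> (0, N)) (Num m) \<Longrightarrow> rel P N (\<rho> (1, N)) (Num n) \<Longrightarrow>
    forces P \<rho> A"
  shows "valid A"
  unfolding valid_def
proof (intro allI impI)
  fix P \<rho> assume \<rho>: "env P \<rho>"
  show "forces P \<rho> A"
  proof (rule forces_dense_Num)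
    show "rel P N (\<rho> (0, N)) (\<rho> (0, N))" using env_rel[OF \<rho>, of "(0, N)"] by simp
    fix R m assume R: "R \<le> P" "rel R N (\<rho> (0, N)) (Num m)"
    show "forces R \<rho> A"
    proof (rule forces_dense_Num)
      show "rel R N (\<rho> (1, N)) (\<rho> (1, N))"
        using env_rel[OF env_mono[OF \<rho> R(1)], of "(1, N)"] by simp
      fix S n assume "S \<le> R" "rel S N (\<rho> (1, N)) (Num n)"
      then show "forces S \<rho> A"
        using R \<rho> env_mono rel_mono by (intro assms[of S \<rho> m n]) blast+
    qed
  qed
qed

lemma valid_arith: "A \<in> arith_axioms \<Longrightarrow> valid A"
proof (rule valid_NumI)
  fix P and \<rho> :: "var \<Rightarrow> ctm" and m n :: nat
  assume A: "A \<in> arith_axioms" and m: "rel P N (\<rho> (0, N)) (Num m)" and n: "rel P N (\<rho> (1, N)) (Num n)"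
  have mn: "rel Q N (cl \<rho> (Var (0, N))) (Num m)" "rel Q N (cl \<rho> (Var (1, N))) (Num n)"
    if "Q \<le> P" for Q
    using rel_mono[OF m that] rel_mono[OF n that] by (simp_all del: rel.simps)
  note rules = mn rel_plus rel_times rel_Zero rel_One
  have eq0: "\<not> forces Q \<rho> (Var (1, N) \<oplus> \<^bold>1 \<doteq> \<^bold>0)" if "Q \<le> P" for Q
    using forces_EqN[OF rel_plus[OF mn(2)[OF that] rel_One] rel_Zero] by simp
  have eqS: "forces Q \<rho> (Var (0, N) \<oplus> \<^bold>1 \<doteq> Var (1, N) \<oplus> \<^bold>1) \<longleftrightarrow> m = n" if "Q \<le> P" for Q
    using forces_EqN[OF rel_plus[OF mn(1)[OF that] rel_One] rel_plus[OF mn(2)[OF that] rel_One]]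
    by simp
  have eq: "forces Q \<rho> (Var (0, N) \<doteq> Var (1, N)) \<longleftrightarrow> m = n" if "Q \<le> P" for Q
    using forces_EqN[OF mn(1)[OF that] mn(2)[OF that]] by simp
  have less: "forces Q \<rho> (Var (0, N) \<prec> Var (1, N)) \<longleftrightarrow> m < n" if "Q \<le> P" for Q
    using forces_LessN[OF mn(1)[OF that] mn(2)[OF that]] by simp
  have lessS: "forces Q \<rho> (Var (0, N) \<prec> Var (1, N) \<oplus> \<^bold>1) \<longleftrightarrow> m < n + 1" if "Q \<le> P" for Q
    using forces_LessN[OF mn(1)[OF that] rel_plus[OF mn(2)[OF that] rel_One]] by simp
  have less0: "\<not> forces Q \<rho> (Var (0, N) \<prec> \<^bold>0)" if "Q \<le> P" for Q
    using forces_LessN[OF mn(1)[OF that] rel_Zero] by simp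
  have disj: "forces Q \<rho> (Var (0, N) \<prec> Var (1, N) \<^bold>\<or> Var (0, N) \<doteq> Var (1, N)) \<longleftrightarrow> m < n + 1"
    if "Q \<le> P" for Q
  proof -
    have "forces R \<rho> (Var (0, N) \<prec> Var (1, N)) \<or> forces R \<rho> (Var (0, N) \<doteq> Var (1, N)) \<longleftrightarrow> m < n + 1"
      if "R \<le> Q" for R
      using eq less order_trans[OF that \<open>Q \<le> P\<close>] by auto
    then show ?thesis unfolding forces_Disj using order_refl order_trans by meson
  qed
  have eqs: "forces P \<rho> (Var (0, N) \<oplus> \<^bold>0 \<doteq> Var (0, N))"
    "forces P \<rho> (Var (0, N) \<oplus> (Var (1, N) \<oplus> \<^bold>1) \<doteq> (Var (0, N) \<oplus> Var (1, N)) \<oplus> \<^bold>1)"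
    "forces P \<rho> (Var (0, N) \<otimes> \<^bold>0 \<doteq> \<^bold>0)"
    "forces P \<rho> (Var (0, N) \<otimes> (Var (1, N) \<oplus> \<^bold>1) \<doteq> (Var (0, N) \<otimes> Var (1, N)) \<oplus> Var (0, N))"
    by (rule forces_EqN[THEN iffD2], (rule rules order_refl)+, simp)+
  show "forces P \<rho> A"
    using A eqs unfolding arith_axioms_def Let_def
    by (auto simp: forces_Neg forces_Iff eq0 eqS eq lessS less0 disj simp del: forces.simps(1,2) One_nat_def)
qed

lemma valid_combinator:
  assumes "A \<in> combinator_axioms"
  shows "valid A"
  unfolding valid_def
proof (intro allI impI)
  fix P \<rho> assume \<rho>: "env P \<rho>"
  from assms consider
    (Pi) \<sigma> \<tau> where "A = eqty \<sigma> (Cst (CPi \<sigma> \<tau>) \<cdot> Var (0, \<sigma>) \<cdot> Var (1, \<tau>)) (Var (0, \<sigma>))"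
  | (Sg) \<delta> \<sigma> \<tau> where "A = eqty \<tau>
      (Cst (CSigma \<delta> \<sigma> \<tau>) \<cdot> Var (0, \<delta> \<rightarrow> \<sigma> \<rightarrow> \<tau>) \<cdot> Var (1, \<delta> \<rightarrow> \<sigma>) \<cdot> Var (2, \<delta>))
      (Var (0, \<delta> \<rightarrow> \<sigma> \<rightarrow> \<tau>) \<cdot> Var (2, \<delta>) \<cdot> (Var (1, \<delta> \<rightarrow> \<sigma>) \<cdot> Var (2, \<delta>)))"
    unfolding combinator_axioms_def by blast
  then show "forces P \<rho> A"
  proof cases
    case Pi
    have "rel P \<sigma> (\<rho> (0, \<sigma>)) (\<rho> (0, \<sigma>))" using env_rel[OF \<rho>, of "(0, \<sigma>)"] by simp
    then show ?thesis unfolding Pi by (simp add: forces_eqty \<rho> rel_step[OF step.Pi])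
  next
    case Sg
    let ?t = "Var (0, \<delta> \<rightarrow> \<sigma> \<rightarrow> \<tau>) \<cdot> Var (2, \<delta>) \<cdot> (Var (1, \<delta> \<rightarrow> \<sigma>) \<cdot> Var (2, \<delta>))"
    have "rel P \<tau> (cl \<rho> ?t) (cl \<rho> ?t)" by (rule rel_cl_env) (use \<rho> in auto)
    then show ?thesis unfolding Sg by (simp add: forces_eqty \<rho> rel_step[OF step.Sg])
  qed
qed

lemma rel_Rc_0:
  "rel P N a a \<Longrightarrow> rel P N (Rc \<bullet> f \<bullet> a \<bullet> Num 0) a"
  by (simp add: eval_Rc_iff)

lemma rel_Rc_Suc:
  assumes "rel P (N \<rightarrow> N \<rightarrow> N) f f" "rel P N a a"
  shows "rel P N (Rc \<bullet> f \<bullet> a \<bullet> Num (Suc k)) (f \<bullet> Num k \<bullet> (Rc \<bullet> f \<bullet> a \<bullet> Num k))"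
proof -
  have "rel P N (f \<bullet> Num k \<bullet> (Rc \<bullet> f \<bullet> a \<bullet> Num k)) (f \<bullet> Num k \<bullet> (Rc \<bullet> f \<bullet> a \<bullet> Num k))"
    by (meson assms rel_Ap rel_Num rel_Rc)
  then show ?thesis by (simp add: eval_Rc_iff)
qed

lemma valid_recursor: "A \<in> recursor_axioms \<Longrightarrow> valid A"
proof (rule valid_NumI)
  fix P and \<rho> :: "var \<Rightarrow> ctm" and m n :: nat
  assume A: "A \<in> recursor_axioms" and \<rho>: "env P \<rho>"
    and m: "rel P N (\<rho> (0, N)) (Num m)" and n: "rel P N (\<rho> (1, N)) (Num n)"
  let ?f = "\<rho> (0, N \<rightarrow> N \<rightarrow> N)" and ?m = "\<rho> (0, N)" and ?n = "\<rho> (1, N)"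
  have f: "rel P (N \<rightarrow> N \<rightarrow> N) ?f ?f" and m': "rel P N ?m ?m"
    using env_rel[OF \<rho>, of "(0, N \<rightarrow> N \<rightarrow> N)"] env_rel[OF \<rho>, of "(0, N)"]
    by (simp_all only: snd_conv)
  have Rc: "rel P N (Rc \<bullet> ?f \<bullet> ?m \<bullet> a) (Rc \<bullet> ?f \<bullet> ?m \<bullet> b)" if "rel P N a b" for a b
    using that f m' rel_Rc rel_Ap by meson
  have "rel P N (Rc \<bullet> ?f \<bullet> ?m \<bullet> cl \<rho> (Var (1, N) \<oplus> \<^bold>1)) (Rc \<bullet> ?f \<bullet> ?m \<bullet> Num (Suc n))"
    using rel_plus[of P \<rho> "Var (1, N)" n "\<^bold>1" 1] n rel_One by (intro Rc) simp
  moreover have "rel P N (Rc \<bullet> ?f \<bullet> ?m \<bullet> Num (Suc n)) (?f \<bullet> Num n \<bullet> (Rc \<bullet> ?f \<bullet> ?m \<bullet> Num n))"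
    by (rule rel_Rc_Suc[OF f m'])
  moreover have "rel P N (?f \<bullet> Num n \<bullet> (Rc \<bullet> ?f \<bullet> ?m \<bullet> Num n)) (?f \<bullet> ?n \<bullet> (Rc \<bullet> ?f \<bullet> ?m \<bullet> ?n))"
    using f Rc[OF rel_sym[OF n]] rel_sym[OF n] rel_Ap by meson
  ultimately have "rel P N (Rc \<bullet> ?f \<bullet> ?m \<bullet> cl \<rho> (Var (1, N) \<oplus> \<^bold>1)) (?f \<bullet> ?n \<bullet> (Rc \<bullet> ?f \<bullet> ?m \<bullet> ?n))"
    using rel_trans by blast
  then show "forces P \<rho> A"
    using A rel_Rc_0[OF m'] unfolding recursor_axioms_def Let_def
    by (auto simp: Rec_def simp del: rel.simps)
qed

lemma valid_extensionality:
  assumes "A \<in> extensionality_axioms"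
  shows "valid A"
  unfolding valid_def
proof (intro allI impI)
  fix P \<rho> assume \<rho>: "env P \<rho>"
  from assms obtain \<sigma> \<tau> where A: "A = (eqty \<sigma> (Var (0, \<sigma>)) (Var (1, \<sigma>)) \<^bold>\<longrightarrow>
      eqty \<tau> (Var (2, \<sigma> \<rightarrow> \<tau>) \<cdot> Var (0, \<sigma>)) (Var (2, \<sigma> \<rightarrow> \<tau>) \<cdot> Var (1, \<sigma>)))"
    unfolding extensionality_axioms_def by blast
  show "forces P \<rho> A" unfolding A
  proof (rule forces_ImpI)
    fix Q assume "Q \<le> P" and *: "forces Q \<rho> (eqty \<sigma> (Var (0, \<sigma>)) (Var (1, \<sigma>)))"
    then have Q: "env Q \<rho>" using \<rho> env_mono by blast
    have "rel Q (\<sigma> \<rightarrow> \<tau>) (\<rho> (2, \<sigma> \<rightarrow> \<tau>)) (\<rho> (2, \<sigma> \<rightarrow> \<tau>))"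
      using env_rel[OF Q, of "(2, \<sigma> \<rightarrow> \<tau>)"] by (simp only: snd_conv)
    then show "forces Q \<rho> (eqty \<tau> (Var (2, \<sigma> \<rightarrow> \<tau>) \<cdot> Var (0, \<sigma>)) (Var (2, \<sigma> \<rightarrow> \<tau>) \<cdot> Var (1, \<sigma>)))"
      using * Q rel_Ap by (simp add: forces_eqty del: rel.simps)
  qed
qed

lemma qfree_free_for: "qfree A \<Longrightarrow> free_for v t A"
  by (induction A) auto

text \<open>The induction runs in HOL over numerals, at one fixed condition;
  \<open>forces_cong\<close> trades the successor term for a numeral. An arbitrary number object is
  densely a numeral.\<close>

lemma valid_induction:
  assumes "A \<in> qf_induction"
  shows "valid A"
  unfolding valid_def
proof (intro allI impI)
  fix P \<rho> assume \<rho>: "env P \<rho>"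
  from assms obtain n B where A: "A = (subst n \<^bold>0 B \<^bold>\<and> Forall n (B \<^bold>\<longrightarrow> subst n (Var n \<oplus> \<^bold>1) B) \<^bold>\<longrightarrow> Forall n B)"
    and n: "snd n = N" and B: "qfree B" "wff B"
    unfolding qf_induction_def by blast
  note sub = forces_subst[OF qfree_free_for[OF B(1)]]
  show "forces P \<rho> A" unfolding A
  proof (intro forces_ImpI forces_ForallI)
    fix Q R a
    assume "Q \<le> P" "R \<le> Q" and a: "rel R (snd n) a a" and
      *: "forces Q \<rho> (subst n \<^bold>0 B \<^bold>\<and> Forall n (B \<^bold>\<longrightarrow> subst n (Var n \<oplus> \<^bold>1) B))"
    then have R: "env R \<rho>" using \<rho> env_mono order_trans by blast
    have num: "forces R (\<rho>(n := Num k)) B" for k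
    proof (induction k)
      case 0
      have "forces R \<rho> (subst n \<^bold>0 B)" using * forces_Conj forces_mono \<open>R \<le> Q\<close> by blast
      then show ?case by (simp add: sub del: fun_upd_apply)
    next
      case (Suc k)
      have "forces R \<rho> (Forall n (B \<^bold>\<longrightarrow> subst n (Var n \<oplus> \<^bold>1) B))"
        using * forces_Conj forces_mono \<open>R \<le> Q\<close> by blast
      then have "forces R (\<rho>(n := Num k)) (B \<^bold>\<longrightarrow> subst n (Var n \<oplus> \<^bold>1) B)"
        by (rule forces_ForallD) (simp only: n rel_Num)
      then have "forces R (\<rho>(n := Num k)) (subst n (Var n \<oplus> \<^bold>1) B)"
        using Suc.IH order_refl unfolding forces.simps by blast
      then have "forces R (\<rho>(n := cl (\<rho>(n := Num k)) (Var n \<oplus> \<^bold>1))) B"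
        by (simp add: sub del: cl.simps(3))
      moreover have "rel R N (cl (\<rho>(n := Num k)) (Var n \<oplus> \<^bold>1)) (Num (Suc k))"
        using rel_plus[of R "\<rho>(n := Num k)" "Var n" k "\<^bold>1" 1] rel_One by simp
      then have "rel_on (fv B) R (\<rho>(n := cl (\<rho>(n := Num k)) (Var n \<oplus> \<^bold>1))) (\<rho>(n := Num (Suc k)))"
        using R env_rel_on n by (intro rel_on_upd) auto
      ultimately show ?case using forces_cong B(2) by blast
    qed
    show "forces R (\<rho>(n := a)) B"
    proof (rule forces_dense_Num)
      show "rel R N a a" using a n by simp
      fix S k assume S: "S \<le> R" "rel S N a (Num k)"
      have "rel_on (fv B) S (\<rho>(n := a)) (\<rho>(n := Num k))"
        using R S env_mono env_rel_on n by (intro rel_on_upd) auto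
      then show "forces S (\<rho>(n := a)) B" using num forces_mono S(1) forces_cong B(2) by blast
    qed
  qed
qed


section \<open>Quantifier-free choice\<close>

text \<open>Quantifier-free formulas are decided by the map of a condition alone; this is what makes
  fusion applicable to them.\<close>
fun decides :: "(real \<rightharpoonup> nat) \<Rightarrow> (var \<Rightarrow> ctm) \<Rightarrow> fm \<Rightarrow> bool" where
  "decides p \<rho> (s \<doteq> t) \<longleftrightarrow> (\<exists>m. eval p (cl \<rho> s) m) \<and> (\<exists>n. eval p (cl \<rho> t) n)"
| "decides p \<rho> (s \<prec> t) \<longleftrightarrow> (\<exists>m. eval p (cl \<rho> s) m) \<and> (\<exists>n. eval p (cl \<rho> t) n)"
| "decides p \<rho> Falsum \<longleftrightarrow> True"
| "decides p \<rho> (A \<^bold>\<longrightarrow> B) \<longleftrightarrow> decides p \<rho> A \<and> decides p \<rho> B"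
| "decides p \<rho> (Forall v A) \<longleftrightarrow> False"

text \<open>To be read together with \<open>decides\<close>: an undecided atomic formula counts as
  false.\<close>

fun tv :: "(real \<rightharpoonup> nat) \<Rightarrow> (var \<Rightarrow> ctm) \<Rightarrow> fm \<Rightarrow> bool" where
  "tv p \<rho> (s \<doteq> t) \<longleftrightarrow> (\<exists>m. eval p (cl \<rho> s) m \<and> eval p (cl \<rho> t) m)"
| "tv p \<rho> (s \<prec> t) \<longleftrightarrow> (\<exists>m n. eval p (cl \<rho> s) m \<and> eval p (cl \<rho> t) n \<and> m < n)"
| "tv p \<rho> Falsum \<longleftrightarrow> False"
| "tv p \<rho> (A \<^bold>\<longrightarrow> B) \<longleftrightarrow> (tv p \<rho> A \<longrightarrow> tv p \<rho> B)"
| "tv p \<rho> (Forall v A) \<longleftrightarrow> False"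

lemma decides_mono: "decides p \<rho> A \<Longrightarrow> p \<subseteq>\<^sub>m q \<Longrightarrow> decides q \<rho> A"
proof (induction A)
  case (EqN s t)
  then show ?case unfolding decides.simps using eval_mono by blast
next
  case (LessN s t)
  then show ?case unfolding decides.simps using eval_mono by blast
qed auto

lemma tv_mono: "decides p \<rho> A \<Longrightarrow> p \<subseteq>\<^sub>m q \<Longrightarrow> tv q \<rho> A \<longleftrightarrow> tv p \<rho> A"
proof (induction A)
  case (EqN s t)
  then show ?case unfolding decides.simps tv.simps by (metis eval_mono eval_det)
next
  case (LessN s t)
  then show ?case unfolding decides.simps tv.simps by (metis eval_mono eval_det)
qed auto

lemma decides_dense: "wff A \<Longrightarrow> qfree A \<Longrightarrow> env P \<rho> \<Longrightarrow> \<exists>R\<le>P. decides (pos R) \<rho> A"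
proof (induction A arbitrary: P)
  have atom: "\<exists>R\<le>P. (\<exists>m. eval (pos R) (cl \<rho> s) m) \<and> (\<exists>n. eval (pos R) (cl \<rho> t) n)"
    if "wft s" "wft t" "ty_of s = N" "ty_of t = N" "env P \<rho>" for s t P
  proof -
    note st = that
    obtain R m where R: "R \<le> P" "eval (pos R) (cl \<rho> s) m"
      by (rule rel_N_obtain[OF rel_cl_env[OF st(1,3,5)]])
    obtain S n where S: "S \<le> R" "eval (pos S) (cl \<rho> t) n"
      by (rule rel_N_obtain[OF rel_cl_env[OF st(2,4) env_mono[OF st(5) R(1)]]])
    then show ?thesis using R eval_mono pos_mono order_trans by meson
  qed
  { case EqN then show ?case using atom by simp }
  { case LessN then show ?case using atom by simp }
  case (Imp A B)
  then obtain R where R: "R \<le> P" "decides (pos R) \<rho> A" by auto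
  then have "env R \<rho>" using Imp.prems env_mono by blast
  then obtain S where "S \<le> R" "decides (pos S) \<rho> B" using Imp by auto
  then show ?case using R decides_mono pos_mono order_trans by (metis decides.simps(4))
qed auto

text \<open>Once the map decides \<open>A\<close>, all extensions agree on its truth value, so the
  quantifiers over extensions in the forcing clauses collapse.\<close>

lemma forces_tv:
  "decides (pos P) \<rho> A \<Longrightarrow> forces P \<rho> A \<longleftrightarrow> tv (pos P) \<rho> A"
proof (induction A arbitrary: P)
  case (EqN s t)
  then obtain m n where *: "eval (pos P) (cl \<rho> s) m" "eval (pos P) (cl \<rho> t) n" by auto
  then have "forces P \<rho> (s \<doteq> t) \<longleftrightarrow> m = n" using forces_EqN eval_imp_rel by blast
  then show ?case unfolding tv.simps using * eval_det by metis
next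
  case (LessN s t)
  then obtain m n where *: "eval (pos P) (cl \<rho> s) m" "eval (pos P) (cl \<rho> t) n" by auto
  then have "forces P \<rho> (s \<prec> t) \<longleftrightarrow> m < n" using forces_LessN eval_imp_rel by blast
  then show ?case unfolding tv.simps using * eval_det by metis
next
  case (Imp A B)
  have AB: "decides (pos P) \<rho> A" "decides (pos P) \<rho> B" using Imp.prems by simp_all
  have "forces Q \<rho> A \<longleftrightarrow> tv (pos P) \<rho> A" "forces Q \<rho> B \<longleftrightarrow> tv (pos P) \<rho> B" if "Q \<le> P" for Q
    using Imp.IH(1)[OF decides_mono[OF AB(1) pos_mono[OF that]]] tv_mono[OF AB(1) pos_mono[OF that]]
      Imp.IH(2)[OF decides_mono[OF AB(2) pos_mono[OF that]]] tv_mono[OF AB(2) pos_mono[OF that]]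
    by simp_all
  then show ?case using order_refl unfolding forces.simps tv.simps by blast
qed auto

lemma env_rel_on_upd:
  "env P \<rho> \<Longrightarrow> rel P (snd v) a b \<Longrightarrow> rel_on V P (\<rho>(v := a)) (\<rho>(v := b))"
  by (rule rel_on_upd[OF env_rel_on])

lemma qf_AC_dense:
  assumes "wff A" "qfree A" "env P \<rho>" "rel P (snd y) b b" "forces P (\<rho>(y := b)) A"
  shows "\<exists>R\<le>P. decides (pos R) (\<rho>(y := b)) A \<and> tv (pos R) (\<rho>(y := b)) A"
proof -
  have "env P (\<rho>(y := b))" using assms env_upd by blast
  then obtain R where "R \<le> P" "decides (pos R) (\<rho>(y := b)) A"
    using decides_dense assms by blast
  then show ?thesis using assms(5) forces_mono forces_tv by blast
qed

text \<open>Each numeral densely has a genuine function as witness, and fusion finds one condition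
  that works for all numerals. Choosing witnesses in HOL gives \<open>G\<close>, so
  \<open>Fn G\<close> is a choice function free of oracles, even when \<open>A\<close> has generic
  parameters.\<close>

lemma valid_QF_AC_N_ty1:
  assumes "C \<in> QF_AC N ty1"
  shows "valid C"
proof -
  from assms obtain x y F A where
    C: "C = (Forall x (Exists y A) \<^bold>\<longrightarrow> Exists F (Forall x (subst y (Var F \<cdot> Var x) A)))"
    and ty: "snd x = N" "snd y = ty1" "snd F = N \<rightarrow> ty1"
    and ne: "x \<noteq> y" "F \<noteq> x" "F \<noteq> y" "F \<notin> fv A" and A: "qfree A" "wff A"
    unfolding QF_AC_def by blast
  show ?thesis unfolding valid_def C
  proof (intro allI impI forces_ImpI)
    fix P \<rho> Q assume "env P \<rho>" "Q \<le> P" and *: "forces Q \<rho> (Forall x (Exists y A))"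
    then have \<rho>: "env Q \<rho>" using env_mono by blast
    \<comment> \<open>\<open>tv\<close> alone does not persist under larger maps, since an
      implication with an undecided premise may turn false; \<open>decides\<close> makes it
      persist.\<close>
    define X where "X n p \<longleftrightarrow> (\<exists>g. decides p (\<rho>(x := Num n, y := std g)) A \<and>
      tv p (\<rho>(x := Num n, y := std g)) A)" for n p
    show "forces Q \<rho> (Exists F (Forall x (subst y (Var F \<cdot> Var x) A)))"
    proof (rule forces_dense)
      fix Q' assume Q': "Q' \<le> Q"
      have "\<exists>R\<le>Q'. \<forall>n. X n (pos R)"
      proof (rule fusion[OF _ _ Q'])
        show "X n q" if "X n p" "p \<subseteq>\<^sub>m q" for n p q
          using that decides_mono tv_mono unfolding X_def by blast
        show "\<exists>R\<le>S. X n (pos R)" if S: "S \<le> Q" for n S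
        proof -
          let ?\<rho> = "\<rho>(x := Num n)"
          have "forces Q ?\<rho> (Exists y A)"
            by (rule forces_ForallD[OF *]) (simp only: ty rel_Num)
          then obtain T a where T: "T \<le> S" "rel T ty1 a a" "forces T (?\<rho>(y := a)) A"
            using S ty unfolding forces_Exists by auto
          obtain U g where U: "U \<le> T" "rel U ty1 a (std g)"
            using rel_ty1_std[OF T(2) order_refl] by blast
          have env: "env U ?\<rho>"
            using \<rho> S T(1) U(1) env_mono order_trans env_upd[of U \<rho> x] ty rel_Num by metis
          then have "rel_on (fv A) U (?\<rho>(y := a)) (?\<rho>(y := std g))"
            by (intro env_rel_on_upd) (use U(2) ty in \<open>simp_all only:\<close>)
          then have "forces U (?\<rho>(y := std g)) A"
            using T(3) U(1) forces_mono forces_cong A(2) by blast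
          then obtain V where "V \<le> U" "decides (pos V) (?\<rho>(y := std g)) A" "tv (pos V) (?\<rho>(y := std g)) A"
            using qf_AC_dense[OF A(2,1) env, of y "std g"] rel_std ty by metis
          then show ?thesis unfolding X_def using T(1) U(1) order_trans by meson
        qed
      qed
      then obtain R G where R: "R \<le> Q'" and
        G: "\<And>n. decides (pos R) (\<rho>(x := Num n, y := std (G n))) A"
          "\<And>n. tv (pos R) (\<rho>(x := Num n, y := std (G n))) A"
        unfolding X_def by metis
      have "forces R \<rho> (Exists F (Forall x (subst y (Var F \<cdot> Var x) A)))"
      proof (intro forces_ExistsI forces_ForallI)
        show "rel R (snd F) (Fn G) (Fn G)" unfolding ty by (rule rel_Fn)
        fix S a assume S: "S \<le> R" "rel S (snd x) a a"
        show "forces S (\<rho>(F := Fn G, x := a)) (subst y (Var F \<cdot> Var x) A)"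
        proof (rule forces_dense_Num)
          show "rel S N a a" using S ty by simp
          fix T n assume T: "T \<le> S" "rel T N a (Num n)"
          let ?\<rho> = "\<rho>(x := Num n, y := std (G n))"
          have env: "env T \<rho>" using \<rho> R Q' S T env_mono order_trans by meson
          have "rel T ty1 (Fn G \<bullet> a) (Fn G \<bullet> Num n)" using rel_Fn rel_Ap T(2) by blast
          moreover have "rel T ty1 (Fn G \<bullet> Num n) (std (G n))"
          proof (rule rel_ty1I)
            show "rel T N (Fn G \<bullet> Num n \<bullet> Num i) (std (G n) \<bullet> Num i)" for i
              by (auto simp: eval_Fn_iff)
          qed (use rel_Fn rel_Ap rel_Num rel_std in blast)+
          ultimately have "rel T ty1 (Fn G \<bullet> a) (std (G n))" by (rule rel_trans)
          \<comment> \<open>As \<open>F\<close> is not free in \<open>A\<close>, it is reset to its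
            old value, which leaves only the updates of \<open>x\<close> and \<open>y\<close> to
            compare over the typed environment \<open>\<rho>\<close>.\<close>
          then have rel: "rel_on (fv A) T (\<rho>(F := \<rho> F, x := a, y := Fn G \<bullet> a)) ?\<rho>"
            unfolding fun_upd_triv
            by (intro rel_on_upd[OF env_rel_on_upd] env) (use T(2) ty in \<open>simp_all only:\<close>)
          have "decides (pos T) ?\<rho> A" "tv (pos T) ?\<rho> A"
            using G[of n] S(1) T(1) decides_mono tv_mono pos_mono order_trans by meson+
          then have "forces T (\<rho>(F := \<rho> F, x := a, y := Fn G \<bullet> a)) A"
            using forces_tv forces_cong[OF A(2) rel] by blast
          moreover have "forces T (\<rho>(F := Fn G, x := a, y := Fn G \<bullet> a)) A \<longleftrightarrow>
              forces T (\<rho>(F := \<rho> F, x := a, y := Fn G \<bullet> a)) A"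
            using ne by (intro forces_coincidence) auto
          ultimately show "forces T (\<rho>(F := Fn G, x := a)) (subst y (Var F \<cdot> Var x) A)"
            using ne by (simp add: forces_subst qfree_free_for A)
        qed
      qed
      then show "\<exists>R\<le>Q'. forces R \<rho> (Exists F (Forall x (subst y (Var F \<cdot> Var x) A)))"
        using R by blast
    qed
  qed
qed

text \<open>The bracket abstraction of \<open>t\<close> from
  \<open>Or F \<bullet> Num 0 \<bullet> t \<bullet> Num 0\<close>.\<close>

definition oracle2 :: "orc \<Rightarrow> ctm" where
  "oracle2 F = Sg \<bullet> (Or F \<bullet> Num 0) \<bullet> (Pi \<bullet> Num 0)"

lemma rel_oracle2:
  assumes "mono_orc F" "total_orc P F"
  shows "rel P ty2 (oracle2 F) (oracle2 F)"
proof -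
  have "rel P (ty1 \<rightarrow> N \<rightarrow> N) (Or F \<bullet> Num 0) (Or F \<bullet> Num 0)"
    using rel_Or[OF assms] rel_Num rel_Ap by blast
  moreover have "rel P (ty1 \<rightarrow> N) (Pi \<bullet> Num 0) (Pi \<bullet> Num 0)"
    using rel_Pi rel_Num rel_Ap by blast
  ultimately show ?thesis unfolding oracle2_def using rel_Ap[OF rel_Ap[OF rel_Sg]] by blast
qed

lemma eval_oracle2:
  "eval p (oracle2 F \<bullet> t) r \<longleftrightarrow>
    mono_orc F \<and> (\<exists>g. (\<forall>i. eval p (t \<bullet> Num i) (g i)) \<and> F 0 g 0 p = Some r)"
  by (simp add: oracle2_def eval_step_iff[OF step.Sg] eval_Or_iff eval_step_iff[OF step.Pi])

lemma eval_oracle2_std: "eval p (oracle2 F \<bullet> std g) r \<longleftrightarrow> mono_orc F \<and> F 0 g 0 p = Some r"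
proof -
  have "(\<forall>i. eval p (std g \<bullet> Num i) (h i)) \<longleftrightarrow> h = g" for h by auto
  then show ?thesis unfolding eval_oracle2 by auto
qed

text \<open>There are uncountably many arguments, so fusion cannot fix all witnesses in one
  condition. Instead the choice functional is an oracle that reads the witness for \<open>g\<close>
  off the map, once the map is large enough.\<close>

lemma valid_QF_AC_ty1_N:
  assumes "C \<in> QF_AC ty1 N"
  shows "valid C"
proof -
  from assms obtain x y F A where
    C: "C = (Forall x (Exists y A) \<^bold>\<longrightarrow> Exists F (Forall x (subst y (Var F \<cdot> Var x) A)))"
    and ty: "snd x = ty1" "snd y = N" "snd F = ty2"
    and ne: "x \<noteq> y" "F \<noteq> x" "F \<noteq> y" "F \<notin> fv A" and A: "qfree A" "wff A"
    unfolding QF_AC_def by blast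
  show ?thesis unfolding valid_def C
  proof (intro allI impI forces_ImpI)
    fix P \<rho> Q assume "env P \<rho>" "Q \<le> P" and *: "forces Q \<rho> (Forall x (Exists y A))"
    then have \<rho>: "env Q \<rho>" using env_mono by blast
    let ?\<rho> = "\<lambda>g k. \<rho>(x := std g, y := Num k)"
    \<comment> \<open>Asking for the least witness, with all smaller instances decided, makes the
      answer unique and keeps it unchanged when the map grows.\<close>
    define H where "H g p k \<longleftrightarrow> (\<forall>i\<le>k. decides p (?\<rho> g i) A) \<and> tv p (?\<rho> g k) A \<and>
      (\<forall>i<k. \<not> tv p (?\<rho> g i) A)" for g p k
    have H_unique: "k = k'" if "H g p k" "H g p k'" for g p k k'
      using that unfolding H_def by (metis linorder_neqE_nat)
    have H_mono: "H g q k" if "H g p k" "p \<subseteq>\<^sub>m q" for g p q k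
      using that decides_mono tv_mono unfolding H_def by (meson less_imp_le order_refl)
    define G :: orc where "G n g m p = (if \<exists>k. H g p k then Some (THE k. H g p k) else None)"
      for n g m p
    have G: "G n g m p = Some k \<longleftrightarrow> H g p k" for n g m p k
    proof (cases "\<exists>k. H g p k")
      case True
      then obtain l where l: "H g p l" by blast
      then have "(THE k. H g p k) = l" using H_unique by blast
      then show ?thesis using l H_unique by (auto simp: G_def)
    next
      case False
      then show ?thesis by (auto simp: G_def)
    qed
    have mono: "mono_orc G" unfolding mono_orc_def G using H_mono by blast
    have total: "total_orc Q G" unfolding total_orc_def
    proof (intro allI impI)
      fix n g m S assume S: "S \<le> Q"
      have env: "env S (\<rho>(x := std g))"
        by (rule env_upd) (use \<rho> S env_mono ty rel_std in \<open>auto simp del: rel.simps\<close>)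
      have "forces Q (\<rho>(x := std g)) (Exists y A)"
        by (rule forces_ForallD[OF *]) (simp only: ty rel_std)
      then obtain T a where T: "T \<le> S" "rel T N a a" "forces T (\<rho>(x := std g, y := a)) A"
        using S ty unfolding forces_Exists by (metis order_refl order_trans)
      obtain U k where U: "U \<le> T" "rel U N a (Num k)"
        using rel_N_Num[OF T(2)] by blast
      have env': "env U (\<rho>(x := std g))" using env T(1) U(1) env_mono by blast
      have "rel_on (fv A) U (\<rho>(x := std g, y := a)) (?\<rho> g k)"
        by (intro env_rel_on_upd env') (use U(2) ty in \<open>simp only:\<close>)
      then have "forces U (?\<rho> g k) A"
        using T(3) U(1) forces_mono forces_cong A(2) by blast
      then obtain V where V: "V \<le> U" "decides (pos V) (?\<rho> g k) A" "tv (pos V) (?\<rho> g k) A"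
        using qf_AC_dense[OF A(2,1) env', of y "Num k"] rel_Num ty by metis
      \<comment> \<open>The witness \<open>k\<close> found so far need not be least; the instances
        below it have to be decided before the least one can be read off.\<close>
      have "\<exists>W\<le>V. \<forall>i. decides (pos W) (?\<rho> g i) A"
      proof (rule fusion[OF decides_mono _ order_refl])
        fix i W assume "W \<le> V"
        then have "env W (?\<rho> g i)"
          using env' V(1) env_mono order_trans rel_Num ty by (metis env_upd)
        then show "\<exists>R\<le>W. decides (pos R) (?\<rho> g i) A" using decides_dense A by blast
      qed
      then obtain W where W: "W \<le> V" "\<And>i. decides (pos W) (?\<rho> g i) A" by blast
      have "tv (pos W) (?\<rho> g k) A" using V W tv_mono pos_mono by blast
      then have "H g (pos W) (LEAST k. tv (pos W) (?\<rho> g k) A)"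
        unfolding H_def using W(2) not_less_Least LeastI[of "\<lambda>k. tv (pos W) (?\<rho> g k) A" k] by auto
      then show "\<exists>R\<le>S. G n g m (pos R) \<noteq> None"
        using G W(1) V(1) U(1) T(1) order_trans by (metis option.distinct(1))
    qed
    show "forces Q \<rho> (Exists F (Forall x (subst y (Var F \<cdot> Var x) A)))"
    proof (intro forces_ExistsI forces_ForallI)
      show relF: "rel Q (snd F) (oracle2 G) (oracle2 G)"
        unfolding ty by (rule rel_oracle2[OF mono total])
      fix S a assume S: "S \<le> Q" "rel S (snd x) a a"
      show "forces S (\<rho>(F := oracle2 G, x := a)) (subst y (Var F \<cdot> Var x) A)"
      proof (rule forces_dense_std)
        show "rel S ty1 a a" using S ty by simp
        fix T g assume T: "T \<le> S" "rel T ty1 a (std g)"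
        have env: "env T \<rho>" using \<rho> S T env_mono order_trans by meson
        have "rel T N (oracle2 G \<bullet> a) (oracle2 G \<bullet> std g)"
          using relF S(1) T rel_mono order_trans rel_Ap unfolding ty by meson
        show "forces T (\<rho>(F := oracle2 G, x := a)) (subst y (Var F \<cdot> Var x) A)"
        proof (rule forces_dense)
          fix U assume U: "U \<le> T"
          then obtain V k where V: "V \<le> U" "H g (pos V) k"
            using total S(1) T(1) G order_trans unfolding total_orc_def by (meson not_None_eq)
          have VT: "V \<le> T" using U V order_trans by blast
          have "rel V N (oracle2 G \<bullet> std g) (Num k)"
            by (rule eval_imp_rel) (simp add: eval_oracle2_std mono G V)
          then have "rel V N (oracle2 G \<bullet> a) (Num k)"
            using \<open>rel T N (oracle2 G \<bullet> a) (oracle2 G \<bullet> std g)\<close> VT rel_mono rel_trans by blast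
          then have rel: "rel_on (fv A) V (\<rho>(F := \<rho> F, x := a, y := oracle2 G \<bullet> a)) (?\<rho> g k)"
            unfolding fun_upd_triv
            by (intro rel_on_upd[OF env_rel_on_upd] env_mono[OF env VT])
              (use rel_mono[OF T(2) VT] ty in \<open>simp_all only:\<close>)
          have "forces V (?\<rho> g k) A" using V(2) forces_tv unfolding H_def by blast
          then have "forces V (\<rho>(F := \<rho> F, x := a, y := oracle2 G \<bullet> a)) A"
            using forces_cong[OF A(2) rel] by blast
          moreover have "forces V (\<rho>(F := oracle2 G, x := a, y := oracle2 G \<bullet> a)) A \<longleftrightarrow>
              forces V (\<rho>(F := \<rho> F, x := a, y := oracle2 G \<bullet> a)) A"
            using ne by (intro forces_coincidence) auto
          ultimately have "forces V (\<rho>(F := oracle2 G, x := a)) (subst y (Var F \<cdot> Var x) A)"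
            using ne by (simp add: forces_subst qfree_free_for A)
          then show "\<exists>R\<le>U. forces R (\<rho>(F := oracle2 G, x := a)) (subst y (Var F \<cdot> Var x) A)"
            using V(1) by blast
        qed
      qed
    qed
  qed
qed


section \<open>The functionals deciding normal forms\<close>

text \<open>The terms that never consult a map, so that their values are the same at all
  conditions.\<close>

fun oracle_free :: "ctm \<Rightarrow> bool" where
  "oracle_free (Or F) \<longleftrightarrow> False"
| "oracle_free (a \<bullet> b) \<longleftrightarrow> oracle_free a \<and> oracle_free b"
| "oracle_free _ \<longleftrightarrow> True"

lemma oracle_free_step: "step a b \<Longrightarrow> oracle_free a \<Longrightarrow> oracle_free b"
  by (induction rule: step.induct) auto

lemma eval_oracle_free: "eval p a m \<Longrightarrow> oracle_free a \<Longrightarrow> eval q a m"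
proof (induction rule: eval.induct)
  case (step s s' m)
  then show ?case using eval.step oracle_free_step by blast
qed (auto intro: eval.Num eval.Fn eval.Rc0 eval.RcS)

lemma oracle_free_cl: "(\<And>v. v \<in> fvt t \<Longrightarrow> oracle_free (\<rho> v)) \<Longrightarrow> oracle_free (cl \<rho> t)"
proof (induction t)
  case (Cst c)
  then show ?case by (cases c) auto
qed auto

lemma oracle_free_std: "oracle_free (std g)"
  by (simp add: std_def)

fun second_order :: "fm \<Rightarrow> bool" where
  "second_order (A \<^bold>\<longrightarrow> B) \<longleftrightarrow> second_order A \<and> second_order B"
| "second_order (Forall v A) \<longleftrightarrow> snd v \<in> {N, ty1} \<and> second_order A"
| "second_order _ \<longleftrightarrow> True"

text \<open>Type-1 objects are standard up to density, so the truth of a second-order formula does not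
  depend on the condition.\<close>
lemma second_order_absolute:
  "second_order A \<Longrightarrow> wff A \<Longrightarrow> (\<And>P. env P \<rho>) \<Longrightarrow> (\<And>v. v \<in> fv A \<Longrightarrow> oracle_free (\<rho> v)) \<Longrightarrow>
    forces P \<rho> A \<Longrightarrow> forces Q \<rho> A"
proof (induction A arbitrary: P Q \<rho>)
  case (EqN s t)
  then have free: "oracle_free (cl \<rho> s)" "oracle_free (cl \<rho> t)" by (auto intro: oracle_free_cl)
  obtain R m where "eval (pos R) (cl \<rho> s) m" "eval (pos R) (cl \<rho> t) m"
    using EqN.prems(5) unfolding forces.simps by (rule rel_N_obtain)
  then have "eval (pos R) (cl \<rho> s) m" "eval (pos R) (cl \<rho> t) m" for R
    using free eval_oracle_free by blast+
  then show ?case by auto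
next
  case (LessN s t)
  then have free: "oracle_free (cl \<rho> s)" "oracle_free (cl \<rho> t)" by (auto intro: oracle_free_cl)
  obtain R m n where "eval (pos R) (cl \<rho> s) m" "eval (pos R) (cl \<rho> t) n" "m < n"
    using LessN.prems(5) unfolding forces.simps less_rel_def by blast
  then show ?case using free eval_oracle_free unfolding forces.simps less_rel_def by blast
next
  case (Imp A B)
  have "forces R \<rho> B" if "forces R \<rho> A" for R
  proof -
    have "forces P \<rho> A" by (rule Imp.IH(1)[OF _ _ _ _ that]) (use Imp.prems in auto)
    then have "forces P \<rho> B" using Imp.prems(5) by simp
    show ?thesis by (rule Imp.IH(2)[OF _ _ _ _ \<open>forces P \<rho> B\<close>]) (use Imp.prems in auto)
  qed
  then show ?case by simp
next
  case (Forall v A)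
  \<comment> \<open>An oracle-free instance is an object at every condition. It is forced at
    \<open>P\<close>, and the induction hypothesis carries it over to \<open>R\<close>.\<close>
  have std: "forces R (\<rho>(v := a)) A" if a: "oracle_free a" "\<And>R. rel R (snd v) a a" for a R
  proof (rule Forall.IH)
    show "forces P (\<rho>(v := a)) A" using Forall.prems(5) a(2) by (rule forces_ForallD)
    show "env R (\<rho>(v := a))" for R using Forall.prems(3) a(2) env_upd by blast
    show "oracle_free ((\<rho>(v := a)) w)" if "w \<in> fv A" for w using that Forall.prems a(1) by auto
  qed (use Forall.prems in auto)
  show ?case
  proof (rule forces_ForallI)
    fix R a assume R: "R \<le> Q" "rel R (snd v) a a"
    have cong: "forces S (\<rho>(v := a)) A"
      if "rel S (snd v) a b" "oracle_free b" "\<And>R. rel R (snd v) b b" for S b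
    proof -
      have "rel_on (fv A) S (\<rho>(v := a)) (\<rho>(v := b))"
        by (intro env_rel_on_upd Forall.prems(3) that(1))
      then show ?thesis using std[OF that(2,3)] forces_cong Forall.prems(2) by (metis wff.simps(5))
    qed
    have "snd v \<in> {N, ty1}" using Forall.prems(1) by simp
    then consider "snd v = N" | "snd v = ty1" by blast
    then show "forces R (\<rho>(v := a)) A"
    proof cases
      case 1
      show ?thesis
      proof (rule forces_dense_Num)
        show "rel R N a a" using R(2) 1 by (simp only:)
        show "forces S (\<rho>(v := a)) A" if "rel S N a (Num m)" for S m
          by (rule cong[of S "Num m"]) (simp_all only: 1 that rel_Num oracle_free.simps)
      qed
    next
      case 2
      show ?thesis
      proof (rule forces_dense_std)
        show "rel R ty1 a a" using R(2) 2 by (simp only:)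
        show "forces S (\<rho>(v := a)) A" if "rel S ty1 a (std g)" for S g
          by (rule cong[of S "std g"]) (simp_all only: 2 that rel_std oracle_free_std)
      qed
    qed
  qed
qed auto

text \<open>Constant functions with value 0. They are objects at every condition, so they give an
  environment that is typed everywhere.\<close>

fun dflt :: "ty \<Rightarrow> ctm" where
  "dflt N = Num 0"
| "dflt (\<sigma> \<rightarrow> \<tau>) = Pi \<bullet> dflt \<tau>"

lemma rel_dflt: "rel P \<sigma> (dflt \<sigma>) (dflt \<sigma>)"
proof (induction \<sigma>)
  case (Arr \<sigma> \<tau>)
  then show ?case using rel_Ap[OF rel_Pi Arr(2)] by simp
qed (simp only: dflt.simps rel_Num)

lemma oracle_free_dflt: "oracle_free (dflt \<sigma>)"
  by (induction \<sigma>) auto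

definition dflt_env :: "var \<Rightarrow> ctm" where
  "dflt_env v = dflt (snd v)"

lemma env_dflt: "env P dflt_env"
  unfolding env_def rel_on_def dflt_env_def using rel_dflt by blast

section \<open>The normal forms: free variables and order of quantifiers\<close>

lemma fvt_lam: "fvt (lam v t) = fvt t - {v}"
  by (induction t) auto

lemma fvt_initseg: "fvt (initseg g n) = fvt g \<union> fvt n"
proof -
  have "(i, N) \<notin> fvt g" if "fresh g \<le> i" for i
    using fvt_fresh[of "(i, N)" g] that by auto
  then show ?thesis
    unfolding initseg_def Let_def Rec_def pair_def plus_t_def times_t_def by (auto simp: fvt_lam)
qed

lemma fvt_tuple: "fvt (tuple ts) = (\<Union>t\<in>set ts. fvt t)"
  by (induction ts rule: tuple.induct) (auto simp: pair_def plus_t_def times_t_def)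

lemma fv_Exists[simp]: "fv (Exists v A) = fv A - {v}"
  by (simp add: Exists_def Neg_def)

lemma fv_alternate: "fv (alternate b gs n A) = fv A - insert n (set gs)"
  by (induction gs arbitrary: b) auto

lemma second_order_Exists: "second_order (Exists v A) \<longleftrightarrow> snd v \<in> {N, ty1} \<and> second_order A"
  by (simp add: Exists_def Neg_def)

lemma second_order_alternate:
  "second_order A \<Longrightarrow> snd n = N \<Longrightarrow> (\<forall>g\<in>set gs. snd g = ty1) \<Longrightarrow> second_order (alternate b gs n A)"
  by (induction gs arbitrary: b) (auto simp: second_order_Exists)

lemma fv_Sigma1_normal: "fv (Sigma1_normal k) \<subseteq> {(0, ty1)}"
  unfolding Sigma1_normal_def Let_def fv_alternate
  by (auto simp: fvt_tuple fvt_initseg)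

lemma second_order_Sigma1_normal: "second_order (Sigma1_normal k)"
  unfolding Sigma1_normal_def Let_def by (rule second_order_alternate) auto

text \<open>The normal form is second-order with \<open>f\<close> as its only parameter, so its
  truth at a genuine \<open>g\<close> is the same at all conditions. An oracle whose answer does not
  vary with the map therefore decides it. The assumption is the side condition of the rule
  \<open>ax\<close>.\<close>

lemma valid_exists_S:
  assumes "wff (exists_S k)"
  shows "valid (exists_S k)"
  unfolding valid_def
proof (intro allI impI)
  fix P \<rho> assume \<rho>: "env P \<rho>"
  let ?A = "Sigma1_normal k" and ?S = "(0, ty2) :: var" and ?f = "(0, ty1) :: var"
  let ?eq = "\<lambda>t. Var ?S \<cdot> Var ?f \<doteq> t"
  have A: "wff ?A" using assms by (auto simp: exists_S_def Let_def Exists_def Neg_def Conj_def Iff_def)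
  \<comment> \<open>The given environment may contain oracles and is typed only from
    \<open>P\<close> on; absoluteness needs one that is oracle-free and typed at all
    conditions.\<close>
  let ?\<rho> = "\<lambda>g. dflt_env(?f := std g)"
  define G :: orc where "G n g m p = Some (if forces P (?\<rho> g) ?A then 0 else 1)" for n g m p
  have absolute: "forces Q (?\<rho> g) ?A \<longleftrightarrow> forces P (?\<rho> g) ?A" for Q g
  proof -
    have "env Q (?\<rho> g)" for Q
      by (rule env_upd[OF env_dflt]) (simp only: snd_conv rel_std)
    moreover have "oracle_free (?\<rho> g v)" for v
      by (simp add: dflt_env_def oracle_free_dflt oracle_free_std)
    ultimately show ?thesis
      using second_order_absolute[OF second_order_Sigma1_normal A, of "?\<rho> g"] by blast
  qed
  have mono: "mono_orc G" and total: "total_orc P G"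
    unfolding mono_orc_def total_orc_def G_def by auto
  have relS: "rel P ty2 (oracle2 G) (oracle2 G)" by (rule rel_oracle2[OF mono total])
  show "forces P \<rho> (exists_S k)"
    unfolding exists_S_def Let_def
  proof (intro forces_ExistsI forces_ForallI)
    show "rel P (snd ?S) (oracle2 G) (oracle2 G)" using relS by (simp only: snd_conv)
    fix Q a assume Q: "Q \<le> P" "rel Q (snd ?f) a a"
    let ?\<rho>' = "\<rho>(?S := oracle2 G, ?f := a)"
    show "forces Q ?\<rho>' ((?eq \<^bold>0 \<^bold>\<or> ?eq \<^bold>1) \<^bold>\<and> (?A \<^bold>\<longleftrightarrow> ?eq \<^bold>0))"
    proof (rule forces_dense_std)
      show "rel Q ty1 a a" using Q(2) by (simp only: snd_conv)
      fix R g assume R: "R \<le> Q" "rel R ty1 a (std g)"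
      let ?v = "if forces P (?\<rho> g) ?A then 0 else 1 :: nat"
      have "rel T N (oracle2 G \<bullet> a) (Num ?v)" if "T \<le> R" for T
      proof -
        have "T \<le> P" using that Q(1) R(1) order_trans by blast
        then have "rel T N (oracle2 G \<bullet> a) (oracle2 G \<bullet> std g)"
          using rel_mono[OF R(2) that] rel_mono[OF relS] rel_Ap by blast
        moreover have "rel T N (oracle2 G \<bullet> std g) (Num ?v)"
          by (rule eval_imp_rel) (simp add: eval_oracle2_std mono G_def)
        ultimately show ?thesis by (rule rel_trans)
      qed
      then have val: "rel T N (cl ?\<rho>' (Var ?S \<cdot> Var ?f)) (Num ?v)" if "T \<le> R" for T
        using that by (simp del: rel.simps)
      have eq0: "forces T ?\<rho>' (?eq \<^bold>0) \<longleftrightarrow> forces P (?\<rho> g) ?A"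
        and eq1: "forces T ?\<rho>' (?eq \<^bold>1) \<longleftrightarrow> \<not> forces P (?\<rho> g) ?A" if "T \<le> R" for T
        using forces_EqN[OF val[OF that] rel_Zero] forces_EqN[OF val[OF that] rel_One]
        by (simp_all del: forces.simps)
      have "forces T ?\<rho>' ?A \<longleftrightarrow> forces P (?\<rho> g) ?A" if "T \<le> R" for T
      proof -
        have "rel_on (fv ?A) T ?\<rho>' (?\<rho> g)"
          using fv_Sigma1_normal[of k] rel_mono[OF R(2) that] unfolding rel_on_def by auto
        then show ?thesis using forces_cong[OF A] absolute by metis
      qed
      then show "forces R ?\<rho>' ((?eq \<^bold>0 \<^bold>\<or> ?eq \<^bold>1) \<^bold>\<and> (?A \<^bold>\<longleftrightarrow> ?eq \<^bold>0))"
        unfolding forces_Conj forces_Disj forces_Iff using eq0 eq1 by (metis order_refl)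
    qed
  qed
qed

theorem valid_axioms: "A \<in> Z2\<omega> \<union> QF_AC N ty1 \<Longrightarrow> wff A \<Longrightarrow> valid A"
  unfolding Z2\<omega>_def Pi1_CA0\<omega>_def RCA0\<omega>_def
  using valid_arith valid_combinator valid_recursor valid_extensionality valid_induction
    valid_QF_AC_ty1_N valid_QF_AC_N_ty1 valid_exists_S by blast


section \<open>Evaluation of the coding terms\<close>

lemma wft_lam: "wft t \<Longrightarrow> wft (lam v t) \<and> ty_of (lam v t) = (snd v \<rightarrow> ty_of t)"
  by (induction t) auto

text \<open>The beta law for bracket abstraction: each clause of \<open>lam\<close> unfolds by head
  steps of \<open>Pi\<close> and \<open>Sg\<close>.\<close>

lemma rel_beta:
  "wft t \<Longrightarrow> env P \<rho> \<Longrightarrow> rel P (snd v) a a \<Longrightarrow>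
    rel P (ty_of t) (cl \<rho> (lam v t) \<bullet> a) (cl (\<rho>(v := a)) t)"
proof (induction t)
  case (Var w)
  show ?case
  proof (cases "w = v")
    case True
    have "rel P (snd v) (Pi \<bullet> a \<bullet> (Pi \<bullet> a)) a" using Var.prems(3) by (rule rel_step[OF step.Pi])
    then have "rel P (snd v) (Sg \<bullet> Pi \<bullet> Pi \<bullet> a) a" by (rule rel_step[OF step.Sg])
    then show ?thesis using True by simp
  next
    case False
    have "rel P (snd w) (Pi \<bullet> \<rho> w \<bullet> a) (\<rho> w)"
      by (rule rel_step[OF step.Pi env_rel[OF Var.prems(2)]])
    then show ?thesis using False by simp
  qed
next
  case (Cst c)
  have "rel P (cty c) (Pi \<bullet> ccst c \<bullet> a) (ccst c)" by (rule rel_step[OF step.Pi rel_ccst])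
  then show ?case by simp
next
  case (App s t)
  then obtain \<tau> where \<tau>: "ty_of s = ty_of t \<rightarrow> \<tau>" by auto
  have "rel P (ty_of t \<rightarrow> \<tau>) (cl \<rho> (lam v s) \<bullet> a) (cl (\<rho>(v := a)) s)"
    "rel P (ty_of t) (cl \<rho> (lam v t) \<bullet> a) (cl (\<rho>(v := a)) t)"
    using App \<tau> by (simp_all del: rel.simps fun_upd_apply)
  then have "rel P \<tau> (cl \<rho> (lam v s) \<bullet> a \<bullet> (cl \<rho> (lam v t) \<bullet> a)) (cl (\<rho>(v := a)) s \<bullet> cl (\<rho>(v := a)) t)"
    by (rule rel_Ap)
  then show ?case using \<tau> rel_step[OF step.Sg] by (simp del: rel.simps fun_upd_apply)
qed

definition val :: "cond \<Rightarrow> (var \<Rightarrow> ctm) \<Rightarrow> trm \<Rightarrow> nat \<Rightarrow> bool" where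
  "val P \<rho> t n \<longleftrightarrow> rel P N (cl \<rho> t) (Num n)"

definition num_tm :: "trm \<Rightarrow> bool" where
  "num_tm t \<longleftrightarrow> wft t \<and> ty_of t = N"

lemma val_mono: "val P \<rho> t n \<Longrightarrow> Q \<le> P \<Longrightarrow> val Q \<rho> t n"
  unfolding val_def by (rule rel_mono)

section \<open>Typing of the coding terms\<close>

lemma num_tm_Var: "num_tm (Var (i, N))"
  and num_tm_Zero: "num_tm \<^bold>0"
  and num_tm_One: "num_tm \<^bold>1"
  and num_tm_plus: "num_tm s \<Longrightarrow> num_tm t \<Longrightarrow> num_tm (s \<oplus> t)"
  and num_tm_times: "num_tm s \<Longrightarrow> num_tm t \<Longrightarrow> num_tm (s \<otimes> t)"
  and num_tm_Rec: "wft f \<Longrightarrow> ty_of f = N \<rightarrow> N \<rightarrow> N \<Longrightarrow> num_tm s \<Longrightarrow> num_tm t \<Longrightarrow> num_tm (Rec f s t)"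
  by (auto simp: num_tm_def plus_t_def times_t_def Rec_def)

lemma num_tm_lam2: "num_tm t \<Longrightarrow> wft (lam (i, N) (lam (j, N) t)) \<and> ty_of (lam (i, N) (lam (j, N) t)) = N \<rightarrow> N \<rightarrow> N"
  by (simp add: num_tm_def wft_lam)

lemma num_tm_pred: "num_tm t \<Longrightarrow> num_tm (pred_t t)"
  unfolding pred_t_def by (intro num_tm_Rec num_tm_Zero) auto

lemma num_tm_monus: "num_tm s \<Longrightarrow> num_tm t \<Longrightarrow> num_tm (s \<ominus> t)"
  unfolding monus_def Let_def
  by (intro num_tm_Rec conjunct1[OF num_tm_lam2] conjunct2[OF num_tm_lam2] num_tm_pred num_tm_Var)

lemma num_tm_pow2: "num_tm t \<Longrightarrow> num_tm (pow2 t)"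
  unfolding pow2_def Let_def
  by (intro num_tm_Rec conjunct1[OF num_tm_lam2] conjunct2[OF num_tm_lam2] num_tm_plus num_tm_Var
      num_tm_One)

lemma num_tm_sqrt: "num_tm t \<Longrightarrow> num_tm (sqrt_t t)"
  unfolding sqrt_t_def Let_def
  by (intro num_tm_Rec conjunct1[OF num_tm_lam2] conjunct2[OF num_tm_lam2] num_tm_plus num_tm_times
      num_tm_monus num_tm_Var num_tm_Zero num_tm_One)

lemma num_tm_pair: "num_tm s \<Longrightarrow> num_tm t \<Longrightarrow> num_tm (pair s t)"
  unfolding pair_def by (intro num_tm_plus num_tm_times)

lemma num_tm_fst: "num_tm t \<Longrightarrow> num_tm (fst_t t)"
  unfolding fst_t_def by (intro num_tm_monus num_tm_times num_tm_sqrt)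

lemma num_tm_snd: "num_tm t \<Longrightarrow> num_tm (snd_t t)"
  unfolding snd_t_def by (intro num_tm_monus num_tm_fst num_tm_sqrt)

lemma num_tm_Ap: "wft x \<Longrightarrow> ty_of x = ty1 \<Longrightarrow> num_tm t \<Longrightarrow> num_tm (x \<cdot> t)"
  by (simp add: num_tm_def)

lemma num_tm_num_pos: "num_tm t \<Longrightarrow> num_tm (num_pos t)"
  and num_tm_num_neg: "num_tm t \<Longrightarrow> num_tm (num_neg t)"
  and num_tm_den: "num_tm t \<Longrightarrow> num_tm (den t)"
  and num_tm_mkrat: "num_tm a \<Longrightarrow> num_tm b \<Longrightarrow> num_tm d \<Longrightarrow> num_tm (mkrat a b d)"
  unfolding num_pos_def num_neg_def den_def mkrat_def
  by (intro num_tm_fst num_tm_snd num_tm_plus num_tm_One num_tm_pair num_tm_pred; assumption)+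

lemma num_tm_ratdist: "num_tm s \<Longrightarrow> num_tm t \<Longrightarrow> num_tm (ratdist s t)"
  and num_tm_ratadd: "num_tm s \<Longrightarrow> num_tm t \<Longrightarrow> num_tm (s \<oplus>\<^sub>Q t)"
  unfolding ratdist_def ratabs_def ratneg_def ratadd_def
  by (intro num_tm_mkrat num_tm_plus num_tm_times num_tm_num_pos num_tm_num_neg num_tm_den
      num_tm_monus num_tm_Zero; assumption)+

lemma num_tm_half_pow: "num_tm t \<Longrightarrow> num_tm (half_pow t)"
  and num_tm_twice_half_pow: "num_tm t \<Longrightarrow> num_tm (twice_half_pow t)"
  unfolding half_pow_def twice_half_pow_def
  by (intro num_tm_mkrat num_tm_plus num_tm_pow2 num_tm_Zero num_tm_One; assumption)+

lemmas num_tm_intros = num_tm_Var num_tm_Zero num_tm_One num_tm_plus num_tm_times num_tm_Ap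
  num_tm_ratdist num_tm_ratadd num_tm_half_pow num_tm_twice_half_pow

lemma wff_ratless: "num_tm s \<Longrightarrow> num_tm t \<Longrightarrow> wff (s \<prec>\<^sub>Q t)"
  using num_tm_plus num_tm_times num_tm_num_pos num_tm_num_neg num_tm_den
  unfolding ratless_def num_tm_def wff.simps by metis

lemma wff_ratle: "num_tm s \<Longrightarrow> num_tm t \<Longrightarrow> wff (s \<preceq>\<^sub>Q t)"
  unfolding ratle_def Neg_def by (simp add: wff_ratless)

section \<open>Values of the coding terms\<close>

lemma val_Var: "\<rho> v = Num n \<Longrightarrow> val P \<rho> (Var v) n"
  unfolding val_def cl.simps using rel_Num by metis

lemma val_Zero: "val P \<rho> \<^bold>0 0"
  and val_One: "val P \<rho> \<^bold>1 1"
  and val_plus: "val P \<rho> s m \<Longrightarrow> val P \<rho> t n \<Longrightarrow> val P \<rho> (s \<oplus> t) (m + n)"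
  and val_times: "val P \<rho> s m \<Longrightarrow> val P \<rho> t n \<Longrightarrow> val P \<rho> (s \<otimes> t) (m * n)"
  unfolding val_def using rel_Zero rel_One rel_plus rel_times by blast+

lemma rel_Rc_Num:
  assumes f: "rel P (N \<rightarrow> N \<rightarrow> N) f f" "\<And>i j. rel P N (f \<bullet> Num i \<bullet> Num j) (Num (h i j))"
    and a: "rel P N a (Num x)" and n: "rel P N n (Num k)"
  shows "rel P N (Rc \<bullet> f \<bullet> a \<bullet> n) (Num (rec_nat x h k))"
proof -
  have a': "rel P N a a" using a rel_refl1 by blast
  have "rel P N (Rc \<bullet> f \<bullet> a \<bullet> Num k) (Num (rec_nat x h k))"
  proof (induction k)
    case 0
    then show ?case using rel_trans[OF rel_Rc_0[OF a'] a] by simp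
  next
    case (Suc k)
    have "rel P N (f \<bullet> Num k \<bullet> (Rc \<bullet> f \<bullet> a \<bullet> Num k)) (f \<bullet> Num k \<bullet> Num (rec_nat x h k))"
      using rel_Ap[OF rel_Ap[OF f(1) rel_Num] Suc] .
    then show ?case
      using rel_Rc_Suc[OF f(1) a'] f(2)[of k "rec_nat x h k"] rel_trans
      by (metis old.nat.simps(7))
  qed
  moreover have "rel P N (Rc \<bullet> f \<bullet> a \<bullet> n) (Rc \<bullet> f \<bullet> a \<bullet> Num k)"
    using rel_Ap[OF rel_Ap[OF rel_Ap[OF rel_Rc f(1)] a'] n] .
  ultimately show ?thesis using rel_trans by blast
qed

text \<open>Moves a recursion inside the formal language to \<open>rec_nat\<close>, so that
  subtraction, powers and square roots become computations in HOL.\<close>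

lemma val_Rec_lam:
  assumes \<rho>: "env P \<rho>" and t: "num_tm t"
    and h: "\<And>x y. val P (\<rho>((i, N) := Num x, (j, N) := Num y)) t (h x y)"
    and "val P \<rho> s a" "val P \<rho> n k"
  shows "val P \<rho> (Rec (lam (i, N) (lam (j, N) t)) s n) (rec_nat a h k)"
proof -
  let ?f = "lam (i, N) (lam (j, N) t)"
  have f: "rel P (N \<rightarrow> N \<rightarrow> N) (cl \<rho> ?f) (cl \<rho> ?f)"
    by (rule rel_cl_env[OF _ _ \<rho>]) (use num_tm_lam2[OF t] in auto)
  have "rel P N (cl \<rho> ?f \<bullet> Num x \<bullet> Num y) (Num (h x y))" for x y
  proof -
    let ?\<rho> = "\<rho>((i, N) := Num x)"
    have num: "rel P (snd (l, N)) (Num z) (Num z)" for l :: nat and z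
      by (simp only: snd_conv rel_Num)
    have "rel P (N \<rightarrow> N) (cl \<rho> ?f \<bullet> Num x) (cl ?\<rho> (lam (j, N) t))"
      using rel_beta[of "lam (j, N) t" P \<rho> "(i, N)" "Num x"] wft_lam t \<rho> num
      by (simp only: num_tm_def snd_conv)
    then have "rel P N (cl \<rho> ?f \<bullet> Num x \<bullet> Num y) (cl ?\<rho> (lam (j, N) t) \<bullet> Num y)"
      using rel_Num rel_Ap by blast
    moreover have "rel P N (cl ?\<rho> (lam (j, N) t) \<bullet> Num y) (cl (?\<rho>((j, N) := Num y)) t)"
      using rel_beta[of t P ?\<rho> "(j, N)" "Num y"] t env_upd[OF \<rho> num] num
      by (simp only: num_tm_def)
    ultimately show ?thesis using h rel_trans unfolding val_def by blast
  qed
  then show ?thesis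
    using rel_Rc_Num[OF f] assms(4,5) unfolding val_def Rec_def by simp
qed

lemma rec_nat_pred: "rec_nat 0 (\<lambda>i j. i) k = k - 1"
  by (cases k) auto

lemma val_pred: "val P \<rho> t n \<Longrightarrow> val P \<rho> (pred_t t) (n - 1)"
proof -
  assume t: "val P \<rho> t n"
  have "rel P N (Pi \<bullet> Num i \<bullet> Num j) (Num i)" for i j by (rule rel_step[OF step.Pi rel_Num])
  then have "rel P N (Rc \<bullet> Pi \<bullet> Num 0 \<bullet> cl \<rho> t) (Num (rec_nat 0 (\<lambda>i j. i) n))"
    using t rel_Pi rel_Num unfolding val_def by (intro rel_Rc_Num) blast+
  then show ?thesis by (simp add: val_def pred_t_def Rec_def rec_nat_pred del: rel.simps)
qed

lemma env_upd_Num: "env P \<rho> \<Longrightarrow> env P (\<rho>((i, N) := Num n))"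
  by (rule env_upd) (simp_all only: snd_conv rel_Num)

lemma val_monus:
  assumes "env P \<rho>" "val P \<rho> s m" "val P \<rho> t n"
  shows "val P \<rho> (s \<ominus> t) (m - n)"
proof -
  have "rec_nat m (\<lambda>i j. j - 1) n = m - n" by (induction n) auto
  moreover have "val P \<rho> (s \<ominus> t) (rec_nat m (\<lambda>i j. j - 1) n)"
    unfolding monus_def Let_def
    by (intro val_Rec_lam assms num_tm_pred num_tm_Var val_pred val_Var) simp
  ultimately show ?thesis by simp
qed

lemma val_pow2:
  assumes "env P \<rho>" "val P \<rho> t n"
  shows "val P \<rho> (pow2 t) (2 ^ n)"
proof -
  have "rec_nat 1 (\<lambda>i j. j + j) n = (2 ^ n :: nat)" by (induction n) auto
  moreover have "val P \<rho> (pow2 t) (rec_nat 1 (\<lambda>i j. j + j) n)"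
    unfolding pow2_def Let_def
    by (intro val_Rec_lam assms num_tm_plus num_tm_Var val_plus val_Var val_One) simp_all
  ultimately show ?thesis by simp
qed

text \<open>Copies the recursion of \<open>sqrt_t\<close>; \<open>nsqrt_bounds\<close> identifies it
  as the integer square root.\<close>

definition nsqrt :: "nat \<Rightarrow> nat" where
  "nsqrt n = rec_nat 0 (\<lambda>k m. m + (1 - ((m + 1) * (m + 1) - (k + 1)))) n"

lemma nsqrt_bounds: "nsqrt n * nsqrt n \<le> n \<and> n < (nsqrt n + 1) * (nsqrt n + 1)"
proof (induction n)
  case (Suc n)
  have "nsqrt (Suc n) = nsqrt n + (1 - ((nsqrt n + 1) * (nsqrt n + 1) - (n + 1)))"
    by (simp add: nsqrt_def)
  then show ?case using Suc
    by (cases "(nsqrt n + 1) * (nsqrt n + 1) \<le> n + 1") (auto simp: algebra_simps)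
qed (simp add: nsqrt_def)

lemma nsqrt_eqI:
  assumes "m * m \<le> n" "n < (m + 1) * (m + 1)"
  shows "nsqrt n = m"
proof -
  have mono: "a < b" if "a * a \<le> n" "n < (b + 1) * (b + 1)" "a \<noteq> b" for a b
  proof (rule ccontr)
    assume "\<not> a < b"
    then have "(b + 1) * (b + 1) \<le> a * a" using that(3) by (intro mult_le_mono) auto
    then show False using that(1,2) by linarith
  qed
  then show ?thesis using assms nsqrt_bounds[of n] by (metis less_asym)
qed

lemma val_sqrt:
  assumes "env P \<rho>" "val P \<rho> t n"
  shows "val P \<rho> (sqrt_t t) (nsqrt n)"
  unfolding sqrt_t_def Let_def nsqrt_def
  by (intro val_Rec_lam assms num_tm_plus num_tm_times num_tm_monus num_tm_Var num_tm_One
      val_plus val_times val_monus val_Var val_Zero val_One env_upd_Num) simp_all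

definition npair :: "nat \<Rightarrow> nat \<Rightarrow> nat" where "npair a b = (a + b) * (a + b) + a"
definition nfst :: "nat \<Rightarrow> nat" where "nfst q = q - nsqrt q * nsqrt q"
definition nsnd :: "nat \<Rightarrow> nat" where "nsnd q = nsqrt q - nfst q"

text \<open>The code exceeds the square of \<open>a + b\<close> by \<open>a\<close>, which is less
  than the distance \<open>2 * (a + b) + 1\<close> to the next square.\<close>

lemma nsqrt_npair: "nsqrt (npair a b) = a + b"
  by (rule nsqrt_eqI) (auto simp: npair_def algebra_simps)

lemma nfst_npair[simp]: "nfst (npair a b) = a"
  by (simp add: nfst_def nsqrt_npair) (simp add: npair_def)

lemma nsnd_npair[simp]: "nsnd (npair a b) = b"
  by (simp add: nsnd_def nsqrt_npair)

lemma val_pair: "val P \<rho> s m \<Longrightarrow> val P \<rho> t n \<Longrightarrow> val P \<rho> (pair s t) (npair m n)"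
  unfolding pair_def npair_def by (intro val_plus val_times)

lemma val_fst: "env P \<rho> \<Longrightarrow> val P \<rho> t n \<Longrightarrow> val P \<rho> (fst_t t) (nfst n)"
  unfolding fst_t_def nfst_def by (intro val_monus val_times val_sqrt)

lemma val_snd: "env P \<rho> \<Longrightarrow> val P \<rho> t n \<Longrightarrow> val P \<rho> (snd_t t) (nsnd n)"
  unfolding snd_t_def nsnd_def by (intro val_monus val_fst val_sqrt)


section \<open>Rationals and reals\<close>

definition qv :: "nat \<Rightarrow> real" where
  "qv q = (real (nfst (nfst q)) - real (nsnd (nfst q))) / (real (nsnd q) + 1)"

text \<open>Codes store the denominator minus one, hence \<open>d - 1\<close> on the left.\<close>

lemma qv_mkrat: "d > 0 \<Longrightarrow> qv (npair (npair a b) (d - 1)) = (real a - real b) / real d"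
  by (simp add: qv_def of_nat_diff)

lemma val_num_pos: "env P \<rho> \<Longrightarrow> val P \<rho> t n \<Longrightarrow> val P \<rho> (num_pos t) (nfst (nfst n))"
  and val_num_neg: "env P \<rho> \<Longrightarrow> val P \<rho> t n \<Longrightarrow> val P \<rho> (num_neg t) (nsnd (nfst n))"
  and val_den: "env P \<rho> \<Longrightarrow> val P \<rho> t n \<Longrightarrow> val P \<rho> (den t) (nsnd n + 1)"
  unfolding num_pos_def num_neg_def den_def
  by (intro val_fst val_snd val_plus val_One; assumption)+

lemma val_mkrat:
  "val P \<rho> s a \<Longrightarrow> val P \<rho> t b \<Longrightarrow> val P \<rho> u d \<Longrightarrow>
    val P \<rho> (mkrat s t u) (npair (npair a b) (d - 1))"
  unfolding mkrat_def by (intro val_pair val_pred)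

lemma forces_ratless:
  assumes "env P \<rho>" "val P \<rho> s x" "val P \<rho> t y"
  shows "forces P \<rho> (s \<prec>\<^sub>Q t) \<longleftrightarrow> qv x < qv y"
proof -
  let ?a = "nfst (nfst x)" and ?b = "nsnd (nfst x)" and ?c = "nsnd x + 1"
  let ?a' = "nfst (nfst y)" and ?b' = "nsnd (nfst y)" and ?c' = "nsnd y + 1"
  have "forces P \<rho> (s \<prec>\<^sub>Q t) \<longleftrightarrow> ?a * ?c' + ?b' * ?c < ?a' * ?c + ?b * ?c'"
    unfolding ratless_def
    by (intro forces_LessN; fold val_def; intro val_plus val_times val_num_pos val_num_neg val_den assms)
  also have "\<dots> \<longleftrightarrow> real (?a * ?c' + ?b' * ?c) < real (?a' * ?c + ?b * ?c')"
    by (simp only: of_nat_less_iff)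
  also have "\<dots> \<longleftrightarrow> (real ?a - real ?b) * real ?c' < (real ?a' - real ?b') * real ?c"
    by (simp add: algebra_simps)
  also have "\<dots> \<longleftrightarrow> (real ?a - real ?b) / real ?c < (real ?a' - real ?b') / real ?c'"
  proof -
    have "a * d < b * c \<longleftrightarrow> a / c < b / d" if "c > 0" "d > 0" for a b c d :: real
      using that by (simp add: field_simps)
    then show ?thesis by simp
  qed
  finally show ?thesis by (simp add: qv_def add.commute)
qed

lemma forces_ratle:
  assumes "env P \<rho>" "val P \<rho> s x" "val P \<rho> t y"
  shows "forces P \<rho> (s \<preceq>\<^sub>Q t) \<longleftrightarrow> qv x \<le> qv y"
proof -
  have "forces Q \<rho> (t \<prec>\<^sub>Q s) \<longleftrightarrow> qv y < qv x" if "Q \<le> P" for Q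
    using that assms env_mono val_mono by (intro forces_ratless) blast+
  then show ?thesis unfolding ratle_def forces_Neg by (meson not_le order_refl)
qed

definition nadd :: "nat \<Rightarrow> nat \<Rightarrow> nat" where
  "nadd x y = npair (npair (nfst (nfst x) * (nsnd y + 1) + nfst (nfst y) * (nsnd x + 1))
     (nsnd (nfst x) * (nsnd y + 1) + nsnd (nfst y) * (nsnd x + 1))) ((nsnd x + 1) * (nsnd y + 1) - 1)"

text \<open>The uncancelled \<open>nsnd x + 1 - 1\<close> is what \<open>pred_t\<close> yields on
  \<open>den\<close>; in this form \<open>val_ratdist\<close> can follow the term symbol by
  symbol.\<close>

definition nneg :: "nat \<Rightarrow> nat" where
  "nneg x = npair (npair (nsnd (nfst x)) (nfst (nfst x))) (nsnd x + 1 - 1)"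

definition nabs :: "nat \<Rightarrow> nat" where
  "nabs x = npair (npair ((nfst (nfst x) - nsnd (nfst x)) + (nsnd (nfst x) - nfst (nfst x))) 0) (nsnd x + 1 - 1)"

definition ndist :: "nat \<Rightarrow> nat \<Rightarrow> nat" where
  "ndist x y = nabs (nadd x (nneg y))"

lemma qv_nadd: "qv (nadd x y) = qv x + qv y"
proof -
  have frac: "(a * d + a' * c - (b * d + b' * c)) / (c * d) = (a - b) / c + (a' - b') / d"
    if "c > 0" "d > 0" for a b a' b' c d :: real
    using that by (simp add: field_simps)
  have "qv (nadd x y) = (real (nfst (nfst x) * (nsnd y + 1) + nfst (nfst y) * (nsnd x + 1)) -
      real (nsnd (nfst x) * (nsnd y + 1) + nsnd (nfst y) * (nsnd x + 1))) /
      real ((nsnd x + 1) * (nsnd y + 1))"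
    unfolding nadd_def by (rule qv_mkrat) simp
  also have "\<dots> = (real (nfst (nfst x)) * (real (nsnd y) + 1) + real (nfst (nfst y)) * (real (nsnd x) + 1) -
      (real (nsnd (nfst x)) * (real (nsnd y) + 1) + real (nsnd (nfst y)) * (real (nsnd x) + 1))) /
      ((real (nsnd x) + 1) * (real (nsnd y) + 1))"
    by (simp only: of_nat_add of_nat_mult of_nat_1)
  also have "\<dots> = qv x + qv y"
    unfolding qv_def by (rule frac) simp_all
  finally show ?thesis .
qed

lemma qv_nneg: "qv (nneg x) = - qv x"
  unfolding nneg_def by (subst qv_mkrat) (simp_all add: qv_def field_simps)

lemma qv_nabs: "qv (nabs x) = \<bar>qv x\<bar>"
proof -
  have "real ((a - b) + (b - a)) = \<bar>real a - real b\<bar>" for a b :: nat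
    by (cases "a \<le> b") (auto simp: of_nat_diff)
  then show ?thesis
    unfolding nabs_def by (subst qv_mkrat) (simp_all add: qv_def abs_divide)
qed

lemma qv_ndist: "qv (ndist x y) = \<bar>qv x - qv y\<bar>"
  by (simp add: ndist_def qv_nabs qv_nadd qv_nneg)

lemma val_ratadd: "env P \<rho> \<Longrightarrow> val P \<rho> s x \<Longrightarrow> val P \<rho> t y \<Longrightarrow> val P \<rho> (s \<oplus>\<^sub>Q t) (nadd x y)"
  unfolding ratadd_def nadd_def
  by (intro val_mkrat val_plus val_times val_num_pos val_num_neg val_den)

lemma val_ratdist: "env P \<rho> \<Longrightarrow> val P \<rho> s x \<Longrightarrow> val P \<rho> t y \<Longrightarrow> val P \<rho> (ratdist s t) (ndist x y)"
  unfolding ratdist_def ndist_def ratabs_def nabs_def ratneg_def nneg_def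
  by (intro val_mkrat val_plus val_monus val_num_pos val_num_neg val_den val_Zero val_ratadd)

definition nhalf :: "nat \<Rightarrow> nat" where "nhalf n = npair (npair 1 0) (2 ^ n - 1)"
definition ntwice_half :: "nat \<Rightarrow> nat" where "ntwice_half n = npair (npair (1 + 1) 0) (2 ^ n - 1)"

lemma qv_nhalf: "qv (nhalf n) = 1 / 2 ^ n"
  and qv_ntwice_half: "qv (ntwice_half n) = 2 / 2 ^ n"
  unfolding nhalf_def ntwice_half_def by (subst qv_mkrat; simp)+

lemma val_half_pow: "env P \<rho> \<Longrightarrow> val P \<rho> t n \<Longrightarrow> val P \<rho> (half_pow t) (nhalf n)"
  and val_twice_half_pow: "env P \<rho> \<Longrightarrow> val P \<rho> t n \<Longrightarrow> val P \<rho> (twice_half_pow t) (ntwice_half n)"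
  unfolding half_pow_def nhalf_def twice_half_pow_def ntwice_half_def
  by (intro val_mkrat val_plus val_Zero val_One val_pow2; assumption)+

section \<open>Terms denoting genuine functions, and formulas about reals\<close>

definition fval :: "cond \<Rightarrow> (var \<Rightarrow> ctm) \<Rightarrow> trm \<Rightarrow> (nat \<Rightarrow> nat) \<Rightarrow> bool" where
  "fval P \<rho> x g \<longleftrightarrow> wft x \<and> ty_of x = ty1 \<and> rel P ty1 (cl \<rho> x) (std g)"

lemma fval_mono: "fval P \<rho> x g \<Longrightarrow> Q \<le> P \<Longrightarrow> fval Q \<rho> x g"
  unfolding fval_def using rel_mono by blast

lemma fval_fresh: "fval P \<rho> x g \<Longrightarrow> fresh x \<le> i \<Longrightarrow> fval P (\<rho>((i, \<sigma>) := a)) x g"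
  unfolding fval_def by (simp add: cl_fresh)

lemma val_Ap:
  assumes "fval P \<rho> x g" "val P \<rho> t n"
  shows "val P \<rho> (x \<cdot> t) (g n)"
proof -
  have "rel P N (cl \<rho> x \<bullet> cl \<rho> t) (std g \<bullet> Num n)"
    using assms rel_Ap unfolding val_def fval_def by blast
  moreover have "rel P N (std g \<bullet> Num n) (Num (g n))"
    by (rule eval_imp_rel) simp
  ultimately show ?thesis unfolding val_def cl.simps by (rule rel_trans)
qed

text \<open>If the truth of the numeral instances does not vary below \<open>P\<close>, forcing a
  number quantifier is ordinary truth, because number objects are densely numerals.\<close>

lemma forces_Forall_N:
  assumes "env P \<rho>" "wff A" and X: "\<And>Q k. Q \<le> P \<Longrightarrow> forces Q (\<rho>((i, N) := Num k)) A \<longleftrightarrow> X k"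
  shows "forces P \<rho> (Forall (i, N) A) \<longleftrightarrow> (\<forall>k. X k)"
proof
  assume "forces P \<rho> (Forall (i, N) A)"
  then have "forces P (\<rho>((i, N) := Num k)) A" for k
    by (rule forces_ForallD) (simp only: snd_conv rel_Num)
  then show "\<forall>k. X k" using X by blast
next
  assume X': "\<forall>k. X k"
  show "forces P \<rho> (Forall (i, N) A)"
  proof (rule forces_ForallI)
    fix Q a assume Q: "Q \<le> P" "rel Q (snd (i, N)) a a"
    show "forces Q (\<rho>((i, N) := a)) A"
    proof (rule forces_dense_Num)
      show "rel Q N a a" using Q by (simp only: snd_conv)
      fix R k assume R: "R \<le> Q" "rel R N a (Num k)"
      have "rel_on (fv A) R (\<rho>((i, N) := a)) (\<rho>((i, N) := Num k))"
        using assms(1) Q R env_mono order_trans by (intro env_rel_on_upd) (blast, simp only: snd_conv)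
      then show "forces R (\<rho>((i, N) := a)) A"
        using forces_cong[OF assms(2)] X X' R(1) Q(1) order_trans by blast
    qed
  qed
qed

lemma forces_Exists_N:
  assumes "env P \<rho>" "wff A" "\<And>Q k. Q \<le> P \<Longrightarrow> forces Q (\<rho>((i, N) := Num k)) A \<longleftrightarrow> X k"
  shows "forces P \<rho> (Exists (i, N) A) \<longleftrightarrow> (\<exists>k. X k)"
proof -
  have "forces Q \<rho> (Forall (i, N) (\<^bold>\<not> A)) \<longleftrightarrow> (\<forall>k. \<not> X k)" if Q: "Q \<le> P" for Q
  proof (rule forces_Forall_N)
    show "env Q \<rho>" using assms(1) Q env_mono by blast
    show "wff (\<^bold>\<not> A)" using assms(2) by (simp add: Neg_def)
    show "forces R (\<rho>((i, N) := Num k)) (\<^bold>\<not> A) \<longleftrightarrow> \<not> X k" if "R \<le> Q" for R k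
      using assms(3) that Q order_trans unfolding forces_Neg by (meson order_refl)
  qed
  then show ?thesis unfolding Exists_def forces_Neg by (meson order_refl)
qed

definition isreal :: "(nat \<Rightarrow> nat) \<Rightarrow> bool" where
  "isreal g \<longleftrightarrow> (\<forall>n i. \<bar>qv (g n) - qv (g (n + i))\<bar> < 1 / 2 ^ n)"

lemma forces_is_real:
  assumes "env P \<rho>" "fval P \<rho> x g"
  shows "forces P \<rho> (is_real x) \<longleftrightarrow> isreal g"
proof -
  let ?n = "fresh x" and ?i = "Suc (fresh x)"
  let ?A = "ratdist (x \<cdot> Var (?n, N)) (x \<cdot> (Var (?n, N) \<oplus> Var (?i, N))) \<prec>\<^sub>Q half_pow (Var (?n, N))"
  have x: "wft x" "ty_of x = ty1" using assms(2) by (auto simp: fval_def)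
  have wff: "wff ?A" by (intro wff_ratless num_tm_intros x)
  have "forces R (\<rho>((?n, N) := Num n, (?i, N) := Num i)) ?A \<longleftrightarrow>
      \<bar>qv (g n) - qv (g (n + i))\<bar> < 1 / 2 ^ n" if R: "R \<le> P" for R n i
  proof -
    let ?\<rho> = "\<rho>((?n, N) := Num n, (?i, N) := Num i)"
    have env: "env R ?\<rho>" using assms(1) R env_mono env_upd_Num by blast
    have f: "fval R ?\<rho> x g" using assms(2) R by (intro fval_fresh fval_mono[OF _ R]) auto
    have n: "val R ?\<rho> (Var (?n, N)) n" "val R ?\<rho> (Var (?i, N)) i" by (auto intro: val_Var)
    show ?thesis
      using forces_ratless[OF env val_ratdist[OF env val_Ap[OF f n(1)] val_Ap[OF f val_plus[OF n]]]
          val_half_pow[OF env n(1)]] by (simp add: qv_ndist qv_nhalf)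
  qed
  then have inner: "forces R (\<rho>((?n, N) := Num n)) (Forall (?i, N) ?A) \<longleftrightarrow>
      (\<forall>i. \<bar>qv (g n) - qv (g (n + i))\<bar> < 1 / 2 ^ n)" if "R \<le> P" for R n
    using that assms(1) env_mono env_upd_Num wff order_trans by (intro forces_Forall_N) blast+
  show ?thesis unfolding is_real_def Let_def isreal_def
    by (rule forces_Forall_N[OF assms(1) _ inner]) (use wff in simp)
qed

lemma forces_realeq:
  assumes "env P \<rho>" "fval P \<rho> x g" "fval P \<rho> y h"
  shows "forces P \<rho> (x \<doteq>\<^sub>R y) \<longleftrightarrow> (\<forall>n. \<bar>qv (g n) - qv (h n)\<bar> \<le> 2 / 2 ^ n)"
proof -
  let ?n = "max (fresh x) (fresh y)"
  have xy: "wft x" "ty_of x = ty1" "wft y" "ty_of y = ty1" using assms by (auto simp: fval_def)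
  show ?thesis unfolding realeq_def Let_def
  proof (rule forces_Forall_N[OF assms(1)])
    show "wff (ratdist (x \<cdot> Var (?n, N)) (y \<cdot> Var (?n, N)) \<preceq>\<^sub>Q twice_half_pow (Var (?n, N)))"
      by (intro wff_ratle num_tm_intros xy)
    fix R n assume R: "R \<le> P"
    let ?\<rho> = "\<rho>((?n, N) := Num n)"
    have env: "env R ?\<rho>" using assms(1) R env_mono env_upd_Num by blast
    have f: "fval R ?\<rho> x g" "fval R ?\<rho> y h"
      using assms(2,3) R by (auto intro!: fval_fresh fval_mono[OF _ R])
    have n: "val R ?\<rho> (Var (?n, N)) n" by (auto intro: val_Var)
    show "forces R ?\<rho> (ratdist (x \<cdot> Var (?n, N)) (y \<cdot> Var (?n, N)) \<preceq>\<^sub>Q twice_half_pow (Var (?n, N))) \<longleftrightarrow>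
        \<bar>qv (g n) - qv (h n)\<bar> \<le> 2 / 2 ^ n"
      using forces_ratle[OF env val_ratdist[OF env val_Ap[OF f(1) n] val_Ap[OF f(2) n]]
          val_twice_half_pow[OF env n]] by (simp add: qv_ndist qv_ntwice_half)
  qed
qed

lemma forces_realless:
  assumes "env P \<rho>" "fval P \<rho> x g" "fval P \<rho> y h"
  shows "forces P \<rho> (x \<prec>\<^sub>R y) \<longleftrightarrow> (\<exists>n. qv (g n) + 2 / 2 ^ n < qv (h n))"
proof -
  let ?n = "max (fresh x) (fresh y)"
  have xy: "wft x" "ty_of x = ty1" "wft y" "ty_of y = ty1" using assms by (auto simp: fval_def)
  show ?thesis unfolding realless_def Let_def
  proof (rule forces_Exists_N[OF assms(1)])
    show "wff (x \<cdot> Var (?n, N) \<oplus>\<^sub>Q twice_half_pow (Var (?n, N)) \<prec>\<^sub>Q y \<cdot> Var (?n, N))"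
      by (intro wff_ratless num_tm_intros xy)
    fix R n assume R: "R \<le> P"
    let ?\<rho> = "\<rho>((?n, N) := Num n)"
    have env: "env R ?\<rho>" using assms(1) R env_mono env_upd_Num by blast
    have f: "fval R ?\<rho> x g" "fval R ?\<rho> y h"
      using assms(2,3) R by (auto intro!: fval_fresh fval_mono[OF _ R])
    have n: "val R ?\<rho> (Var (?n, N)) n" by (auto intro: val_Var)
    show "forces R ?\<rho> (x \<cdot> Var (?n, N) \<oplus>\<^sub>Q twice_half_pow (Var (?n, N)) \<prec>\<^sub>Q y \<cdot> Var (?n, N)) \<longleftrightarrow>
        qv (g n) + 2 / 2 ^ n < qv (h n)"
      using forces_ratless[OF env val_ratadd[OF env val_Ap[OF f(1) n] val_twice_half_pow[OF env n]]
          val_Ap[OF f(2) n]] by (simp add: qv_nadd qv_ntwice_half)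
  qed
qed

lemma fval_real_of_ratcode:
  assumes "num_tm t" "val P \<rho> t c" "env P \<rho>"
  shows "fval P \<rho> (real_of_ratcode t) (\<lambda>_. c)"
proof -
  have t: "wft (real_of_ratcode t)" "ty_of (real_of_ratcode t) = ty1"
    using assms(1) by (auto simp: num_tm_def real_of_ratcode_def)
  have "rel P ty1 (cl \<rho> (real_of_ratcode t)) (std (\<lambda>_. c))"
  proof (rule rel_ty1I)
    fix i
    have "rel P N (Pi \<bullet> cl \<rho> t \<bullet> Num i) (Num c)"
      using assms(2) unfolding val_def by (rule rel_step[OF step.Pi])
    moreover have "rel P N (Num c) (std (\<lambda>_. c) \<bullet> Num i)" by auto
    ultimately show "rel P N (cl \<rho> (real_of_ratcode t) \<bullet> Num i) (std (\<lambda>_. c) \<bullet> Num i)"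
      unfolding real_of_ratcode_def cl.simps ccst.simps by (rule rel_trans)
  qed (use rel_cl_env[OF t assms(3)] rel_std in blast)+
  then show ?thesis using t by (simp add: fval_def del: rel.simps)
qed

lemma fval_realdist:
  assumes "env P \<rho>" "fval P \<rho> x g" "fval P \<rho> y h"
  shows "fval P \<rho> (realdist x y) (\<lambda>n. ndist (g (n + 1)) (h (n + 1)))"
proof -
  let ?n = "(max (fresh x) (fresh y), N)"
  let ?t = "ratdist (x \<cdot> (Var ?n \<oplus> \<^bold>1)) (y \<cdot> (Var ?n \<oplus> \<^bold>1))"
  have xy: "wft x" "ty_of x = ty1" "wft y" "ty_of y = ty1" using assms by (auto simp: fval_def)
  have num: "num_tm ?t" by (intro num_tm_intros xy)
  then have t: "wft (realdist x y)" "ty_of (realdist x y) = ty1"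
    unfolding realdist_def Let_def num_tm_def using wft_lam[of ?t ?n] by auto
  have "rel P ty1 (cl \<rho> (realdist x y)) (std (\<lambda>n. ndist (g (n + 1)) (h (n + 1))))"
  proof (rule rel_ty1I)
    fix i
    let ?\<rho> = "\<rho>(?n := Num i)"
    have env: "env P ?\<rho>" using assms(1) env_upd_Num by blast
    have f: "fval P ?\<rho> x g" "fval P ?\<rho> y h" using assms(2,3) by (auto intro!: fval_fresh)
    have n: "val P ?\<rho> (Var ?n \<oplus> \<^bold>1) (i + 1)" by (intro val_plus val_One val_Var) simp
    have "val P ?\<rho> ?t (ndist (g (i + 1)) (h (i + 1)))"
      by (intro val_ratdist env val_Ap f n)
    moreover have "rel P N (cl \<rho> (realdist x y) \<bullet> Num i) (cl ?\<rho> ?t)"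
      using rel_beta[of ?t P \<rho> ?n "Num i"] num assms(1) rel_Num
      unfolding realdist_def Let_def num_tm_def by (simp only: snd_conv)
    moreover have "rel P N (Num (ndist (g (i + 1)) (h (i + 1))))
        (std (\<lambda>n. ndist (g (n + 1)) (h (n + 1))) \<bullet> Num i)" by auto
    ultimately show "rel P N (cl \<rho> (realdist x y) \<bullet> Num i)
        (std (\<lambda>n. ndist (g (n + 1)) (h (n + 1))) \<bullet> Num i)"
      unfolding val_def by (meson rel_trans)
  qed (use rel_cl_env[OF t assms(1)] rel_std in blast)+
  then show ?thesis using t by (simp add: fval_def del: rel.simps)
qed

section \<open>Limits of fast Cauchy sequences\<close>

definition rv :: "(nat \<Rightarrow> nat) \<Rightarrow> real" where
  "rv g = lim (\<lambda>n. qv (g n))"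

lemma isreal_rv:
  assumes "isreal g"
  shows "(\<lambda>n. qv (g n)) \<longlonglongrightarrow> rv g" and "\<bar>qv (g n) - rv g\<bar> \<le> 1 / 2 ^ n"
proof -
  have bound: "\<bar>qv (g n) - qv (g m)\<bar> < 1 / 2 ^ n" if "n \<le> m" for n m
    using assms that unfolding isreal_def by (metis le_Suc_ex)
  have "Cauchy (\<lambda>n. qv (g n))"
  proof (rule CauchyI')
    fix e :: real assume "e > 0"
    then obtain M where "inverse 2 ^ M < e" using real_arch_pow_inv[of e "inverse 2"] by auto
    then have M: "1 / 2 ^ M < e" by (simp add: power_inverse power_one_over inverse_eq_divide)
    have "dist (qv (g m)) (qv (g n)) < e" if "m \<ge> M" "m < n" for m n
    proof -
      have "dist (qv (g m)) (qv (g n)) < 1 / 2 ^ m"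
        using bound[of m n] that by (simp add: dist_real_def)
      also have "\<dots> \<le> 1 / 2 ^ M" using that by (simp add: field_simps)
      finally show ?thesis using M by simp
    qed
    then show "\<exists>M. \<forall>m\<ge>M. \<forall>n>m. dist (qv (g m)) (qv (g n)) < e" by blast
  qed
  then show lim: "(\<lambda>n. qv (g n)) \<longlonglongrightarrow> rv g"
    unfolding rv_def by (simp add: Cauchy_convergent_iff convergent_LIMSEQ_iff)
  have "(\<lambda>m. \<bar>qv (g n) - qv (g m)\<bar>) \<longlonglongrightarrow> \<bar>qv (g n) - rv g\<bar>"
    by (intro tendsto_intros lim)
  then show "\<bar>qv (g n) - rv g\<bar> \<le> 1 / 2 ^ n"
    by (rule LIMSEQ_le_const2) (use bound less_imp_le in blast)
qed

lemma rv_const: "rv (\<lambda>_. c) = qv c"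
  unfolding rv_def by (intro limI tendsto_const)

lemma isreal_const: "isreal (\<lambda>_. c)"
  by (simp add: isreal_def)

lemma rv_eq:
  assumes "isreal g" "isreal h" "\<forall>n. \<bar>qv (g n) - qv (h n)\<bar> \<le> 2 / 2 ^ n"
  shows "rv g = rv h"
proof -
  have "(\<lambda>n. qv (g n) - qv (h n)) \<longlonglongrightarrow> 0"
  proof (rule tendsto_rabs_zero_cancel, rule tendsto_sandwich[of "\<lambda>_. 0"])
    have "(\<lambda>n. 2 * (1 / 2) ^ n :: real) \<longlonglongrightarrow> 2 * 0"
      by (intro tendsto_intros LIMSEQ_realpow_zero) auto
    then show "(\<lambda>n. 2 / 2 ^ n :: real) \<longlonglongrightarrow> 0" by (simp add: power_divide)
  qed (use assms(3) in auto)
  moreover have "(\<lambda>n. qv (g n) - qv (h n)) \<longlonglongrightarrow> rv g - rv h"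
    by (intro tendsto_intros isreal_rv assms)
  ultimately show ?thesis using LIMSEQ_unique by fastforce
qed

lemma rv_less_iff:
  assumes "isreal g" "isreal h"
  shows "(\<exists>n. qv (g n) + 2 / 2 ^ n < qv (h n)) \<longleftrightarrow> rv g < rv h"
proof
  assume "\<exists>n. qv (g n) + 2 / 2 ^ n < qv (h n)"
  then obtain n where "qv (g n) + 2 / 2 ^ n < qv (h n)" by blast
  moreover have "(2::real) / 2 ^ n = 1 / 2 ^ n + 1 / 2 ^ n" by (simp add: add_divide_distrib[symmetric])
  ultimately show "rv g < rv h"
    using isreal_rv(2)[OF assms(1), of n] isreal_rv(2)[OF assms(2), of n] by linarith
next
  assume "rv g < rv h"
  \<comment> \<open>With \<open>e = 1 / 2 ^ n\<close>, the approximations cost \<open>e\<close> on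
    each side and the order demands a margin of \<open>2 * e\<close>; so \<open>4 * e\<close> has to
    fit into the gap.\<close>
  then have "(rv h - rv g) / 4 > 0" by simp
  then obtain n where "inverse 2 ^ n < (rv h - rv g) / 4"
    using real_arch_pow_inv[of "(rv h - rv g) / 4" "inverse 2"] by auto
  moreover define e :: real where "e = 1 / 2 ^ n"
  ultimately have "4 * e < rv h - rv g" by (simp add: power_inverse power_one_over inverse_eq_divide)
  moreover have "2 / 2 ^ n = 2 * e" by (simp add: e_def)
  ultimately have "qv (g n) + 2 / 2 ^ n < qv (h n)"
    using isreal_rv(2)[OF assms(1), of n] isreal_rv(2)[OF assms(2), of n] unfolding e_def[symmetric]
    by linarith
  then show "\<exists>n. qv (g n) + 2 / 2 ^ n < qv (h n)" by blast
qed

text \<open>The two approximations are off by \<open>1 / 2 ^ (n + 1)\<close> each, together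
  \<open>1 / 2 ^ n\<close>, which the margin \<open>2 / 2 ^ n\<close> absorbs.\<close>

lemma rv_dist_less:
  assumes "isreal g" "isreal h" "qv (ndist (g (n + 1)) (h (n + 1))) + 2 / 2 ^ n < r"
  shows "\<bar>rv g - rv h\<bar> < r"
proof -
  have "(2::real) / 2 ^ n = 4 * (1 / 2 ^ (n + 1))" by simp
  moreover have "(1::real) / 2 ^ (n + 1) > 0" by simp
  ultimately show ?thesis
    using assms(3) isreal_rv(2)[OF assms(1), of "n + 1"] isreal_rv(2)[OF assms(2), of "n + 1"]
    unfolding qv_ndist by linarith
qed


section \<open>A generic sequence of open dense sets\<close>

text \<open>The number \<open>6\<close> codes the rational \<open>1\<close>, so the \<open>n\<close>-th set consists of the reals whose
  generic value is at least \<open>n\<close>.\<close>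
definition generic :: orc where
  "generic n g m p = map_option (\<lambda>j. if n \<le> j then 6 else 0) (p (rv g))"

lemma qv_6: "qv 6 = 1"
proof -
  have "(6::nat) = npair (npair 1 0) (1 - 1)" by (simp add: npair_def)
  then show ?thesis using qv_mkrat[of 1 1 0] by simp
qed

lemma qv_0: "qv 0 = 0"
proof -
  have "(0::nat) = npair (npair 0 0) (1 - 1)" by (simp add: npair_def)
  then show ?thesis using qv_mkrat[of 1 0 0] by simp
qed

lemma qv_surj_rat:
  assumes "x \<in> \<rat>"
  shows "\<exists>c. qv c = x"
proof -
  from assms obtain a b :: int where b: "b > 0" and x: "x = of_int a / of_int b"
    by (rule Rats_cases')
  have "real (nat a) - real (nat (- a)) = of_int a" by auto
  then have "qv (npair (npair (nat a) (nat (- a))) (nat b - 1)) = x"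
    using qv_mkrat[of "nat b" "nat a" "nat (- a)"] b x by simp
  then show ?thesis by blast
qed

text \<open>A fresh real takes any spare value, and the reserve minus one number is still infinite.
  This makes the generic oracle total.\<close>

lemma ex_pos: "\<exists>R\<le>P. \<exists>j. pos R z = Some j"
proof (cases "pos P z")
  case None
  obtain e where e: "e \<in> spare P" using infinite_spare[of P] by (metis finite.emptyI all_not_in_conv)
  have ran: "ran ((pos P)(z \<mapsto> e)) = insert e (ran (pos P))" using None by simp
  have "e \<notin> ran (pos P)" using e ran_pos_spare[of P] by blast
  then have "inj_on ((pos P)(z \<mapsto> e)) (dom ((pos P)(z \<mapsto> e)))"
    using inj_on_pos[of P] None by (auto simp: inj_on_def ran_def)
  moreover have "infinite (spare P - {e})" using infinite_spare[of P] by simp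
  moreover have "ran ((pos P)(z \<mapsto> e)) \<inter> (spare P - {e}) = {}"
    unfolding ran using ran_pos_spare[of P] by blast
  ultimately obtain R where R: "pos R = (pos P)(z \<mapsto> e)" "spare R = spare P - {e}"
    by (rule ex_cond)
  have "R \<le> P"
    unfolding less_eq_cond_def R ran using None e by (auto simp: map_le_def)
  then show ?thesis using R(1) by (metis fun_upd_same)
qed auto

text \<open>Discarding finitely many spare values is always allowed; from then on no new real can
  receive a value below \<open>k\<close>.\<close>

lemma ex_spare_ge: "\<exists>R\<le>P. spare R \<inter> {..<k} = {}"
proof -
  have "infinite (spare P - {..<k})" using infinite_spare[of P] by simp
  moreover have "ran (pos P) \<inter> (spare P - {..<k}) = {}" using ran_pos_spare[of P] by blast
  ultimately obtain R where R: "pos R = pos P" "spare R = spare P - {..<k}"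
    by (rule ex_cond[OF inj_on_pos])
  then have "R \<le> P" by (auto simp: less_eq_cond_def)
  then show ?thesis using R by (intro exI[of _ R]) auto
qed

definition small :: "cond \<Rightarrow> nat \<Rightarrow> real set" where
  "small P k = {z. \<exists>j<k. pos P z = Some j}"

text \<open>Injectivity leaves at most one real for each value below \<open>k\<close>.\<close>

lemma finite_small: "finite (small P k)"
proof (rule inj_on_finite)
  show "inj_on (pos P) (small P k)"
    using inj_on_pos[of P] by (rule inj_on_subset) (auto simp: small_def)
  show "pos P ` small P k \<subseteq> Some ` {..<k}" by (auto simp: small_def)
qed simp

text \<open>A value below \<open>k\<close> cannot come from the reserve, so \<open>P\<close> already
  gives it to some real, and injectivity of the map of \<open>Q\<close> makes that real equal to
  \<open>z\<close>.\<close>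

lemma small_mono:
  assumes "spare P \<inter> {..<k} = {}" "Q \<le> P" "pos Q z = Some j" "j < k"
  shows "z \<in> small P k"
proof -
  have "j \<in> ran (pos P) \<union> spare P" using assms(2,3) by (auto simp: less_eq_cond_def ran_def)
  then have "j \<in> ran (pos P)" using assms(1,4) by blast
  then obtain y where y: "pos P y = Some j" by (auto simp: ran_def)
  then have "pos Q y = Some j" using map_le_SomeD[OF pos_mono[OF assms(2)]] by blast
  then have "y = z" using inj_on_pos[of Q] assms(3) by (auto simp: inj_on_def domIff)
  then show ?thesis using y assms(4) by (auto simp: small_def)
qed

lemma mono_generic: "mono_orc generic"
  unfolding mono_orc_def generic_def using map_le_SomeD by fastforce

lemma total_generic: "total_orc P generic"
  unfolding total_orc_def generic_def using ex_pos by simp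

lemma rel_generic: "rel P (N \<rightarrow> ty1 \<rightarrow> ty1) (Or generic) (Or generic)"
  by (rule rel_Or[OF mono_generic total_generic])

context
  fixes Y :: var and n :: var
  assumes Y: "snd Y = N \<rightarrow> ty1 \<rightarrow> ty1" and n: "snd n = N"
begin

abbreviation "Yn \<equiv> Var Y \<cdot> Var n"

definition gen_env :: "cond \<Rightarrow> (var \<Rightarrow> ctm) \<Rightarrow> nat \<Rightarrow> bool" where
  "gen_env P \<rho> k \<longleftrightarrow> env P \<rho> \<and> \<rho> Y = Or generic \<and> rel P N (\<rho> n) (Num k)"

lemma gen_env_mono: "gen_env P \<rho> k \<Longrightarrow> Q \<le> P \<Longrightarrow> gen_env Q \<rho> k"
  unfolding gen_env_def using env_mono rel_mono by blast

lemma gen_env_upd: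
  assumes "gen_env P \<rho> k" "fresh Yn \<le> i" "rel P \<sigma> a a"
  shows "gen_env P (\<rho>((i, \<sigma>) := a)) k"
proof -
  have "(i, \<sigma>) \<noteq> Y" "(i, \<sigma>) \<noteq> n" using assms(2) by auto
  moreover have "env P (\<rho>((i, \<sigma>) := a))"
    using assms(1,3) unfolding gen_env_def by (intro env_upd) (simp_all del: rel.simps)
  ultimately show ?thesis using assms(1) by (simp add: gen_env_def del: rel.simps)
qed

lemma gen_env_env: "gen_env P \<rho> k \<Longrightarrow> env P \<rho>"
  by (simp add: gen_env_def)

lemma fval_generic:
  assumes \<rho>: "gen_env P \<rho> k" and x: "fval P \<rho> x g" and j: "pos P (rv g) = Some j"
  shows "fval P \<rho> (Yn \<cdot> x) (\<lambda>_. if k \<le> j then 6 else 0)"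
proof -
  let ?v = "if k \<le> j then 6 else 0 :: nat"
  have wf: "wft (Yn \<cdot> x)" "ty_of (Yn \<cdot> x) = ty1"
    using x Y n by (auto simp: fval_def)
  have "rel P ty1 (Or generic \<bullet> \<rho> n \<bullet> cl \<rho> x) (Or generic \<bullet> Num k \<bullet> std g)"
    using rel_Ap[OF rel_Ap[OF rel_generic]] \<rho> x unfolding gen_env_def fval_def by blast
  moreover have "rel P ty1 (Or generic \<bullet> Num k \<bullet> std g) (std (\<lambda>_. ?v))"
  proof (rule rel_ty1I)
    fix i
    have "eval (pos P) (Or generic \<bullet> Num k \<bullet> std g \<bullet> Num i) ?v"
    proof (rule eval.Or[OF mono_generic])
      show "generic k g i (pos P) = Some ?v" by (simp add: generic_def j)
    qed simp_all
    then have "rel P N (Or generic \<bullet> Num k \<bullet> std g \<bullet> Num i) (Num ?v)" by (rule eval_imp_rel)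
    moreover have "rel P N (Num ?v) (std (\<lambda>_. ?v) \<bullet> Num i)" by auto
    ultimately show "rel P N (Or generic \<bullet> Num k \<bullet> std g \<bullet> Num i) (std (\<lambda>_. ?v) \<bullet> Num i)"
      by (rule rel_trans)
  next
    show "rel P ty1 (Or generic \<bullet> Num k \<bullet> std g) (Or generic \<bullet> Num k \<bullet> std g)"
      using rel_Ap[OF rel_Ap[OF rel_generic rel_Num] rel_std] .
  qed (rule rel_std)
  ultimately have "rel P ty1 (cl \<rho> (Yn \<cdot> x)) (std (\<lambda>_. ?v))"
    using rel_trans \<rho> unfolding gen_env_def cl.simps by metis
  then show ?thesis using wf by (simp add: fval_def del: rel.simps)
qed

lemma forces_mem:
  assumes \<rho>: "gen_env P \<rho> k" and x: "fval P \<rho> x g" and j: "pos P (rv g) = Some j"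
  shows "forces P \<rho> (x \<epsilon> Yn) \<longleftrightarrow> k \<le> j"
proof -
  have "fval P \<rho> (real_of_ratcode \<^bold>0) (\<lambda>_. 0)"
    by (rule fval_real_of_ratcode[OF num_tm_Zero val_Zero gen_env_env[OF \<rho>]])
  then have "forces P \<rho> (x \<epsilon> Yn) \<longleftrightarrow>
      (\<exists>i. qv 0 + 2 / 2 ^ i < qv (if k \<le> j then 6 else 0))"
    unfolding mem_R_def using forces_realless[OF gen_env_env[OF \<rho>] _ fval_generic[OF assms]] by simp
  also have "\<dots> \<longleftrightarrow> k \<le> j"
  proof (cases "k \<le> j")
    case True
    \<comment> \<open>At index 2 the margin is \<open>2 / 2 ^ 2\<close>, which is below 1; at index
      1 it would be exactly 1.\<close>
    have "\<exists>i. qv 0 + 2 / 2 ^ i < qv 6"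
      by (rule exI[of _ 2]) (simp add: qv_0 qv_6)
    then show ?thesis using True by simp
  qed (simp add: qv_0)
  finally show ?thesis .
qed

lemma fval_Var: "snd v = ty1 \<Longrightarrow> rel P ty1 (\<rho> v) (std g) \<Longrightarrow> fval P \<rho> (Var v) g"
  by (simp add: fval_def del: rel.simps)

text \<open>By local character the bound real may be taken to be a genuine Cauchy sequence whose
  limit already has a generic value.\<close>

lemma forces_ForallRI:
  assumes \<rho>: "gen_env P \<rho> k" and i: "fresh Yn \<le> i"
    and step: "\<And>Q a g j. Q \<le> P \<Longrightarrow> rel Q ty1 a (std g) \<Longrightarrow> isreal g \<Longrightarrow> pos Q (rv g) = Some j \<Longrightarrow>
      gen_env Q (\<rho>((i, ty1) := a)) k \<Longrightarrow> forces Q (\<rho>((i, ty1) := a)) A"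
  shows "forces P \<rho> (ForallR (i, ty1) A)"
  unfolding ForallR_def
proof (intro forces_ForallI forces_ImpI)
  fix Q a Q' assume Q: "Q \<le> P" and a: "rel Q (snd (i, ty1)) a a" and Q': "Q' \<le> Q"
    and is_real: "forces Q' (\<rho>((i, ty1) := a)) (is_real (Var (i, ty1)))"
  let ?\<rho> = "\<rho>((i, ty1) := a)"
  have a': "rel Q' ty1 a a" using rel_mono[OF a Q'] by (simp only: snd_conv)
  show "forces Q' ?\<rho> A"
  proof (rule forces_dense)
    fix R assume R: "R \<le> Q'"
    obtain S g where S: "S \<le> R" "rel S ty1 a (std g)" using rel_ty1_std[OF a' R] by blast
    obtain T j where T: "T \<le> S" "pos T (rv g) = Some j" using ex_pos by blast
    have TQ': "T \<le> Q'" and TP: "T \<le> P" using Q Q' R S T order_trans by meson+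
    have env: "gen_env T ?\<rho> k"
      using gen_env_upd[OF gen_env_mono[OF \<rho> TP] i] rel_mono[OF a' TQ'] by blast
    have g: "rel T ty1 a (std g)" using rel_mono S(2) T(1) by blast
    then have "fval T ?\<rho> (Var (i, ty1)) g" by (intro fval_Var) (simp_all del: rel.simps)
    then have "isreal g"
      using forces_is_real[OF gen_env_env[OF env]] forces_mono[OF is_real TQ'] by blast
    then have "forces T ?\<rho> A" using step[OF TP g _ T(2) env] by blast
    then show "\<exists>R'\<le>R. forces R' ?\<rho> A" using T(1) S(1) order_trans by blast
  qed
qed

text \<open>The oracle consults a Cauchy sequence only through its limit, so equal reals get the
  same answer; every answer is a constant sequence and thus a real.\<close>

lemma forces_real_function:
  assumes \<rho>: "gen_env P \<rho> k"
  shows "forces P \<rho> (real_function Yn)"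
proof -
  let ?x = "(fresh Yn, ty1)" and ?y = "(Suc (fresh Yn), ty1)"
  have "forces P \<rho> (ForallR ?x (is_real (Yn \<cdot> Var ?x)))"
  proof (rule forces_ForallRI[OF \<rho> order_refl])
    fix Q a g j
    assume g: "rel Q ty1 a (std g)" "pos Q (rv g) = Some j" and env: "gen_env Q (\<rho>(?x := a)) k"
    have "fval Q (\<rho>(?x := a)) (Var ?x) g"
      by (rule fval_Var) (use g(1) in \<open>simp_all del: rel.simps\<close>)
    then have "fval Q (\<rho>(?x := a)) (Yn \<cdot> Var ?x) (\<lambda>_. if k \<le> j then 6 else 0)"
      using fval_generic[OF env] g(2) by blast
    then show "forces Q (\<rho>(?x := a)) (is_real (Yn \<cdot> Var ?x))"
      using forces_is_real[OF gen_env_env[OF env]] isreal_const by blast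
  qed
  moreover have "forces P \<rho> (ForallR ?x (ForallR ?y
      (Var ?x \<doteq>\<^sub>R Var ?y \<^bold>\<longrightarrow> Yn \<cdot> Var ?x \<doteq>\<^sub>R Yn \<cdot> Var ?y)))"
  proof (rule forces_ForallRI[OF \<rho> order_refl], rule forces_ForallRI[OF _ le_SucI[OF order_refl]])
    fix Q a g j
    assume "gen_env Q (\<rho>(?x := a)) k"
    then show "gen_env Q (\<rho>(?x := a)) k" .
  next
    fix Q a g j R b h l
    let ?\<rho> = "\<rho>(?x := a, ?y := b)"
    assume a: "rel Q ty1 a (std g)" "isreal g" "pos Q (rv g) = Some j"
      and R: "R \<le> Q"
      and b: "rel R ty1 b (std h)" "isreal h" "pos R (rv h) = Some l" and env: "gen_env R ?\<rho> k"
    have j: "pos R (rv g) = Some j" using map_le_SomeD[OF pos_mono[OF R]] a(3) .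
    have x: "fval R ?\<rho> (Var ?x) g"
      by (rule fval_Var) (use rel_mono[OF a(1) R] in \<open>simp_all del: rel.simps\<close>)
    have y: "fval R ?\<rho> (Var ?y) h"
      by (rule fval_Var) (use b(1) in \<open>simp_all del: rel.simps\<close>)
    show "forces R ?\<rho> (Var ?x \<doteq>\<^sub>R Var ?y \<^bold>\<longrightarrow> Yn \<cdot> Var ?x \<doteq>\<^sub>R Yn \<cdot> Var ?y)"
    proof (rule forces_ImpI)
      fix S assume S: "S \<le> R" "forces S ?\<rho> (Var ?x \<doteq>\<^sub>R Var ?y)"
      have env': "env S ?\<rho>" using env S(1) gen_env_env env_mono by blast
      have "\<forall>n. \<bar>qv (g n) - qv (h n)\<bar> \<le> 2 / 2 ^ n"
        using forces_realeq[OF env' fval_mono[OF x S(1)] fval_mono[OF y S(1)]] S(2) by blast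
      then have "l = j" using rv_eq[OF a(2) b(2)] j b(3) by simp
      then show "forces S ?\<rho> (Yn \<cdot> Var ?x \<doteq>\<^sub>R Yn \<cdot> Var ?y)"
        using forces_realeq[OF env' fval_mono[OF fval_generic[OF env x j] S(1)]
            fval_mono[OF fval_generic[OF env y b(3)] S(1)]] by simp
    qed
  qed
  ultimately show ?thesis unfolding real_function_def Let_def forces_Conj by blast
qed

text \<open>Without spare values below \<open>k\<close>, the complement of the set is frozen: at all
  extensions it stays inside the finite set \<open>small P k\<close>, from which any other point has
  positive distance.\<close>

lemma forces_open:
  assumes \<rho>: "gen_env P \<rho> k" and spare: "spare P \<inter> {..<k} = {}"
  shows "forces P \<rho> (open_R Yn)"
  unfolding open_R_def Let_def
proof (rule forces_ForallRI[OF \<rho> order_refl], rule forces_ImpI)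
  let ?x = "(fresh Yn, ty1)" and ?y = "(Suc (fresh Yn), ty1)" and ?r = "(fresh Yn, N)"
  fix Q a g j R
  assume Q: "Q \<le> P" and a: "rel Q ty1 a (std g)" "isreal g" "pos Q (rv g) = Some j"
    and env: "gen_env Q (\<rho>(?x := a)) k" and R: "R \<le> Q"
    and mem: "forces R (\<rho>(?x := a)) (Var ?x \<epsilon> Yn)"
  have envR: "gen_env R (\<rho>(?x := a)) k" using env R gen_env_mono by blast
  have x: "fval R (\<rho>(?x := a)) (Var ?x) g"
    by (rule fval_Var) (use rel_mono[OF a(1) R] in \<open>simp_all del: rel.simps\<close>)
  have j: "pos R (rv g) = Some j" using map_le_SomeD[OF pos_mono[OF R]] a(3) .
  have kj: "k \<le> j" using forces_mem[OF envR x j] mem by blast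
  have "rv g \<notin> small P k"
    using kj j map_le_SomeD[OF pos_mono[OF order_trans[OF R Q]]] by (fastforce simp: small_def)
  moreover have "open (- small P k)" by (intro open_Compl finite_imp_closed finite_small)
  ultimately obtain e where e: "e > 0" "\<And>z. dist z (rv g) < e \<Longrightarrow> z \<notin> small P k"
    unfolding open_dist by (metis ComplD ComplI)
  \<comment> \<open>The formula asks for a rational radius, hence a code \<open>c\<close> below the
    real radius \<open>e\<close>.\<close>
  obtain c where c: "0 < qv c" "qv c < e"
    using Rats_dense_in_real[OF e(1)] qv_surj_rat by metis
  show "forces R (\<rho>(?x := a)) (Exists ?r (\<^bold>0 \<prec>\<^sub>Q Var ?r \<^bold>\<and>
      ForallR ?y (realdist (Var ?x) (Var ?y) \<prec>\<^sub>R real_of_ratcode (Var ?r) \<^bold>\<longrightarrow> Var ?y \<epsilon> Yn)))"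
  proof (rule forces_ExistsI)
    show "rel R (snd ?r) (Num c) (Num c)" by (simp only: snd_conv rel_Num)
    let ?\<rho> = "\<rho>(?x := a, ?r := Num c)"
    have env': "gen_env R ?\<rho> k" by (rule gen_env_upd[OF envR order_refl rel_Num])
    have r: "val R ?\<rho> (Var ?r) c" by (rule val_Var) simp
    have "forces R ?\<rho> (\<^bold>0 \<prec>\<^sub>Q Var ?r)"
      using forces_ratless[OF gen_env_env[OF env'] val_Zero r] c(1) by (simp add: qv_0)
    moreover have "forces R ?\<rho> (ForallR ?y
        (realdist (Var ?x) (Var ?y) \<prec>\<^sub>R real_of_ratcode (Var ?r) \<^bold>\<longrightarrow> Var ?y \<epsilon> Yn))"
    proof (rule forces_ForallRI[OF env' le_SucI[OF order_refl]], rule forces_ImpI)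
      fix S b h l T
      let ?\<rho>' = "?\<rho>(?y := b)"
      assume S: "S \<le> R" and b: "rel S ty1 b (std h)" "isreal h" "pos S (rv h) = Some l"
        and envS: "gen_env S ?\<rho>' k" and T: "T \<le> S"
        and less: "forces T ?\<rho>' (realdist (Var ?x) (Var ?y) \<prec>\<^sub>R real_of_ratcode (Var ?r))"
      have envT: "gen_env T ?\<rho>' k" using envS T gen_env_mono by blast
      have TQ: "T \<le> Q" and TP: "T \<le> P" using T S R Q order_trans by meson+
      have x': "fval T ?\<rho>' (Var ?x) g"
        by (rule fval_Var) (use rel_mono[OF a(1) TQ] in \<open>simp_all del: rel.simps\<close>)
      have y: "fval T ?\<rho>' (Var ?y) h"
        by (rule fval_Var) (use rel_mono[OF b(1) T] in \<open>simp_all del: rel.simps\<close>)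
      have "val T ?\<rho>' (Var ?r) c" by (rule val_Var) simp
      then have r': "fval T ?\<rho>' (real_of_ratcode (Var ?r)) (\<lambda>_. c)"
        by (rule fval_real_of_ratcode[OF num_tm_Var _ gen_env_env[OF envT]])
      obtain m where "qv (ndist (g (m + 1)) (h (m + 1))) + 2 / 2 ^ m < qv c"
        using forces_realless[OF gen_env_env[OF envT] fval_realdist[OF gen_env_env[OF envT] x' y] r'] less
        by blast
      then have "dist (rv h) (rv g) < e"
        using rv_dist_less[OF a(2) b(2)] c(2) by (fastforce simp: dist_real_def abs_minus_commute)
      then have "rv h \<notin> small P k" by (rule e(2))
      moreover have l: "pos T (rv h) = Some l" using map_le_SomeD[OF pos_mono[OF T]] b(3) .
      ultimately have "k \<le> l" using small_mono[OF spare TP l] by force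
      then show "forces T ?\<rho>' (Var ?y \<epsilon> Yn)" using forces_mem[OF envT y l] by blast
    qed
    ultimately show "forces R ?\<rho> (\<^bold>0 \<prec>\<^sub>Q Var ?r \<^bold>\<and> ForallR ?y
        (realdist (Var ?x) (Var ?y) \<prec>\<^sub>R real_of_ratcode (Var ?r) \<^bold>\<longrightarrow> Var ?y \<epsilon> Yn))"
      unfolding forces_Conj by blast
  qed
qed

text \<open>An open interval minus the finite set \<open>small P k\<close> is open and nonempty, so
  it contains a rational, available in the model as a constant sequence. Its generic value, once
  assigned, is at least \<open>k\<close>.\<close>

lemma forces_dense_R:
  assumes \<rho>: "gen_env P \<rho> k" and spare: "spare P \<inter> {..<k} = {}"
  shows "forces P \<rho> (dense_R Yn)"
  unfolding dense_R_def Let_def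
proof (rule forces_ForallRI[OF \<rho> order_refl], rule forces_ForallRI[OF _ le_SucI[OF order_refl]])
  let ?a = "(fresh Yn, ty1)" and ?b = "(Suc (fresh Yn), ty1)" and ?x = "(Suc (Suc (fresh Yn)), ty1)"
  { fix Q a g j
    assume "gen_env Q (\<rho>(?a := a)) k"
    then show "gen_env Q (\<rho>(?a := a)) k" . }
  fix Q a g j R b h l
  let ?\<rho> = "\<rho>(?a := a, ?b := b)"
  assume Q: "Q \<le> P" and a: "rel Q ty1 a (std g)" "isreal g"
    and R: "R \<le> Q" and b: "rel R ty1 b (std h)" "isreal h" and env: "gen_env R ?\<rho> k"
  let ?A = "Var ?a \<prec>\<^sub>R Var ?x \<^bold>\<and> Var ?x \<prec>\<^sub>R Var ?b \<^bold>\<and> Var ?x \<epsilon> Yn"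
  have ga: "fval R ?\<rho> (Var ?a) g"
    by (rule fval_Var) (use rel_mono[OF a(1) R] in \<open>simp_all del: rel.simps\<close>)
  have hb: "fval R ?\<rho> (Var ?b) h"
    by (rule fval_Var) (use b(1) in \<open>simp_all del: rel.simps\<close>)
  show "forces R ?\<rho> (Var ?a \<prec>\<^sub>R Var ?b \<^bold>\<longrightarrow> ExistsR ?x ?A)"
  proof (rule forces_ImpI)
    fix S assume S: "S \<le> R" and less: "forces S ?\<rho> (Var ?a \<prec>\<^sub>R Var ?b)"
    have "rv g < rv h"
      using less rv_less_iff[OF a(2) b(2)]
        forces_realless[OF gen_env_env[OF gen_env_mono[OF env S]] fval_mono[OF ga S] fval_mono[OF hb S]]
      by blast
    then have "infinite {rv g<..<rv h}" by (rule infinite_Ioo)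
    then have "{rv g<..<rv h} - small P k \<noteq> {}"
      using finite_small[of P k] by (metis Diff_eq_empty_iff finite_subset)
    moreover have "open ({rv g<..<rv h} - small P k)"
      by (intro open_Diff finite_imp_closed finite_small) simp
    ultimately obtain u e where u: "e > 0" "\<And>z. dist z u < e \<Longrightarrow> z \<in> {rv g<..<rv h} - small P k"
      unfolding open_dist by (metis ex_in_conv)
    obtain z where z: "z \<in> \<rat>" "u < z" "z < u + e"
      using Rats_dense_in_real[of u "u + e"] u(1) by auto
    then have "dist z u < e" by (simp add: dist_real_def)
    then have zin: "rv g < z" "z < rv h" "z \<notin> small P k" using u(2) by auto
    obtain c where c: "qv c = z" using qv_surj_rat[OF z(1)] by blast
    show "forces S ?\<rho> (ExistsR ?x ?A)"
    proof (rule forces_dense)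
      fix T assume T: "T \<le> S"
      obtain U m where U: "U \<le> T" "pos U z = Some m" using ex_pos by blast
      have UR: "U \<le> R" and UP: "U \<le> P" using U T S R Q order_trans by meson+
      let ?\<rho>' = "?\<rho>(?x := std (\<lambda>_. c))"
      have env': "gen_env U ?\<rho>' k"
        by (rule gen_env_upd[OF gen_env_mono[OF env UR] le_SucI[OF le_SucI[OF order_refl]] rel_std])
      have x: "fval U ?\<rho>' (Var ?x) (\<lambda>_. c)"
        by (rule fval_Var) (use rel_std in \<open>simp_all del: rel.simps\<close>)
      have ga': "fval U ?\<rho>' (Var ?a) g"
        by (rule fval_Var) (use rel_mono[OF a(1) order_trans[OF UR R]] in \<open>simp_all del: rel.simps\<close>)
      have hb': "fval U ?\<rho>' (Var ?b) h"
        by (rule fval_Var) (use rel_mono[OF b(1) UR] in \<open>simp_all del: rel.simps\<close>)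
      have m: "pos U (rv (\<lambda>_. c)) = Some m" using U(2) c by (simp add: rv_const)
      have "k \<le> m" using small_mono[OF spare UP U(2)] zin(3) by force
      then have "forces U ?\<rho>' (Var ?x \<epsilon> Yn)" using forces_mem[OF env' x m] by blast
      moreover have "forces U ?\<rho>' (Var ?a \<prec>\<^sub>R Var ?x)"
        using forces_realless[OF gen_env_env[OF env'] ga' x] zin(1)
        unfolding rv_less_iff[OF a(2) isreal_const] unfolding rv_const c by blast
      moreover have "forces U ?\<rho>' (Var ?x \<prec>\<^sub>R Var ?b)"
        using forces_realless[OF gen_env_env[OF env'] x hb'] zin(2)
        unfolding rv_less_iff[OF isreal_const b(2)] unfolding rv_const c by blast
      moreover have "forces U ?\<rho>' (is_real (Var ?x))"
        using forces_is_real[OF gen_env_env[OF env'] x] isreal_const by blast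
      ultimately have "forces U ?\<rho> (ExistsR ?x ?A)"
        unfolding ExistsR_def
        by (intro forces_ExistsI[of _ _ "std (\<lambda>_. c)"])
          (simp_all only: forces_Conj snd_conv rel_std)
      then show "\<exists>U\<le>T. forces U ?\<rho> (ExistsR ?x ?A)" using U(1) by blast
    qed
  qed
qed

lemma forces_open_dense:
  assumes "env P \<rho>" "\<rho> Y = Or generic"
  shows "forces P \<rho> (Forall n (real_function Yn \<^bold>\<and> open_R Yn \<^bold>\<and> dense_R Yn))"
proof (rule forces_ForallI, rule forces_dense)
  fix Q a R assume Q: "Q \<le> P" "rel Q (snd n) a a" "R \<le> Q"
  let ?\<rho> = "\<rho>(n := a)"
  have "rel R N a a" using Q rel_mono n by metis
  then obtain S k where S: "S \<le> R" "rel S N a (Num k)" using rel_N_Num by blast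
  \<comment> \<open>The values below \<open>k\<close> are discarded after \<open>n\<close> has
    become the numeral \<open>k\<close>. No single condition could do this for all \<open>k\<close>,
    as its reserve would be empty; density makes that unnecessary.\<close>
  obtain T where T: "T \<le> S" "spare T \<inter> {..<k} = {}" using ex_spare_ge by blast
  have "Y \<noteq> n" using Y n by auto
  moreover have "env T ?\<rho>"
    using assms(1) Q S(1) T(1) env_upd env_mono rel_mono order_trans by meson
  ultimately have "gen_env T ?\<rho> k"
    using assms(2) rel_mono[OF S(2) T(1)] by (simp add: gen_env_def del: rel.simps)
  then have "forces T ?\<rho> (real_function Yn \<^bold>\<and> open_R Yn \<^bold>\<and> dense_R Yn)"
    using forces_real_function forces_open forces_dense_R T(2) unfolding forces_Conj by blast
  then show "\<exists>T\<le>R. forces T ?\<rho> (real_function Yn \<^bold>\<and> open_R Yn \<^bold>\<and> dense_R Yn)"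
    using S(1) T(1) order_trans by blast
qed

lemma not_forces_inter:
  assumes \<rho>: "env P \<rho>" "\<rho> Y = Or generic" and x: "snd x = ty1"
  shows "\<not> forces P \<rho> (ExistsR x (Forall n (Var x \<epsilon> Yn)))"
proof
  assume "forces P \<rho> (ExistsR x (Forall n (Var x \<epsilon> Yn)))"
  then obtain Q a where Q: "Q \<le> P" "rel Q ty1 a a" "forces Q (\<rho>(x := a)) (Forall n (Var x \<epsilon> Yn))"
    unfolding ExistsR_def forces_Exists forces_Conj x by (meson order_refl)
  obtain R g where R: "R \<le> Q" "rel R ty1 a (std g)" using rel_ty1_std[OF Q(2)] by blast
  obtain S j where S: "S \<le> R" "pos S (rv g) = Some j" using ex_pos by blast
  \<comment> \<open>The real has the generic value \<open>j\<close>, so it is missing from the set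
    with index \<open>Suc j\<close>.\<close>
  let ?\<rho> = "\<rho>(x := a, n := Num (Suc j))"
  have ne: "x \<noteq> n" "x \<noteq> Y" "Y \<noteq> n" using x Y n by auto
  have "env S ?\<rho>"
    using \<rho>(1) Q(1,2) R(1) S(1) env_mono rel_mono order_trans x n rel_Num by (metis env_upd)
  then have env: "gen_env S ?\<rho> (Suc j)"
    using \<rho>(2) ne rel_Num by (simp add: gen_env_def del: rel.simps)
  have "fval S ?\<rho> (Var x) g"
    by (rule fval_Var) (use x ne rel_mono[OF R(2) S(1)] in \<open>simp_all del: rel.simps\<close>)
  moreover have "forces S ?\<rho> (Var x \<epsilon> Yn)"
  proof (rule forces_ForallD)
    show "forces S (\<rho>(x := a)) (Forall n (Var x \<epsilon> Yn))"
      using Q(3) R(1) S(1) forces_mono order_trans by blast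
  qed (simp only: n rel_Num)
  ultimately show False using forces_mem[OF env _ S(2)] by simp
qed

end

lemma not_valid_BCT: "\<not> valid BCT"
proof
  assume valid: "valid BCT"
  \<comment> \<open>Any condition serves: failure at a single one refutes validity.\<close>
  obtain P :: cond where True by blast
  let ?Y = "(0, N \<rightarrow> ty1 \<rightarrow> ty1) :: var" and ?n = "(0, N) :: var" and ?x = "(0, ty1) :: var"
  let ?\<rho> = "dflt_env(?Y := Or generic)"
  have "forces P dflt_env BCT" using valid env_dflt unfolding valid_def by blast
  then have imp: "forces P ?\<rho> (Forall ?n (real_function (Var ?Y \<cdot> Var ?n) \<^bold>\<and>
      open_R (Var ?Y \<cdot> Var ?n) \<^bold>\<and> dense_R (Var ?Y \<cdot> Var ?n)) \<^bold>\<longrightarrow>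
      ExistsR ?x (Forall ?n (Var ?x \<epsilon> Var ?Y \<cdot> Var ?n)))"
    unfolding BCT_def Let_def by (rule forces_ForallD) (simp only: snd_conv rel_generic)
  have env: "env P ?\<rho>" by (rule env_upd[OF env_dflt]) (simp only: snd_conv rel_generic)
  have "forces P ?\<rho> (Forall ?n (real_function (Var ?Y \<cdot> Var ?n) \<^bold>\<and>
      open_R (Var ?Y \<cdot> Var ?n) \<^bold>\<and> dense_R (Var ?Y \<cdot> Var ?n)))"
    by (rule forces_open_dense[OF _ _ env]) simp_all
  then have "forces P ?\<rho> (ExistsR ?x (Forall ?n (Var ?x \<epsilon> Var ?Y \<cdot> Var ?n)))"
    using imp order_refl unfolding forces.simps(4) by blast
  moreover have "\<not> forces P ?\<rho> (ExistsR ?x (Forall ?n (Var ?x \<epsilon> Var ?Y \<cdot> Var ?n)))"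
    by (rule not_forces_inter[OF _ _ env]) simp_all
  ultimately show False by blast
qed

theorem theorem6p16:
  shows "\<not> (Z2\<omega> \<union> QF_AC N ty1 \<turnstile> BCT)"
  using soundness valid_axioms not_valid_BCT by blast

end
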